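(* Let $\mathfrak a\subset\mathfrak p$ be an Abelian subalgebra, $A=\exp(\mathfrak a)$, and let $\mu_{\mathfrak a}=\pi_{\mathfrak a}\circ\mu_{\mathfrak p}:\mathbb P(V)\to\mathfrak a$ be the $A$-gradient map. Then $\mu_{\mathfrak a}(\mathbb P(V))=\mu_{\mathfrak a}(\mathcal O)$. If moreover $\mathfrak a$ is a maximal Abelian subalgebra of $\mathfrak p$, then $\mu_{\mathfrak a}(\mathbb P(V))$ is the convex hull of an orbit in $\mathfrak a$ of the Weyl group $\mathcal W=N_K(\mathfrak a)/K^{\mathfrak a}$.
   Context: Setting: $G$ is a connected noncompact real semisimple Lie group with finite center, $K\subset G$ a maximal compact subgroup, $\mathfrak g=\mathfrak k\oplus\mathfrak p$ the corresponding Cartan decomposition, and $\tau:G\to \mathrm{SL}(V)$ an irreducible representation on a finite-dimensional complex vector space $V$. $h$ is a Hermitian scalar product on $V$ such that $\tau(G)$ is compatible with $\mathrm{SU}(V,h)^{\mathbb C}$, i.e. $\tau(K)\subset \mathrm{SU}(V,h)$, $\tau(\mathfrak p)\subset i\,\mathfrak{su}(V,h)$ and $\tau(G)=\tau(K)\exp(\tau(\mathfrak p))$. $G$ is identified with $\tau(G)$; elements of $\mathfrak p$ are thus Hermitian endomorphisms of $V$, and $G$ acts on $\mathbb P(V)$. Gradient map: fix an $\mathrm{Ad}(K)$-invariant scalar product $\langle\cdot,\cdot\rangle$ on $\mathfrak p$. The $G$-gradient map $\mu_{\mathfrak p}:\mathbb P(V)\to\mathfrak p$ is determined by $\langle\mu_{\mathfrak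 p}([v]),\beta\rangle=h(\beta v,v)/h(v,v)$ for all $\beta\in\mathfrak p$. For $\mathfrak a\subset\mathfrak p$ Abelian, $\pi_{\mathfrak a}:\mathfrak p\to\mathfrak a$ is the orthogonal projection. The orbit $\mathcal O$: let $U^{\mathbb C}$ be the Zariski closure of $\tau(G)$ in $\mathrm{SL}(V)$; it is complex semisimple, acts irreducibly on $V$, and has a unique closed orbit $\mathcal O'$ in $\mathbb P(V)$. $\mathcal O$ is the unique closed $G$-orbit contained in $\mathcal O'$; it is a $K$-orbit. $N_K(\mathfrak a)=\{k\in K:\mathrm{Ad}(k)\mathfrak a=\mathfrak a\}$ and $K^{\mathfrak a}=\{k\in K:\mathrm{Ad}(k)z=z\ \forall z\in\mathfrak a\}$. *)

theory Defs
  imports "HOL-Analysis.Analysis"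
begin

text \<open>
  The representation space is \<open>V = complex^'n\<close>, endomorphisms of \<open>V\<close> are matrices of type
  \<open>complex^'n^'n\<close>, and the group \<open>G\<close> is identified with its image in \<open>SL(V)\<close>.
\<close>

type_synonym 'n cmat = "complex^'n^'n"

subsection \<open>Matrix Lie groups and their Lie algebras\<close>

definition matpow :: "'n::finite cmat \<Rightarrow> nat \<Rightarrow> 'n cmat" where
  "matpow X k = ((\<lambda>Y. X ** Y) ^^ k) (mat 1)"

text \<open>The constant \<open>exp\<close> of the library is not available here, since \<open>*\<close> on vectors is
  componentwise.\<close>

definition mexp :: "'n::finite cmat \<Rightarrow> 'n cmat" where
  "mexp X = (\<Sum>k. (1 / fact k) *\<^sub>R matpow X k)"

definition SL :: "('n::finite cmat) set" where
  "SL = {g. det g = 1}"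

definition matrix_group :: "('n::finite cmat) set \<Rightarrow> bool" where
  "matrix_group G \<longleftrightarrow> mat 1 \<in> G \<and> (\<forall>g\<in>G. \<forall>g'\<in>G. g ** g' \<in> G)
     \<and> (\<forall>g\<in>G. invertible g \<and> matrix_inv g \<in> G)"

definition group_center :: "('n::finite cmat) set \<Rightarrow> 'n cmat set" where
  "group_center G = {z\<in>G. \<forall>g\<in>G. z ** g = g ** z}"

definition maximal_compact_subgroup :: "('n::finite cmat) set \<Rightarrow> 'n cmat set \<Rightarrow> bool" where
  "maximal_compact_subgroup K G \<longleftrightarrow>
     matrix_group K \<and> compact K \<and> K \<subseteq> G \<and>
     (\<forall>K'. matrix_group K' \<and> compact K' \<and> K \<subseteq> K' \<and> K' \<subseteq> G \<longrightarrow> K' = K)"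

text \<open>For a closed matrix group \<open>G\<close> this is the Lie algebra of \<open>G\<close>.\<close>

definition lie_algebra :: "('n::finite cmat) set \<Rightarrow> 'n cmat set" where
  "lie_algebra G = {X. \<forall>t::real. mexp (t *\<^sub>R X) \<in> G}"

definition lie_bracket :: "'n::finite cmat \<Rightarrow> 'n cmat \<Rightarrow> 'n cmat" where
  "lie_bracket X Y = X ** Y - Y ** X"

definition Ad :: "'n::finite cmat \<Rightarrow> 'n cmat \<Rightarrow> 'n cmat" where
  "Ad g X = g ** X ** matrix_inv g"

subsection \<open>Semisimplicity and Cartan decompositions of real Lie algebras of matrices\<close>

definition lie_ideal :: "('n::finite cmat) set \<Rightarrow> 'n cmat set \<Rightarrow> bool" where
  "lie_ideal I g \<longleftrightarrow> subspace I \<and> I \<subseteq> g \<and> (\<forall>X\<in>g. \<forall>Y\<in>I. lie_bracket X Y \<in> I)"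

definition derived_algebra :: "('n::finite cmat) set \<Rightarrow> 'n cmat set" where
  "derived_algebra g = span {lie_bracket X Y | X Y. X \<in> g \<and> Y \<in> g}"

definition solvable_lie_algebra :: "('n::finite cmat) set \<Rightarrow> bool" where
  "solvable_lie_algebra g \<longleftrightarrow> (\<exists>m. (derived_algebra ^^ m) g = {0})"

definition semisimple_lie_algebra :: "('n::finite cmat) set \<Rightarrow> bool" where
  "semisimple_lie_algebra g \<longleftrightarrow> (\<forall>I. lie_ideal I g \<and> solvable_lie_algebra I \<longrightarrow> I = {0})"

text \<open>Trace of an endomorphism \<open>f\<close> of the real subspace \<open>S\<close>; the value does not depend on
  the chosen basis.\<close>

definition trace_on :: "'v::real_vector set \<Rightarrow> ('v \<Rightarrow> 'v) \<Rightarrow> real" where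
  "trace_on S f =
     (let B = (SOME B. B \<subseteq> S \<and> independent B \<and> S \<subseteq> span B)
      in \<Sum>b\<in>B. representation B (f b) b)"

definition killing_form :: "('n::finite cmat) set \<Rightarrow> 'n cmat \<Rightarrow> 'n cmat \<Rightarrow> real" where
  "killing_form g X Y = trace_on g (\<lambda>Z. lie_bracket X (lie_bracket Y Z))"

definition cartan_decomposition ::
  "('n::finite cmat) set \<Rightarrow> 'n cmat set \<Rightarrow> 'n cmat set \<Rightarrow> bool" where
  "cartan_decomposition g k p \<longleftrightarrow>
     subspace k \<and> subspace p \<and> g = {X + Y | X Y. X \<in> k \<and> Y \<in> p} \<and> k \<inter> p = {0} \<and>
     (\<forall>X\<in>k. \<forall>Y\<in>k. lie_bracket X Y \<in> k) \<and>
     (\<forall>X\<in>k. \<forall>Y\<in>p. lie_bracket X Y \<in> p) \<and>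
     (\<forall>X\<in>p. \<forall>Y\<in>p. lie_bracket X Y \<in> k) \<and>
     (\<forall>X\<in>k. X \<noteq> 0 \<longrightarrow> killing_form g X X < 0) \<and>
     (\<forall>X\<in>p. X \<noteq> 0 \<longrightarrow> killing_form g X X > 0)"

definition abelian_subalgebra :: "('n::finite cmat) set \<Rightarrow> 'n cmat set \<Rightarrow> bool" where
  "abelian_subalgebra a p \<longleftrightarrow>
     subspace a \<and> a \<subseteq> p \<and> (\<forall>X\<in>a. \<forall>Y\<in>a. lie_bracket X Y = 0)"

definition maximal_abelian_subalgebra :: "('n::finite cmat) set \<Rightarrow> 'n cmat set \<Rightarrow> bool" where
  "maximal_abelian_subalgebra a p \<longleftrightarrow>
     abelian_subalgebra a p \<and> (\<forall>a'. abelian_subalgebra a' p \<and> a \<subseteq> a' \<longrightarrow> a' = a)"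

subsection \<open>Hermitian structure and compatibility\<close>

definition hermitian_scalar_product ::
  "(complex^'n::finite \<Rightarrow> complex^'n \<Rightarrow> complex) \<Rightarrow> bool" where
  "hermitian_scalar_product h \<longleftrightarrow>
     (\<forall>u v w. h (u + v) w = h u w + h v w) \<and>
     (\<forall>c u v. h (c *s u) v = c * h u v) \<and>
     (\<forall>u v. h v u = cnj (h u v)) \<and>
     (\<forall>v. v \<noteq> 0 \<longrightarrow> Re (h v v) > 0)"

definition SU :: "(complex^'n::finite \<Rightarrow> complex^'n \<Rightarrow> complex) \<Rightarrow> 'n cmat set" where
  "SU h = {g. det g = 1 \<and> (\<forall>u v. h (g *v u) (g *v v) = h u v)}"

definition su_algebra :: "(complex^'n::finite \<Rightarrow> complex^'n \<Rightarrow> complex) \<Rightarrow> 'n cmat set" where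
  "su_algebra h = {X. trace X = 0 \<and> (\<forall>u v. h (X *v u) v = - h u (X *v v))}"

text \<open>Here \<open>mat \<i> ** X\<close> is the scalar multiple of \<open>X\<close> by the imaginary unit.\<close>

definition compatible ::
  "(complex^'n::finite \<Rightarrow> complex^'n \<Rightarrow> complex) \<Rightarrow> 'n cmat set \<Rightarrow> 'n cmat set \<Rightarrow> 'n cmat set \<Rightarrow> bool" where
  "compatible h G K p \<longleftrightarrow>
     K \<subseteq> SU h \<and> p \<subseteq> (\<lambda>X. mat \<i> ** X) ` su_algebra h \<and>
     G = {k ** mexp X | k X. k \<in> K \<and> X \<in> p}"

definition irreducible_action :: "('n::finite cmat) set \<Rightarrow> bool" where
  "irreducible_action G \<longleftrightarrow>
     (\<forall>W :: (complex^'n) set. vec.subspace W \<and> (\<forall>g\<in>G. \<forall>w\<in>W. g *v w \<in> W)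
        \<longrightarrow> W = {0} \<or> W = UNIV)"

subsection \<open>Projective space and closed orbits\<close>

text \<open>Points of the projective space are the complex lines in \<open>V\<close>, as subsets of \<open>V\<close>.\<close>

definition proj :: "complex^'n::finite \<Rightarrow> (complex^'n) set" where
  "proj v = vec.span {v}"

definition PV :: "(complex^'n::finite) set set" where
  "PV = proj ` {v. v \<noteq> 0}"

text \<open>Closedness in the quotient topology on the projective space.\<close>

definition closed_in_PV :: "(complex^'n::finite) set set \<Rightarrow> bool" where
  "closed_in_PV S \<longleftrightarrow>
     S \<subseteq> PV \<and> closedin (top_of_set {v. v \<noteq> 0}) {v. v \<noteq> 0 \<and> proj v \<in> S}"

definition proj_orbit :: "('n::finite cmat) set \<Rightarrow> (complex^'n) set \<Rightarrow> (complex^'n) set set" where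
  "proj_orbit G L = (\<lambda>g. (\<lambda>v. g *v v) ` L) ` G"

definition is_closed_orbit :: "('n::finite cmat) set \<Rightarrow> (complex^'n) set set \<Rightarrow> bool" where
  "is_closed_orbit G S \<longleftrightarrow> (\<exists>L\<in>PV. S = proj_orbit G L) \<and> closed_in_PV S"

text \<open>Complex polynomial functions in the matrix entries. (The library's
  \<open>polynomial_function\<close> is about real polynomials and would also admit complex conjugation.)\<close>

inductive_set complex_polynomials :: "('n::finite cmat \<Rightarrow> complex) set" where
  const: "(\<lambda>_. c) \<in> complex_polynomials"
| entry: "(\<lambda>X. X $ i $ j) \<in> complex_polynomials"
| add: "f \<in> complex_polynomials \<Longrightarrow> f' \<in> complex_polynomials
          \<Longrightarrow> (\<lambda>X. f X + f' X) \<in> complex_polynomials"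
| mult: "f \<in> complex_polynomials \<Longrightarrow> f' \<in> complex_polynomials
          \<Longrightarrow> (\<lambda>X. f X * f' X) \<in> complex_polynomials"

definition zariski_closure_SL :: "('n::finite cmat) set \<Rightarrow> 'n cmat set" where
  "zariski_closure_SL G =
     {x\<in>SL. \<forall>f\<in>complex_polynomials. (\<forall>g\<in>G. f g = 0) \<longrightarrow> f x = 0}"

subsection \<open>Gradient maps\<close>

definition Ad_invariant_scalar_product ::
  "('n::finite cmat) set \<Rightarrow> 'n cmat set \<Rightarrow> ('n cmat \<Rightarrow> 'n cmat \<Rightarrow> real) \<Rightarrow> bool" where
  "Ad_invariant_scalar_product K p ip \<longleftrightarrow>
     (\<forall>X\<in>p. \<forall>Y\<in>p. \<forall>Z\<in>p. ip (X + Y) Z = ip X Z + ip Y Z) \<and>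
     (\<forall>c. \<forall>X\<in>p. \<forall>Y\<in>p. ip (c *\<^sub>R X) Y = c * ip X Y) \<and>
     (\<forall>X\<in>p. \<forall>Y\<in>p. ip X Y = ip Y X) \<and>
     (\<forall>X\<in>p. X \<noteq> 0 \<longrightarrow> ip X X > 0) \<and>
     (\<forall>k\<in>K. \<forall>X\<in>p. \<forall>Y\<in>p. ip (Ad k X) (Ad k Y) = ip X Y)"

definition gradient_map ::
  "(complex^'n::finite \<Rightarrow> complex^'n \<Rightarrow> complex) \<Rightarrow> ('n cmat \<Rightarrow> 'n cmat \<Rightarrow> real) \<Rightarrow> 'n cmat set
     \<Rightarrow> (complex^'n) set \<Rightarrow> 'n cmat" where
  "gradient_map h ip p L =
     (THE X. X \<in> p \<and>
        (\<forall>\<beta>\<in>p. \<forall>v\<in>L. v \<noteq> 0 \<longrightarrow> complex_of_real (ip X \<beta>) = h (\<beta> *v v) v / h v v))"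

definition orth_projection ::
  "('n::finite cmat \<Rightarrow> 'n cmat \<Rightarrow> real) \<Rightarrow> 'n cmat set \<Rightarrow> 'n cmat \<Rightarrow> 'n cmat" where
  "orth_projection ip a X = (THE Y. Y \<in> a \<and> (\<forall>Z\<in>a. ip (X - Y) Z = 0))"

definition A_gradient_map ::
  "(complex^'n::finite \<Rightarrow> complex^'n \<Rightarrow> complex) \<Rightarrow> ('n cmat \<Rightarrow> 'n cmat \<Rightarrow> real) \<Rightarrow> 'n cmat set
     \<Rightarrow> 'n cmat set \<Rightarrow> (complex^'n) set \<Rightarrow> 'n cmat" where
  "A_gradient_map h ip p a = orth_projection ip a \<circ> gradient_map h ip p"

subsection \<open>The Weyl group\<close>

definition normalizer_in :: "('n::finite cmat) set \<Rightarrow> 'n cmat set \<Rightarrow> 'n cmat set" where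
  "normalizer_in K a = {k\<in>K. Ad k ` a = a}"

definition centralizer_in :: "('n::finite cmat) set \<Rightarrow> 'n cmat set \<Rightarrow> 'n cmat set" where
  "centralizer_in K a = {k\<in>K. \<forall>Z\<in>a. Ad k Z = Z}"

text \<open>The set of cosets of the centralizer in the normalizer. A coset acts on \<open>a\<close> by \<open>Ad k\<close>
  for any of its representatives \<open>k\<close>.\<close>

definition weyl_group :: "('n::finite cmat) set \<Rightarrow> 'n cmat set \<Rightarrow> 'n cmat set set" where
  "weyl_group K a = (\<lambda>k. (\<lambda>c. k ** c) ` centralizer_in K a) ` normalizer_in K a"

definition weyl_orbit :: "('n::finite cmat) set \<Rightarrow> 'n cmat set \<Rightarrow> 'n cmat \<Rightarrow> 'n cmat set" where
  "weyl_orbit K a x = (\<Union>w\<in>weyl_group K a. (\<lambda>k. Ad k x) ` w)"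

end

theory Submission
  imports Defs
begin

text \<open>
  In a basis \<open>f\<close> of simultaneous eigenvectors of \<open>\<aa>\<close>, orthonormal for \<open>h\<close>, the value of the \<open>A\<close>-gradient
  map at \<open>[v]\<close> is the convex combination of the weights of \<open>\<aa>\<close> with coefficients \<open>|v\<^sub>i|\<^sup>2 / |v|\<^sup>2\<close>. So the
  image of the projective space is the polytope spanned by the weights.

  The orbit contains a line \<open>[v]\<close> with all coordinates nonzero: since \<open>G\<close> is connected and acts
  irreducibly, \<open>U v\<close> spans the whole space for every neighbourhood \<open>U\<close> of \<open>1\<close> in \<open>G\<close>
  (\<open>neighbourhood_orbit_spans\<close>), and coordinates can be made nonzero one at a time by small moves. The
  gradient map on \<open>A[v]\<close> comes arbitrarily close to every point of the polytope, because approximating a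
  point amounts to finding almost critical points of a positive sum of exponentials on \<open>\<aa>\<close>
  (\<open>moment_approximation\<close>). The orbit is closed and the projective space is compact, so every point of
  the polytope is attained on the orbit (\<open>image_orbit\<close>).

  Now let \<open>\<aa>\<close> be maximal Abelian. The polytope is spanned by the weights that are the strict maximum of
  some regular \<open>\<beta> \<in> \<aa>\<close>, and it remains to see that the Weyl group permutes these vertices
  transitively. For each vertex the orbit contains a weight vector: apply \<open>exp(t \<beta>)\<close> to a vector with
  nonzero coordinates and let \<open>t\<close> tend to infinity. At such a vector \<open>v\<close>, the odd polynomial
  \<open>sgn(ad \<beta>)\<close> carries \<open>\<pp>\<close> to the Lie algebra of \<open>K\<close> and shows that the directions \<open>\<pp> v\<close> are tangent to the
  \<open>K\<close>-orbit of \<open>[v]\<close>. Hence the flows of elements of \<open>\<pp>\<close> preserve this \<open>K\<close>-orbit, and it is all of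
  \<open>\<O>\<close> (\<open>mexp_p_in_K_orbit_cone\<close>, \<open>K_transitive\<close>). Two vertices thus have weight vectors \<open>v\<close> and \<open>w\<close>
  conjugate under some \<open>k \<in> K\<close>. The gradient at \<open>w\<close>, for the trace form, commutes with the regular
  element of \<open>w\<close> and with the conjugate by \<open>k\<close> of that of \<open>v\<close>. A maximum argument over the centralizer of
  the gradient in \<open>K\<close> changes \<open>k\<close> into an element normalizing \<open>\<aa>\<close> that still takes one weight to the
  other (\<open>exposed_weights_conjugate\<close>).
\<close>

section \<open>Matrices acting on complex vectors\<close>

lemma scaleR_eq_vector_scalar: "r *\<^sub>R (v :: complex^'n) = complex_of_real r *s v"
  by (simp add: vec_eq_iff scaleR_conv_of_real[where 'a=complex])

lemma scaleR_matrix_mult: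
  fixes A B :: "('n::finite) cmat"
  shows "(r *\<^sub>R A) ** B = r *\<^sub>R (A ** B)" and "A ** (r *\<^sub>R B) = r *\<^sub>R (A ** B)"
  by (simp_all add: matrix_matrix_mult_def vec_eq_iff scaleR_sum_right)

lemma scaleR_matrix_vector: "(r *\<^sub>R (A :: ('n::finite) cmat)) *v v = complex_of_real r *s (A *v v)"
  by (simp add: scaleR_eq_vector_scalar[symmetric] matrix_vector_mult_def vec_eq_iff scaleR_sum_right)

lemma matrix_diff_mult:
  fixes A B C :: "('n::finite) cmat"
  shows "(A - B) ** C = A ** C - B ** C" and "C ** (A - B) = C ** A - C ** B"
  by (simp_all add: matrix_matrix_mult_def vec_eq_iff sum_subtractf algebra_simps)

lemma matrix_add_mult:
  fixes A B C :: "('n::finite) cmat"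
  shows "(A + B) ** C = A ** C + B ** C" and "C ** (A + B) = C ** A + C ** B"
  by (simp_all add: matrix_matrix_mult_def vec_eq_iff sum.distrib algebra_simps)

lemma mat_vector_mult: "mat z *v (v :: complex^'n::finite) = z *s v"
  by (simp add: matrix_vector_mult_def mat_def vec_eq_iff if_distrib[where f="\<lambda>x. x * _"] cong: if_cong)

lemma matrix_vector_sum: "(A :: ('n::finite) cmat) *v (\<Sum>i\<in>S. g i) = (\<Sum>i\<in>S. A *v g i)"
  by (induction S rule: infinite_finite_induct) (auto simp: matrix_vector_right_distrib)

lemma bilinear_matrix_mult: "bilinear ((**) :: ('n::finite) cmat \<Rightarrow> 'n cmat \<Rightarrow> 'n cmat)"
  by (auto simp: bilinear_def intro!: linearI simp: matrix_add_mult scaleR_matrix_mult)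

lemma bounded_bilinear_matrix_mult:
  "bounded_bilinear ((**) :: ('n::finite) cmat \<Rightarrow> 'n cmat \<Rightarrow> 'n cmat)"
  using bilinear_matrix_mult bilinear_conv_bounded_bilinear by blast

lemma bounded_bilinear_matrix_vector_mult:
  "bounded_bilinear ((*v) :: ('n::finite) cmat \<Rightarrow> complex^'n \<Rightarrow> complex^'n)"
proof -
  have "bilinear ((*v) :: 'n cmat \<Rightarrow> complex^'n \<Rightarrow> complex^'n)"
    by (auto simp: bilinear_def intro!: linearI simp: matrix_vector_right_distrib
        matrix_vector_mult_add_rdistrib scaleR_eq_vector_scalar vector_scalar_commute)
      (simp_all add: scaleR_eq_vector_scalar[symmetric] scaleR_matrix_vector)
  then show ?thesis using bilinear_conv_bounded_bilinear by blast
qed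

lemmas continuous_matrix_mult [continuous_intros] =
  bounded_bilinear.continuous_on[OF bounded_bilinear_matrix_mult]
lemmas continuous_matrix_vector_mult [continuous_intros] =
  bounded_bilinear.continuous_on[OF bounded_bilinear_matrix_vector_mult]
lemmas tendsto_matrix_vector_mult [tendsto_intros] =
  bounded_bilinear.tendsto[OF bounded_bilinear_matrix_vector_mult]

lemma linear_trace: "linear (trace :: ('n::finite) cmat \<Rightarrow> complex)"
  by (auto intro!: linearI simp: trace_def sum.distrib scaleR_sum_right)

lemma bounded_linear_trace: "bounded_linear (trace :: ('n::finite) cmat \<Rightarrow> complex)"
  using linear_trace linear_conv_bounded_linear by blast

lemma bounded_linear_vector_scalar: "bounded_linear (\<lambda>z. z *s (v :: complex^'n::finite))"
proof -
  have "linear (\<lambda>z. z *s v)"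
    by (auto intro!: linearI simp: vec_eq_iff algebra_simps)
  then show ?thesis using linear_conv_bounded_linear by blast
qed

lemma complex_subspace_imp_subspace:
  assumes "vec.subspace (W :: (complex^'n::finite) set)"
  shows "subspace W"
  using assms unfolding subspace_def vec.subspace_def
  by (simp add: scaleR_eq_vector_scalar)

lemma matpow_Suc: "matpow X (Suc k) = X ** matpow X k"
  by (simp add: matpow_def)

lemma matpow_0: "matpow X 0 = mat 1"
  by (simp add: matpow_def)

lemma matrix_inv_unique:
  fixes A B :: "('n::finite) cmat"
  assumes "A ** B = mat 1"
  shows "matrix_inv A = B"
proof -
  have BA: "B ** A = mat 1" using assms matrix_left_right_inverse by blast
  have "A ** matrix_inv A = mat 1"
    unfolding matrix_inv_def by (rule someI2[of _ B]) (use assms BA in auto)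
  then have "B ** (A ** matrix_inv A) = B" by simp
  then show ?thesis using BA by (simp add: matrix_mul_assoc)
qed

lemma matrix_inv_cancel:
  fixes A :: "('n::finite) cmat"
  assumes "invertible A"
  shows "A ** matrix_inv A = mat 1" "matrix_inv A ** A = mat 1"
  using assms unfolding invertible_def by (metis matrix_inv_unique)+

lemma matrix_inv_mult:
  fixes A B :: "('n::finite) cmat"
  assumes "invertible A" "invertible B"
  shows "matrix_inv (A ** B) = matrix_inv B ** matrix_inv A"
proof (rule matrix_inv_unique)
  have "A ** B ** (matrix_inv B ** matrix_inv A) = A ** (B ** matrix_inv B) ** matrix_inv A"
    by (simp add: matrix_mul_assoc)
  then show "A ** B ** (matrix_inv B ** matrix_inv A) = mat 1"
    using assms by (simp add: matrix_inv_cancel)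
qed

lemma matrix_inv_inv:
  fixes A :: "('n::finite) cmat"
  assumes "invertible A"
  shows "matrix_inv (matrix_inv A) = A"
  by (rule matrix_inv_unique) (simp add: assms matrix_inv_cancel)

lemma Ad_mult:
  fixes g g' X :: "('n::finite) cmat"
  assumes "invertible g" "invertible g'"
  shows "Ad (g ** g') X = Ad g (Ad g' X)"
  using assms by (simp add: Ad_def matrix_inv_mult matrix_mul_assoc)

lemma Ad_matrix_inv:
  fixes g X :: "('n::finite) cmat"
  assumes "invertible g"
  shows "Ad g (Ad (matrix_inv g) X) = X" and "Ad (matrix_inv g) (Ad g X) = X"
proof -
  have "Ad g (Ad (matrix_inv g) X) = (g ** matrix_inv g) ** X ** (g ** matrix_inv g)"
    by (simp add: Ad_def matrix_inv_inv[OF assms] matrix_mul_assoc)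
  then show "Ad g (Ad (matrix_inv g) X) = X" by (simp add: matrix_inv_cancel[OF assms])
  have "Ad (matrix_inv g) (Ad g X) = (matrix_inv g ** g) ** X ** (matrix_inv g ** g)"
    by (simp add: Ad_def matrix_inv_inv[OF assms] matrix_mul_assoc)
  then show "Ad (matrix_inv g) (Ad g X) = X" by (simp add: matrix_inv_cancel[OF assms])
qed

lemma Ad_product:
  fixes g X Y :: "('n::finite) cmat"
  assumes "invertible g"
  shows "Ad g (X ** Y) = Ad g X ** Ad g Y"
proof -
  have "Ad g X ** Ad g Y = g ** X ** (matrix_inv g ** g) ** Y ** matrix_inv g"
    by (simp add: Ad_def matrix_mul_assoc)
  then show ?thesis by (simp add: matrix_inv_cancel[OF assms] Ad_def matrix_mul_assoc)
qed

lemma linear_Ad: "linear (Ad (g :: ('n::finite) cmat))"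
  by (auto intro!: linearI simp: Ad_def matrix_add_mult scaleR_matrix_mult)

lemma Ad_intertwines:
  fixes g X :: "('n::finite) cmat"
  assumes "invertible g"
  shows "Ad g X *v (g *v v) = g *v (X *v v)"
proof -
  have "Ad g X *v (g *v v) = (g ** X ** (matrix_inv g ** g)) *v v"
    by (simp add: Ad_def matrix_vector_mul_assoc matrix_mul_assoc)
  then show ?thesis by (simp add: matrix_inv_cancel[OF assms] matrix_vector_mul_assoc)
qed

lemma trace_Ad:
  fixes g X Y :: "('n::finite) cmat"
  assumes "invertible g"
  shows "trace (Ad g X ** Y) = trace (X ** Ad (matrix_inv g) Y)"
proof -
  have "trace (Ad g X ** Y) = trace (g ** (X ** matrix_inv g ** Y))"
    by (simp add: Ad_def matrix_mul_assoc)
  also have "\<dots> = trace (X ** matrix_inv g ** Y ** g)" by (rule trace_mul_sym)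
  finally show ?thesis by (simp add: Ad_def matrix_inv_inv[OF assms] matrix_mul_assoc)
qed

section \<open>Hermitian forms and the spectral theorem\<close>

lemma quadratic_nonneg_imp_linear_zero:
  fixes a b :: real
  assumes "\<And>t. 0 \<le> 2 * t * a + t\<^sup>2 * b"
  shows "a = 0"
proof (rule ccontr)
  assume "a \<noteq> 0"
  \<comment> \<open>near \<open>t = 0\<close> the linear term dominates; \<open>t = - a / B\<close> is close enough to \<open>0\<close>\<close>
  define B where "B = \<bar>b\<bar> + 1"
  have B: "B > 0" "b < B" by (auto simp: B_def)
  have "0 \<le> 2 * (- a / B) * a + (- a / B)\<^sup>2 * b" by (rule assms)
  then have "0 \<le> (2 * (- a / B) * a + (- a / B)\<^sup>2 * b) * B\<^sup>2" using B by simp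
  also have "\<dots> = a\<^sup>2 * (b - 2 * B)" using B by (simp add: field_simps power2_eq_square)
  finally have "0 \<le> a\<^sup>2 * (b - 2 * B)" .
  moreover have "a\<^sup>2 > 0" using \<open>a \<noteq> 0\<close> by simp
  ultimately have "b - 2 * B \<ge> 0" by (simp add: zero_le_mult_iff)
  then show False using B by simp
qed

locale hermitian_form =
  fixes h :: "complex^'n::finite \<Rightarrow> complex^'n \<Rightarrow> complex"
  assumes hsp: "hermitian_scalar_product h"
begin

lemma add_left: "h (u + v) w = h u w + h v w"
  and scale_left: "h (c *s u) v = c * h u v"
  and conj_swap: "h v u = cnj (h u v)"
  and positive: "v \<noteq> 0 \<Longrightarrow> Re (h v v) > 0"
  using hsp unfolding hermitian_scalar_product_def by blast+

lemma add_right: "h u (v + w) = h u v + h u w"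
  by (metis conj_swap add_left complex_cnj_add)

lemma scale_right: "h u (c *s v) = cnj c * h u v"
  by (metis conj_swap scale_left complex_cnj_mult)

lemma zero_left [simp]: "h 0 v = 0"
  using scale_left[of 0 v v] by simp

lemma zero_right [simp]: "h v 0 = 0"
  using scale_right[of v 0 v] by simp

lemma diff_left: "h (u - v) w = h u w - h v w"
  using add_left[of "u - v" v w] by simp

lemma diff_right: "h u (v - w) = h u v - h u w"
  using add_right[of u "v - w" w] by simp

lemma sum_left: "h (\<Sum>i\<in>S. g i) v = (\<Sum>i\<in>S. h (g i) v)"
  by (induction S rule: infinite_finite_induct) (auto simp: add_left)

lemma sum_right: "h v (\<Sum>i\<in>S. g i) = (\<Sum>i\<in>S. h v (g i))"
  by (induction S rule: infinite_finite_induct) (auto simp: add_right)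

lemma diagonal_real: "h v v = complex_of_real (Re (h v v))"
  using conj_swap[of v v] by (simp add: complex_eq_iff)

lemma diagonal_eq_0_iff [simp]: "h v v = 0 \<longleftrightarrow> v = 0"
  using positive[of v] by (metis less_irrefl zero_complex.simps(1) zero_left)

lemma diagonal_nonneg: "Re (h v v) \<ge> 0"
  using positive[of v] by (cases "v = 0") auto

lemma bounded_bilinear_form: "bounded_bilinear h"
proof -
  have "bilinear h"
    by (auto simp: bilinear_def intro!: linearI
        simp: add_left add_right scaleR_eq_vector_scalar scale_left scale_right scaleR_conv_of_real[where 'a=complex])
  then show ?thesis using bilinear_conv_bounded_bilinear by blast
qed

lemmas continuous_form [continuous_intros] = bounded_bilinear.continuous_on[OF bounded_bilinear_form]
lemmas tendsto_form [tendsto_intros] = bounded_bilinear.tendsto[OF bounded_bilinear_form]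

definition selfadjoint :: "'n cmat \<Rightarrow> bool" where
  "selfadjoint X \<longleftrightarrow> (\<forall>u v. h (X *v u) v = h u (X *v v))"

definition skewadjoint :: "'n cmat \<Rightarrow> bool" where
  "skewadjoint X \<longleftrightarrow> (\<forall>u v. h (X *v u) v = - h u (X *v v))"

lemma selfadjoint_diagonal_real:
  assumes "selfadjoint X"
  shows "h (X *v v) v = complex_of_real (Re (h (X *v v) v))"
proof -
  have "h (X *v v) v = cnj (h (X *v v) v)"
    using assms conj_swap[of v "X *v v"] by (metis selfadjoint_def)
  then show ?thesis by (simp add: complex_eq_iff)
qed

text \<open>The maximum of the Rayleigh quotient on the unit sphere of \<open>W\<close> is an eigenvalue: at a
  maximiser \<open>w\<close> with value \<open>l\<close> the form \<open>l h(u,u) - h(Zu,u)\<close> is positive semidefinite on \<open>W\<close>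
  and vanishes at \<open>w\<close>, so \<open>w\<close> lies in its radical.\<close>

lemma selfadjoint_eigenvector:
  assumes W: "vec.subspace W" "W \<noteq> {0}" and inv: "\<And>w. w \<in> W \<Longrightarrow> Z *v w \<in> W"
    and Z: "selfadjoint Z"
  obtains u l where "u \<in> W" "u \<noteq> 0" "Z *v u = complex_of_real l *s u"
proof -
  define R where "R w = Re (h (Z *v w) w) / Re (h w w)" for w
  have subW: "subspace W" using W(1) by (rule complex_subspace_imp_subspace)
  have 0: "0 \<in> W" using W(1) vec.subspace_0 by blast
  obtain w0 where w0: "w0 \<in> W" "w0 \<noteq> 0" using W(2) 0 by blast
  have ne: "W \<inter> sphere 0 1 \<noteq> {}"
  proof -
    have "(1 / norm w0) *\<^sub>R w0 \<in> W \<inter> sphere 0 1"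
      using w0 subW by (auto simp: subspace_scale)
    then show ?thesis by blast
  qed
  have "compact (W \<inter> sphere 0 1)"
    by (simp add: closed_Int_compact closed_subspace subW)
  moreover have "continuous_on (W \<inter> sphere 0 1) R"
    unfolding R_def
  proof (intro continuous_intros ballI)
    fix x assume "x \<in> W \<inter> sphere 0 1"
    then have "x \<noteq> 0" by auto
    then show "Re (h x x) \<noteq> 0" using positive[of x] by simp
  qed
  ultimately obtain w where "w \<in> W \<inter> sphere 0 1" "\<forall>u\<in>W \<inter> sphere 0 1. R u \<le> R w"
    using continuous_attains_sup[of "W \<inter> sphere 0 1" R] ne by blast
  then have w: "w \<in> W" "norm w = 1"
      and max: "\<And>u. u \<in> W \<Longrightarrow> norm u = 1 \<Longrightarrow> R u \<le> R w"
    by auto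
  define l where "l = R w"
  define Q where "Q u = l * Re (h u u) - Re (h (Z *v u) u)" for u
  have Q_nonneg: "Q u \<ge> 0" if "u \<in> W" for u
  proof (cases "u = 0")
    case False
    define s where "s = 1 / norm u"
    have s: "s > 0" using False by (simp add: s_def)
    have "R (s *\<^sub>R u) \<le> l"
      unfolding l_def using False that subW by (intro max) (auto simp: subspace_scale s_def)
    moreover have "R (s *\<^sub>R u) = R u"
      unfolding R_def scaleR_eq_vector_scalar vector_scalar_commute
      using s by (simp add: scale_left scale_right)
    ultimately have "R u \<le> l" by simp
    then show ?thesis unfolding R_def Q_def using positive[OF False] by (simp add: field_simps)
  qed (simp add: Q_def)
  have Qw: "Q w = 0"
  proof -
    have "w \<noteq> 0" using w by auto
    then have "Re (h w w) > 0" by (rule positive)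
    then show ?thesis unfolding Q_def l_def R_def by simp
  qed
  define u where "u = complex_of_real l *s w - Z *v w"
  have u: "u \<in> W" unfolding u_def using W(1) w inv by (simp add: vec.subspace_diff vec.subspace_scale)
  have expand: "Q (w + complex_of_real t *s u) = Q w + 2 * t * Re (h u u) + t\<^sup>2 * Q u" for t
  proof -
    have 1: "Re (h u w) = Re (h w u)" using conj_swap[of u w] by simp
    have 2: "Re (h (Z *v u) w) = Re (h (Z *v w) u)"
      using Z conj_swap[of u "Z *v w"] by (simp add: selfadjoint_def)
    have 3: "h u u = l * h w u - h (Z *v w) u"
      using arg_cong[where f="\<lambda>x. h x u", OF u_def] by (simp add: diff_left scale_left)
    show ?thesis
      unfolding Q_def matrix_vector_right_distrib vector_scalar_commute add_left add_right
        scale_left scale_right 3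
      using 1 2 by (simp add: algebra_simps power2_eq_square)
  qed
  have "Re (h u u) = 0"
  proof (rule quadratic_nonneg_imp_linear_zero)
    fix t :: real
    have "w + complex_of_real t *s u \<in> W"
      using W(1) w(1) u by (simp add: vec.subspace_add vec.subspace_scale)
    then show "0 \<le> 2 * t * Re (h u u) + t\<^sup>2 * Q u" using Q_nonneg expand Qw by fastforce
  qed
  then have "u = 0" using positive[of u] by force
  then have "Z *v w = complex_of_real l *s w" by (simp add: u_def)
  moreover have "w \<noteq> 0" using w by auto
  ultimately show ?thesis using that w(1) by blast
qed

text \<open>All nonzero vectors of a minimal invariant subspace are common eigenvectors: an eigenspace of
  one of the matrices is invariant under the others, hence fills the subspace.\<close>

lemma common_eigenvector:
  assumes W: "vec.subspace W" "W \<noteq> {0}" and inv: "\<And>Z w. Z \<in> \<Z> \<Longrightarrow> w \<in> W \<Longrightarrow> Z *v w \<in> W"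
    and sa: "\<And>Z. Z \<in> \<Z> \<Longrightarrow> selfadjoint Z"
    and comm: "\<And>Z Z'. Z \<in> \<Z> \<Longrightarrow> Z' \<in> \<Z> \<Longrightarrow> Z ** Z' = Z' ** Z"
  obtains u where "u \<in> W" "u \<noteq> 0" "\<forall>Z\<in>\<Z>. \<exists>l. Z *v u = complex_of_real l *s u"
proof -
  define ok where "ok U \<longleftrightarrow> vec.subspace U \<and> U \<noteq> {0} \<and> (\<forall>Z\<in>\<Z>. \<forall>u\<in>U. Z *v u \<in> U) \<and> U \<subseteq> W" for U
  have "ok W" using W inv by (auto simp: ok_def)
  then obtain U where U: "ok U" and least: "\<And>U'. ok U' \<Longrightarrow> vec.dim U \<le> vec.dim U'"
    using ex_has_least_nat[of ok W vec.dim] by blast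
  have subU: "vec.subspace U" using U by (simp add: ok_def)
  have all: "\<exists>l. \<forall>u\<in>U. Z *v u = complex_of_real l *s u" if Z: "Z \<in> \<Z>" for Z
  proof -
    obtain u l where u: "u \<in> U" "u \<noteq> 0" "Z *v u = complex_of_real l *s u"
      using selfadjoint_eigenvector[of U Z] U sa Z by (auto simp: ok_def)
    define U' where "U' = {x\<in>U. Z *v x = complex_of_real l *s x}"
    have "vec.subspace U'"
      unfolding U'_def using subU
      by (auto simp: vec.subspace_def matrix_vector_right_distrib vector_scalar_commute
          vector_add_ldistrib vector_smult_assoc mult.commute)
    moreover have "Z' *v x \<in> U'" if "Z' \<in> \<Z>" "x \<in> U'" for Z' x
    proof -
      have "Z *v (Z' *v x) = Z' *v (Z *v x)"
        using comm[OF Z that(1)] by (simp add: matrix_vector_mul_assoc)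
      then show ?thesis using that U by (simp add: U'_def ok_def vector_scalar_commute)
    qed
    ultimately have "ok U'" using u U by (auto simp: ok_def U'_def)
    then have "vec.dim U \<le> vec.dim U'" by (rule least)
    then have "U' = U"
      using \<open>ok U'\<close> U by (intro vec.subspace_dim_equal) (auto simp: ok_def U'_def)
    then show ?thesis by (auto simp: U'_def)
  qed
  obtain u where "u \<in> U" "u \<noteq> 0" using U vec.subspace_0[OF subU] by (auto simp: ok_def)
  have "U \<subseteq> W" using U by (simp add: ok_def)
  then have "u \<in> W" using \<open>u \<in> U\<close> by blast
  moreover have "\<exists>l. Z *v u = complex_of_real l *s u" if "Z \<in> \<Z>" for Z
    using all[OF that] \<open>u \<in> U\<close> by blast
  ultimately show ?thesis using that[of u] \<open>u \<noteq> 0\<close> by blast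
qed

lemma orthonormal_independent:
  assumes fin: "finite B" and B: "\<And>x y. x \<in> B \<Longrightarrow> y \<in> B \<Longrightarrow> h x y = (if x = y then 1 else 0)"
  shows "vec.independent B"
proof
  assume "vec.dependent B"
  then obtain u b where b: "b \<in> B" "u b \<noteq> 0" and s: "(\<Sum>v\<in>B. u v *s v) = 0"
    using vec.dependent_finite[OF fin] by blast
  have "0 = h (\<Sum>v\<in>B. u v *s v) b" by (simp add: s)
  also have "\<dots> = (\<Sum>v\<in>B. if v = b then u v else 0)"
    unfolding sum_left scale_left by (intro sum.cong) (auto simp: B b)
  also have "\<dots> = u b" using b fin by simp
  finally show False using b by simp
qed

text \<open>An orthonormal set of common eigenvectors of maximal cardinality spans the space, because its
  orthogonal complement is invariant and would otherwise contain one more common eigenvector.\<close>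

theorem spectral_theorem:
  assumes sa: "\<And>Z. Z \<in> \<Z> \<Longrightarrow> selfadjoint Z"
    and comm: "\<And>Z Z'. Z \<in> \<Z> \<Longrightarrow> Z' \<in> \<Z> \<Longrightarrow> Z ** Z' = Z' ** Z"
  obtains f :: "'n \<Rightarrow> complex^'n" and l :: "'n \<Rightarrow> 'n cmat \<Rightarrow> real"
    where "\<forall>i j. h (f i) (f j) = (if i = j then 1 else 0)"
      and "\<forall>Z\<in>\<Z>. \<forall>i. Z *v f i = complex_of_real (l i Z) *s f i"
proof -
  define eig where "eig u \<longleftrightarrow> (\<forall>Z\<in>\<Z>. \<exists>l. Z *v u = complex_of_real l *s u)" for u
  define ok where "ok B \<longleftrightarrow> finite B \<and> (\<forall>x\<in>B. eig x) \<and>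
    (\<forall>x\<in>B. \<forall>y\<in>B. h x y = (if x = y then 1 else 0))" for B
  have ind: "vec.independent B" if "ok B" for B
    using that by (intro orthonormal_independent) (auto simp: ok_def)
  have bound: "card B < Suc CARD('n)" if "ok B" for B
    using vec.independent_card_le_dim[of B UNIV] ind[OF that] vec.dim_UNIV
    by (simp add: vec.dimension_def less_Suc_eq_le card_cart_basis)
  have "ok {}" by (simp add: ok_def)
  then obtain B where B: "ok B" and max: "\<And>B'. ok B' \<Longrightarrow> card B' \<le> card B"
    using ex_has_greatest_nat[of ok "{}" card "Suc CARD('n)"] bound by (metis less_imp_le)
  have finB: "finite B" using B by (simp add: ok_def)
  have eigB: "eig b" if "b \<in> B" for b using B that by (simp add: ok_def)
  have span: "vec.span B = UNIV"
  proof (rule ccontr)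
    assume "vec.span B \<noteq> UNIV"
    then obtain x where x: "x \<notin> vec.span B" by blast
    define W where "W = {w. \<forall>b\<in>B. h w b = 0}"
    have subW: "vec.subspace W" by (auto simp: W_def vec.subspace_def add_left scale_left)
    define w where "w = x - (\<Sum>b\<in>B. h x b *s b)"
    have "(\<Sum>b\<in>B. h x b *s b) \<in> vec.span B"
      by (intro vec.span_sum vec.span_scale vec.span_base)
    then have "w \<noteq> 0" using x by (auto simp: w_def)
    have "w \<in> W"
    proof -
      have "h (\<Sum>b\<in>B. h x b *s b) c = h x c" if "c \<in> B" for c
      proof -
        have "h (\<Sum>b\<in>B. h x b *s b) c = (\<Sum>b\<in>B. if b = c then h x b else 0)"
          unfolding sum_left scale_left using B that by (intro sum.cong) (auto simp: ok_def)
        then show ?thesis using that finB by simp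
      qed
      then show ?thesis by (simp add: W_def w_def diff_left)
    qed
    then have neW: "W \<noteq> {0}" using \<open>w \<noteq> 0\<close> by blast
    have invW: "Z *v u \<in> W" if "Z \<in> \<Z>" "u \<in> W" for Z u
    proof -
      have "h (Z *v u) b = 0" if b: "b \<in> B" for b
      proof -
        obtain l where "Z *v b = complex_of_real l *s b"
          by (rule exE[OF bspec[OF eigB[OF b, unfolded eig_def] \<open>Z \<in> \<Z>\<close>]])
        then show ?thesis
          using sa[OF \<open>Z \<in> \<Z>\<close>] \<open>u \<in> W\<close> b by (simp add: selfadjoint_def scale_right W_def)
      qed
      then show ?thesis by (simp add: W_def)
    qed
    obtain u where u: "u \<in> W" "u \<noteq> 0" "\<forall>Z\<in>\<Z>. \<exists>l. Z *v u = complex_of_real l *s u"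
    proof (rule common_eigenvector[OF subW neW, of \<Z>])
      show "Z *v w \<in> W" if "Z \<in> \<Z>" "w \<in> W" for Z w using that by (rule invW)
      show "selfadjoint Z" if "Z \<in> \<Z>" for Z using that by (rule sa)
      show "Z ** Z' = Z' ** Z" if "Z \<in> \<Z>" "Z' \<in> \<Z>" for Z Z' using that by (rule comm)
    qed
    define s where "s = complex_of_real (1 / sqrt (Re (h u u)))"
    define v where "v = s *s u"
    have "h v v = s * s * complex_of_real (Re (h u u))"
      by (simp add: v_def scale_left scale_right s_def diagonal_real[of u, symmetric])
    also have "\<dots> = complex_of_real (Re (h u u) / (sqrt (Re (h u u)) * sqrt (Re (h u u))))"
      by (simp add: s_def flip: of_real_mult)
    finally have 1: "h v v = 1" using positive[OF u(2)] by simp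
    have 2: "h v b = 0" "h b v = 0" if "b \<in> B" for b
      using u(1) that conj_swap[of b u] by (auto simp: v_def W_def scale_left scale_right)
    have 3: "v \<notin> B" using 1 2(1)[of v] by auto
    have "eig v"
      unfolding eig_def
    proof
      fix Z assume "Z \<in> \<Z>"
      then obtain l where "Z *v u = complex_of_real l *s u" using u(3) by blast
      then have "Z *v v = complex_of_real l *s v"
        by (simp add: v_def vector_scalar_commute vector_smult_assoc mult.commute)
      then show "\<exists>l. Z *v v = complex_of_real l *s v" by blast
    qed
    moreover have "h x y = (if x = y then 1 else 0)" if xy: "x \<in> insert v B" "y \<in> insert v B" for x y
    proof -
      consider "x = v" "y = v" | "x = v" "y \<in> B" | "x \<in> B" "y = v" | "x \<in> B" "y \<in> B"
        using xy by blast
      then show ?thesis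
      proof cases
        case 1 then show ?thesis using \<open>h v v = 1\<close> by simp
      next
        case 2 then show ?thesis using \<open>v \<notin> B\<close> \<open>\<And>b. b \<in> B \<Longrightarrow> h v b = 0\<close> by auto
      next
        case 3 then show ?thesis using \<open>v \<notin> B\<close> \<open>\<And>b. b \<in> B \<Longrightarrow> h b v = 0\<close> by auto
      next
        case 4 then show ?thesis using B by (simp add: ok_def)
      qed
    qed
    ultimately have "ok (insert v B)"
      unfolding ok_def using finB eigB by (intro conjI ballI) auto
    then have "card (insert v B) \<le> card B" by (rule max)
    then show False using 3 finB by simp
  qed
  have "card B = CARD('n)"
    using vec.dim_span_eq_card_independent[OF ind[OF B]] span vec.dim_UNIV
    by (simp add: vec.dimension_def card_cart_basis)
  then have "card (UNIV :: 'n set) = card B" by simp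
  from finite_same_card_bij[OF finite finB this]
  obtain f :: "'n \<Rightarrow> complex^'n" where f: "bij_betw f UNIV B" by (rule exE)
  have fB: "f i \<in> B" for i using f by (auto simp: bij_betw_def)
  define l where "l i Z = (SOME l. Z *v f i = complex_of_real l *s f i)" for i Z
  have eigen: "Z *v f i = complex_of_real (l i Z) *s f i" if "Z \<in> \<Z>" for Z i
    unfolding l_def by (rule someI_ex) (rule bspec[OF eigB[OF fB, unfolded eig_def] that])
  have "h (f i) (f j) = (if i = j then 1 else 0)" for i j
  proof -
    have "f i = f j \<longleftrightarrow> i = j" using f by (auto simp: bij_betw_def inj_on_def)
    then show ?thesis using B fB by (simp add: ok_def)
  qed
  then show ?thesis using that[of f l] eigen by simp
qed

end

section \<open>Orthonormal frames and the matrix exponential\<close>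

lemma bounded_linear_mat_mult: "bounded_linear (\<lambda>z. mat z ** (M :: ('n::finite) cmat))"
proof -
  have "linear (\<lambda>z. mat z ** M)"
    by (auto intro!: linearI simp: matrix_eq mat_vector_mult matrix_vector_mult_add_rdistrib
        scaleR_matrix_vector vector_sadd_rdistrib vector_smult_assoc scaleR_conv_of_real[where 'a=complex]
        simp flip: matrix_vector_mul_assoc)
  then show ?thesis using linear_conv_bounded_linear by blast
qed

lemma matrix_sum_vector: "(\<Sum>i\<in>S. M i) *v (v :: complex^'n::finite) = (\<Sum>i\<in>S. M i *v v)"
  by (induction S rule: infinite_finite_induct) (auto simp: matrix_vector_mult_add_rdistrib)

locale orthonormal_frame = hermitian_form h
  for h :: "complex^'n::finite \<Rightarrow> complex^'n \<Rightarrow> complex" +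
  fixes f :: "'n \<Rightarrow> complex^'n"
  assumes orthonormal: "h (f i) (f j) = (if i = j then 1 else 0)"
begin

lemma coordinate_of_sum: "h (\<Sum>i\<in>UNIV. c i *s f i) (f j) = c j"
proof -
  have "h (\<Sum>i\<in>UNIV. c i *s f i) (f j) = (\<Sum>i\<in>UNIV. if i = j then c i else 0)"
    unfolding sum_left scale_left by (intro sum.cong) (auto simp: orthonormal)
  then show ?thesis by simp
qed

lemma expansion: "v = (\<Sum>i\<in>UNIV. h v (f i) *s f i)"
proof -
  define w where "w = v - (\<Sum>i\<in>UNIV. h v (f i) *s f i)"
  have orth: "h w (f j) = 0" for j by (simp add: w_def diff_left coordinate_of_sum)
  have inj: "inj f"
  proof (rule injI)
    fix i j assume "f i = f j"
    then have "h (f i) (f j) = 1" using orthonormal[of i i] by simp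
    then show "i = j" by (simp add: orthonormal split: if_splits)
  qed
  have "vec.independent (range f)"
    by (rule orthonormal_independent) (auto simp: orthonormal inj_eq[OF inj])
  moreover have "card (range f) = vec.dim (UNIV :: (complex^'n) set)"
    using card_image[OF inj] by (simp add: vec.dim_UNIV vec.dimension_def card_cart_basis)
  ultimately have "vec.span (range f) = UNIV"
    using vec.card_eq_dim[of "range f" UNIV] by auto
  then have "w \<in> vec.span (range f)" by simp
  then obtain u where w: "w = (\<Sum>v\<in>range f. u v *s v)"
    using vec.span_finite[of "range f"] by auto
  have "h w w = (\<Sum>v\<in>range f. cnj (u v) * h w v)"
    by (subst (2) w) (simp add: sum_right scale_right)
  also have "\<dots> = 0" using orth by (intro sum.neutral) auto
  finally have "w = 0" by simp
  then show ?thesis by (simp add: w_def)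
qed

lemma vector_eqI: "(\<And>i. h u (f i) = h v (f i)) \<Longrightarrow> u = v"
  using expansion[of u] expansion[of v] by simp

lemma matrix_eqI:
  fixes A B :: "'n cmat"
  assumes "\<And>i. A *v f i = B *v f i"
  shows "A = B"
  unfolding matrix_eq
proof
  fix v
  have "X *v v = (\<Sum>i\<in>UNIV. h v (f i) *s (X *v f i))" for X :: "'n cmat"
    using arg_cong[OF expansion[of v], of "\<lambda>v. X *v v"]
    by (simp add: matrix_vector_sum vector_scalar_commute)
  then show "A *v v = B *v v" by (simp add: assms)
qed

lemma parseval: "h u v = (\<Sum>i\<in>UNIV. h u (f i) * cnj (h v (f i)))"
  by (subst expansion[of v]) (simp add: sum_right scale_right mult.commute)

lemma parseval_norm: "Re (h v v) = (\<Sum>i\<in>UNIV. (cmod (h v (f i)))\<^sup>2)"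
  by (subst parseval) (simp flip: complex_norm_square)

definition coef :: "'n cmat \<Rightarrow> 'n \<Rightarrow> 'n \<Rightarrow> complex" where
  "coef X i j = h (X *v f j) (f i)"

lemma coordinate_apply: "h (X *v v) (f i) = (\<Sum>j\<in>UNIV. coef X i j * h v (f j))"
  by (subst expansion[of v]) (simp add: matrix_vector_sum vector_scalar_commute sum_left scale_left coef_def mult.commute)

lemma coef_mult: "coef (X ** Y) i j = (\<Sum>k\<in>UNIV. coef X i k * coef Y k j)"
proof -
  have "coef (X ** Y) i j = h (X *v (Y *v f j)) (f i)" by (simp add: coef_def matrix_vector_mul_assoc)
  then show ?thesis unfolding coordinate_apply[of X] by (simp add: coef_def)
qed

lemma coef_eqI: "(\<And>i j. coef X i j = coef Y i j) \<Longrightarrow> X = Y"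
  by (intro matrix_eqI vector_eqI) (simp add: coef_def)

lemma coef_diff: "coef (X - Y) i j = coef X i j - coef Y i j"
  by (simp add: coef_def matrix_vector_mult_diff_rdistrib diff_left)

lemma coef_add: "coef (X + Y) i j = coef X i j + coef Y i j"
  by (simp add: coef_def matrix_vector_mult_add_rdistrib add_left)

lemma coef_scaleR: "coef (r *\<^sub>R X) i j = r * coef X i j"
  by (simp add: coef_def scaleR_matrix_vector scale_left)

lemma coef_selfadjoint: "selfadjoint X \<Longrightarrow> coef X j i = cnj (coef X i j)"
  unfolding coef_def selfadjoint_def by (metis conj_swap)

lemma coef_skewadjoint: "skewadjoint X \<Longrightarrow> coef X j i = - cnj (coef X i j)"
  unfolding coef_def skewadjoint_def by (metis conj_swap complex_cnj_minus)

text \<open>\<open>X\<close> is conjugated to its matrix of coefficients by the matrix whose columns are the frame.\<close>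

lemma trace_coef: "trace X = (\<Sum>i\<in>UNIV. coef X i i)"
proof -
  define F :: "'n cmat" where "F = (\<chi> r j. f j $ r)"
  define G :: "'n cmat" where "G = (\<chi> i r. h (axis r 1) (f i))"
  define C :: "'n cmat" where "C = (\<chi> i j. coef X i j)"
  have F: "F *v axis j 1 = f j" for j
    by (simp add: F_def vec_eq_iff matrix_vector_mult_def axis_def if_distrib[where f="\<lambda>x. _ * x"] cong: if_cong)
  have "(\<Sum>r\<in>UNIV. h (axis r 1) (f i) * f j $ r) = (if i = j then 1 else 0)" for i j
  proof -
    have "f j = (\<Sum>r\<in>UNIV. f j $ r *s axis r 1)"
      by (simp add: basis_expansion)
    then have "h (f j) (f i) = (\<Sum>r\<in>UNIV. f j $ r * h (axis r 1) (f i))"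
      using sum_left[of "\<lambda>r. f j $ r *s axis r 1" UNIV "f i"] by (simp add: scale_left)
    then show ?thesis by (auto simp: orthonormal mult.commute)
  qed
  then have GF: "G ** F = mat 1"
    by (simp add: G_def F_def matrix_matrix_mult_def mat_def vec_eq_iff)
  then have FG: "F ** G = mat 1" using matrix_left_right_inverse by blast
  have XF: "X ** F = F ** C"
  proof -
    have "(X *v f j) $ r = (\<Sum>i\<in>UNIV. f i $ r * coef X i j)" for r j
    proof -
      have "(X *v f j) $ r = (\<Sum>i\<in>UNIV. h (X *v f j) (f i) *s f i) $ r"
        using expansion[of "X *v f j"] by simp
      then show ?thesis by (simp add: coef_def mult.commute)
    qed
    then show ?thesis
      by (simp add: F_def C_def matrix_matrix_mult_def matrix_vector_mult_def vec_eq_iff)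
  qed
  have "trace X = trace (X ** F ** G)" by (simp add: FG flip: matrix_mul_assoc)
  also have "\<dots> = trace (G ** F ** C)" unfolding XF by (subst trace_mul_sym) (simp add: matrix_mul_assoc)
  also have "\<dots> = trace C" by (simp add: GF)
  finally show ?thesis by (simp add: trace_def C_def)
qed

lemma trace_square_selfadjoint:
  assumes "selfadjoint X"
  shows "Re (trace (X ** X)) = (\<Sum>i\<in>UNIV. \<Sum>j\<in>UNIV. (cmod (coef X i j))\<^sup>2)"
proof -
  have "coef X i j * coef X j i = complex_of_real ((cmod (coef X i j))\<^sup>2)" for i j
    using coef_selfadjoint[OF assms, of j i] by (simp add: complex_norm_square del: of_real_power)
  then show ?thesis by (simp add: trace_coef coef_mult)
qed

lemma trace_square_skewadjoint:
  assumes "skewadjoint X"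
  shows "Re (trace (X ** X)) = - (\<Sum>i\<in>UNIV. \<Sum>j\<in>UNIV. (cmod (coef X i j))\<^sup>2)"
proof -
  have "coef X i j * coef X j i = - complex_of_real ((cmod (coef X i j))\<^sup>2)" for i j
    using coef_skewadjoint[OF assms, of j i] by (simp add: complex_norm_square del: of_real_power)
  then show ?thesis by (simp add: trace_coef coef_mult sum_negf)
qed

lemma coef_square_sum_0_iff:
  "(\<Sum>i\<in>UNIV. \<Sum>j\<in>UNIV. (cmod (coef X i j))\<^sup>2) = 0 \<longleftrightarrow> X = 0"
proof
  assume "(\<Sum>i\<in>UNIV. \<Sum>j\<in>UNIV. (cmod (coef X i j))\<^sup>2) = 0"
  then have "coef X i j = 0" for i j
    by (simp add: sum_nonneg_eq_0_iff sum_nonneg)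
  then show "X = 0" by (intro coef_eqI) (simp add: coef_def)
qed (simp add: coef_def)

text \<open>The endomorphism that scales the \<open>i\<close>-th frame vector by \<open>c i\<close>.\<close>

definition diag :: "('n \<Rightarrow> complex) \<Rightarrow> 'n cmat" where
  "diag c = matrix (\<lambda>v. \<Sum>i\<in>UNIV. (c i * h v (f i)) *s f i)"

lemma diag_apply: "diag c *v v = (\<Sum>i\<in>UNIV. (c i * h v (f i)) *s f i)"
  unfolding diag_def
proof (rule matrix_works)
  show "Vector_Spaces.linear (*s) (*s) (\<lambda>v. \<Sum>i\<in>UNIV. (c i * h v (f i)) *s f i)"
    by unfold_locales
      (simp_all add: add_left scale_left sum.distrib vec.scale_sum_right algebra_simps vector_smult_assoc
        vector_sadd_rdistrib)
qed

lemma diag_coordinate: "h (diag c *v v) (f i) = c i * h v (f i)"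
  by (simp add: diag_apply coordinate_of_sum)

lemma diag_frame: "diag c *v f i = c i *s f i"
  by (rule vector_eqI) (simp add: diag_coordinate scale_left orthonormal)

lemma diag_unique:
  assumes "\<And>i. X *v f i = c i *s f i"
  shows "X = diag c"
  by (rule matrix_eqI) (simp add: assms diag_frame)

text \<open>Convergence and differentiation of families of diagonal endomorphisms reduce through this
  decomposition to the scalar case.\<close>

lemma diag_as_sum: "diag c = (\<Sum>i\<in>UNIV. mat (c i) ** diag (\<lambda>j. if j = i then 1 else 0))"
proof (rule diag_unique[symmetric])
  fix j
  have "(\<Sum>i\<in>UNIV. mat (c i) ** diag (\<lambda>j. if j = i then 1 else 0)) *v f j
      = (\<Sum>i\<in>UNIV. if i = j then c j *s f j else 0)"
    unfolding matrix_sum_vector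
    by (intro sum.cong) (auto simp: mat_vector_mult diag_frame vector_smult_assoc
        simp flip: matrix_vector_mul_assoc)
  then show "(\<Sum>i\<in>UNIV. mat (c i) ** diag (\<lambda>j. if j = i then 1 else 0)) *v f j = c j *s f j"
    by simp
qed

lemma matpow_diagonal:
  assumes "\<And>i. X *v f i = c i *s f i"
  shows "matpow X k = diag (\<lambda>i. c i ^ k)"
proof (rule diag_unique)
  show "matpow X k *v f i = c i ^ k *s f i" for i
    by (induction k) (simp_all add: matpow_0 matpow_Suc vector_scalar_commute assms vector_smult_assoc
        mult.commute flip: matrix_vector_mul_assoc)
qed

lemma mexp_sums_diagonal:
  assumes "\<And>i. X *v f i = c i *s f i"
  shows "(\<lambda>k. (1 / fact k) *\<^sub>R matpow X k) sums diag (\<lambda>i. exp (c i))"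
proof -
  let ?E = "\<lambda>i. diag (\<lambda>j. if j = i then 1 else 0)"
  have "(\<lambda>k. \<Sum>i\<in>UNIV. mat (c i ^ k /\<^sub>R fact k) ** ?E i) sums (\<Sum>i\<in>UNIV. mat (exp (c i)) ** ?E i)"
    by (intro sums_sum bounded_linear.sums[OF bounded_linear_mat_mult] exp_converges)
  moreover have "(\<Sum>i\<in>UNIV. mat (c i ^ k /\<^sub>R fact k) ** ?E i) = (1 / fact k) *\<^sub>R matpow X k" for k
  proof -
    have "(\<Sum>i\<in>UNIV. mat (c i ^ k /\<^sub>R fact k) ** ?E i) = diag (\<lambda>i. c i ^ k /\<^sub>R fact k)"
      by (rule diag_as_sum[symmetric])
    also have "\<dots> = (1 / fact k) *\<^sub>R matpow X k"
      by (rule diag_unique[symmetric])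
        (simp add: scaleR_matrix_vector matpow_diagonal[OF assms] diag_frame vector_smult_assoc
          scaleR_conv_of_real[where 'a=complex] divide_inverse)
    finally show ?thesis .
  qed
  ultimately show ?thesis by (simp add: diag_as_sum[symmetric])
qed

lemma mexp_diagonal:
  assumes "\<And>i. X *v f i = c i *s f i"
  shows "mexp X = diag (\<lambda>i. exp (c i))"
  unfolding mexp_def using sums_unique[OF mexp_sums_diagonal[OF assms]] by simp

lemma mexp_diagonal_scaled:
  assumes "\<And>i. X *v f i = c i *s f i"
  shows "mexp (t *\<^sub>R X) = diag (\<lambda>i. exp (complex_of_real t * c i))"
  by (rule mexp_diagonal) (simp add: scaleR_matrix_vector assms vector_smult_assoc)

lemma mexp_diagonal_derivative:
  assumes "\<And>i. X *v f i = c i *s f i"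
  shows "((\<lambda>t. mexp (t *\<^sub>R X)) has_vector_derivative X) (at 0)"
proof -
  let ?E = "\<lambda>i. diag (\<lambda>j. if j = i then 1 else 0)"
  have 1: "((\<lambda>t. exp (complex_of_real t * z)) has_vector_derivative z) (at 0)" for z
  proof -
    have "((\<lambda>x. exp (x * z)) has_field_derivative z) (at (complex_of_real 0))"
      by (auto intro!: derivative_eq_intros)
    then show ?thesis by (rule has_vector_derivative_real_field)
  qed
  have "((\<lambda>t. \<Sum>i\<in>UNIV. mat (exp (complex_of_real t * c i)) ** ?E i) has_vector_derivative
      (\<Sum>i\<in>UNIV. mat (c i) ** ?E i)) (at 0)"
    by (intro has_vector_derivative_sum bounded_linear.has_vector_derivative[OF bounded_linear_mat_mult] 1)
  then show ?thesis
    unfolding diag_as_sum[symmetric] mexp_diagonal_scaled[OF assms, symmetric] diag_unique[OF assms, symmetric] .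
qed

lemma diag_mult: "diag c ** diag d = diag (\<lambda>i. c i * d i)"
  by (rule diag_unique)
    (simp add: diag_frame vector_scalar_commute vector_smult_assoc mult.commute flip: matrix_vector_mul_assoc)

lemma diag_1: "diag (\<lambda>i. 1) = mat 1"
  by (rule diag_unique[symmetric]) (simp add: mat_vector_mult)

end

context hermitian_form
begin

text \<open>Selfadjoint and skew-adjoint matrices both have this property, which lets one compute their
  exponentials on eigenvectors, where only the scalar exponential function enters.\<close>

definition unitarily_diagonalizable :: "'n cmat \<Rightarrow> bool" where
  "unitarily_diagonalizable X \<longleftrightarrow>
     (\<exists>f c. orthonormal_frame h f \<and> (\<forall>i. X *v f i = c i *s f i))"

lemma selfadjoint_eigenframe:
  assumes "selfadjoint X"
  obtains f and c :: "'n \<Rightarrow> real"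
  where "orthonormal_frame h f" "\<forall>i. X *v f i = complex_of_real (c i) *s f i"
proof -
  have 1: "selfadjoint Z" if "Z \<in> {X}" for Z using assms that by simp
  have 2: "Z ** Z' = Z' ** Z" if "Z \<in> {X}" "Z' \<in> {X}" for Z Z' using that by simp
  obtain f :: "'n \<Rightarrow> complex^'n" and l :: "'n \<Rightarrow> 'n cmat \<Rightarrow> real"
    where f: "\<forall>i j. h (f i) (f j) = (if i = j then 1 else 0)"
      and l: "\<forall>Z\<in>{X}. \<forall>i. Z *v f i = complex_of_real (l i Z) *s f i"
    by (rule spectral_theorem[OF 1 2])
  have "orthonormal_frame h f" by unfold_locales (use f in blast)
  then show ?thesis using that[of f "\<lambda>i. l i X"] l by simp
qed

lemma selfadjoint_diagonalizable:
  assumes "selfadjoint X"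
  shows "unitarily_diagonalizable X"
proof -
  obtain f and c :: "'n \<Rightarrow> real"
    where "orthonormal_frame h f" "\<forall>i. X *v f i = complex_of_real (c i) *s f i"
    using assms by (rule selfadjoint_eigenframe)
  then show ?thesis
    unfolding unitarily_diagonalizable_def
    by (intro exI[of _ f] exI[of _ "\<lambda>i. complex_of_real (c i)"] conjI)
qed

lemma skewadjoint_diagonalizable:
  assumes "skewadjoint X"
  shows "unitarily_diagonalizable X"
proof -
  have "selfadjoint (mat \<i> ** X)"
    using assms by (simp add: selfadjoint_def skewadjoint_def mat_vector_mult scale_left scale_right
        flip: matrix_vector_mul_assoc)
  then obtain f c where f: "orthonormal_frame h f"
      and c: "\<forall>i. (mat \<i> ** X) *v f i = complex_of_real (c i) *s f i"
    by (rule selfadjoint_eigenframe)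
  have "X *v f i = (- \<i> * complex_of_real (c i)) *s f i" for i
  proof -
    have "(- \<i>) *s (\<i> *s (X *v f i)) = (- \<i>) *s (complex_of_real (c i) *s f i)"
      using c by (simp add: mat_vector_mult flip: matrix_vector_mul_assoc)
    then show ?thesis by (simp add: vector_smult_assoc)
  qed
  then show ?thesis unfolding unitarily_diagonalizable_def
    using f by (intro exI[of _ f] exI[of _ "\<lambda>i. - \<i> * complex_of_real (c i)"] conjI allI)
qed

lemma mexp_sums:
  assumes "unitarily_diagonalizable X"
  shows "(\<lambda>k. (1 / fact k) *\<^sub>R matpow X k) sums mexp X"
proof -
  obtain f c where f: "orthonormal_frame h f" and c: "\<And>i. X *v f i = c i *s f i"
    using assms unfolding unitarily_diagonalizable_def by blast
  interpret orthonormal_frame h f by (rule f)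
  show ?thesis using mexp_sums_diagonal[OF c] mexp_diagonal[OF c] by simp
qed

lemma mexp_derivative:
  assumes "unitarily_diagonalizable X"
  shows "((\<lambda>t. mexp (t *\<^sub>R X)) has_vector_derivative X) (at 0)"
proof -
  obtain f c where f: "orthonormal_frame h f" and c: "\<And>i. X *v f i = c i *s f i"
    using assms unfolding unitarily_diagonalizable_def by blast
  interpret orthonormal_frame h f by (rule f)
  show ?thesis by (rule mexp_diagonal_derivative[OF c])
qed

lemma mexp_add:
  assumes "unitarily_diagonalizable X"
  shows "mexp ((s + t) *\<^sub>R X) = mexp (s *\<^sub>R X) ** mexp (t *\<^sub>R X)"
proof -
  obtain f c where f: "orthonormal_frame h f" and c: "\<And>i. X *v f i = c i *s f i"
    using assms unfolding unitarily_diagonalizable_def by blast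
  interpret orthonormal_frame h f by (rule f)
  show ?thesis by (simp add: mexp_diagonal_scaled[OF c] diag_mult distrib_right exp_add)
qed

lemma mexp_0: "mexp (0 :: 'n cmat) = mat 1"
proof -
  have "selfadjoint 0" by (simp add: selfadjoint_def)
  then obtain f c where f: "orthonormal_frame h f" and c: "\<forall>i. 0 *v f i = complex_of_real (c i) *s f i"
    by (rule selfadjoint_eigenframe)
  interpret orthonormal_frame h f by (rule f)
  have "mexp 0 = diag (\<lambda>i. 1)"
    using mexp_diagonal[of 0 "\<lambda>i. 0"] by simp
  then show ?thesis by (simp add: diag_1)
qed

lemma mexp_inverse:
  assumes "unitarily_diagonalizable X"
  shows "mexp (t *\<^sub>R X) ** mexp (- t *\<^sub>R X) = mat 1"
    and "matrix_inv (mexp (t *\<^sub>R X)) = mexp (- t *\<^sub>R X)"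
proof -
  show 1: "mexp (t *\<^sub>R X) ** mexp (- t *\<^sub>R X) = mat 1"
    using mexp_add[OF assms, of t "- t"] by (simp add: mexp_0)
  show "matrix_inv (mexp (t *\<^sub>R X)) = mexp (- t *\<^sub>R X)"
    by (rule matrix_inv_unique[OF 1])
qed

lemma mexp_invertible:
  assumes "unitarily_diagonalizable X"
  shows "invertible (mexp (t *\<^sub>R X))"
  unfolding invertible_def using mexp_inverse(1)[OF assms] matrix_left_right_inverse by blast

lemma mexp_commute:
  assumes X: "unitarily_diagonalizable X" and M: "M ** X = X ** M"
  shows "M ** mexp X = mexp X ** M"
proof -
  have pow: "M ** matpow X k = matpow X k ** M" for k
  proof (induction k)
    case (Suc k)
    have "M ** (X ** matpow X k) = X ** (M ** matpow X k)" by (simp add: matrix_mul_assoc M)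
    then show ?case by (simp add: matpow_Suc Suc matrix_mul_assoc)
  qed (simp add: matpow_0)
  have "(\<lambda>k. M ** ((1 / fact k) *\<^sub>R matpow X k)) sums (M ** mexp X)"
    using bounded_linear.sums[OF bounded_bilinear.bounded_linear_right[OF bounded_bilinear_matrix_mult] mexp_sums[OF X]] .
  moreover have "(\<lambda>k. ((1 / fact k) *\<^sub>R matpow X k) ** M) sums (mexp X ** M)"
    using bounded_linear.sums[OF bounded_bilinear.bounded_linear_left[OF bounded_bilinear_matrix_mult] mexp_sums[OF X]] .
  ultimately show ?thesis using sums_unique2 by (fastforce simp: scaleR_matrix_mult pow)
qed

lemma mexp_Ad:
  assumes g: "invertible g" and X: "unitarily_diagonalizable X" "unitarily_diagonalizable (Ad g X)"
  shows "mexp (Ad g X) = Ad g (mexp X)"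
proof -
  have pow: "matpow (Ad g X) k = Ad g (matpow X k)" for k
  proof (induction k)
    case 0 then show ?case by (simp add: matpow_0 Ad_def matrix_inv_cancel[OF g])
  qed (simp add: matpow_Suc Ad_product[OF g])
  have "bounded_linear (Ad g)" using linear_Ad linear_conv_bounded_linear by blast
  from bounded_linear.sums[OF this mexp_sums[OF X(1)]]
  have "(\<lambda>k. (1 / fact k) *\<^sub>R matpow (Ad g X) k) sums Ad g (mexp X)"
    by (simp add: pow linear_scale[OF linear_Ad])
  then show ?thesis using mexp_sums[OF X(2)] sums_unique2 by blast
qed

end

lemma (in orthonormal_frame) continuous_mexp_diagonal:
  assumes "\<And>i. X *v f i = c i *s f i"
  shows "continuous_on UNIV (\<lambda>t. mexp (t *\<^sub>R X))"
  unfolding mexp_diagonal_scaled[OF assms] diag_as_sum[of "\<lambda>i. exp (complex_of_real _ * c i)"]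
  by (intro continuous_intros bounded_linear.continuous_on[OF bounded_linear_mat_mult])

lemma (in hermitian_form) continuous_mexp:
  assumes "unitarily_diagonalizable X"
  shows "continuous_on UNIV (\<lambda>t. mexp (t *\<^sub>R X))"
proof -
  obtain f c where f: "orthonormal_frame h f" and c: "\<And>i. X *v f i = c i *s f i"
    using assms unfolding unitarily_diagonalizable_def by blast
  interpret orthonormal_frame h f by (rule f)
  show ?thesis by (rule continuous_mexp_diagonal[OF c])
qed

section \<open>Scalar products on a subspace\<close>

locale subspace_inner =
  fixes S :: "'a::euclidean_space set" and ip :: "'a \<Rightarrow> 'a \<Rightarrow> real"
  assumes subspace: "subspace S"
    and ip_add: "x \<in> S \<Longrightarrow> y \<in> S \<Longrightarrow> z \<in> S \<Longrightarrow> ip (x + y) z = ip x z + ip y z"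
    and ip_scale: "x \<in> S \<Longrightarrow> y \<in> S \<Longrightarrow> ip (c *\<^sub>R x) y = c * ip x y"
    and ip_sym: "x \<in> S \<Longrightarrow> y \<in> S \<Longrightarrow> ip x y = ip y x"
    and ip_pos: "x \<in> S \<Longrightarrow> x \<noteq> 0 \<Longrightarrow> ip x x > 0"
begin

lemma zero_mem: "0 \<in> S" using subspace by (rule subspace_0)

lemma ip_zero: "x \<in> S \<Longrightarrow> ip 0 x = 0"
  using ip_scale[of 0 x 0] zero_mem by simp

lemma ip_diff: "x \<in> S \<Longrightarrow> y \<in> S \<Longrightarrow> z \<in> S \<Longrightarrow> ip (x - y) z = ip x z - ip y z"
  using ip_add[of "x - y" y z] subspace_diff[OF subspace] by simp

lemma ip_add_right: "x \<in> S \<Longrightarrow> y \<in> S \<Longrightarrow> z \<in> S \<Longrightarrow> ip z (x + y) = ip z x + ip z y"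
  using ip_add[of x y z] ip_sym subspace_add[OF subspace] by metis

lemma ip_scale_right: "x \<in> S \<Longrightarrow> y \<in> S \<Longrightarrow> ip y (c *\<^sub>R x) = c * ip y x"
  using ip_scale[of x y] ip_sym subspace_scale[OF subspace] by metis

lemma ip_sum:
  assumes "\<And>i. i \<in> I \<Longrightarrow> g i \<in> S" "z \<in> S"
  shows "ip (\<Sum>i\<in>I. g i) z = (\<Sum>i\<in>I. ip (g i) z)"
  using assms
proof (induction I rule: infinite_finite_induct)
  case (insert i I)
  then have "(\<Sum>i\<in>I. g i) \<in> S" by (intro subspace_sum[OF subspace]) auto
  then show ?case using insert by (simp add: ip_add)
qed (simp_all add: ip_zero)

lemma ip_unique:
  assumes "x \<in> S" "y \<in> S" "\<And>z. z \<in> S \<Longrightarrow> ip x z = ip y z"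
  shows "x = y"
proof (rule ccontr)
  assume "x \<noteq> y"
  then have "ip (x - y) (x - y) > 0" using assms subspace_diff[OF subspace] by (intro ip_pos) auto
  moreover have "x - y \<in> S" using assms subspace_diff[OF subspace] by auto
  ultimately show False using assms by (simp add: ip_diff)
qed

text \<open>One direction \<open>b\<close> is adjoined at a time: subtracting from \<open>b\<close> its projection to the span
  of the previous directions gives a vector along which the previous solution is corrected.\<close>

lemma representing_vector_on_span:
  assumes "finite B" "B \<subseteq> S"
    and "\<And>x y. x \<in> S \<Longrightarrow> y \<in> S \<Longrightarrow> \<phi> (x + y) = \<phi> x + \<phi> y"
    and "\<And>c x. x \<in> S \<Longrightarrow> \<phi> (c *\<^sub>R x) = c * \<phi> x"
  shows "\<exists>m\<in>span B. \<forall>y\<in>span B. ip m y = (\<phi> y :: real)"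
  using assms
proof (induction B arbitrary: \<phi> rule: finite_induct)
  case empty
  have "\<phi> 0 = 0" using empty(3)[of 0 0] zero_mem by simp
  then show ?case using ip_zero[OF zero_mem] by simp
next
  case (insert b B)
  have b: "b \<in> S" and B: "B \<subseteq> S" using insert.prems by auto
  have spB: "span B \<subseteq> S" using B subspace by (simp add: span_minimal)
  obtain m where m: "m \<in> span B" "\<forall>y\<in>span B. ip m y = \<phi> y"
    using insert.IH[OF B, of \<phi>] insert.prems by blast
  obtain b' where b': "b' \<in> span B" "\<forall>y\<in>span B. ip b' y = ip b y"
    using insert.IH[OF B, of "ip b"] b ip_add_right ip_scale_right by blast
  define u where "u = b - b'"
  have mS: "m \<in> S" and bS: "b' \<in> S" using m b' spB by auto
  have uS: "u \<in> S" unfolding u_def using b bS subspace_diff[OF subspace] by blast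
  have uB: "ip u y = 0" if "y \<in> span B" for y
    using that b' b bS spB by (simp add: u_def ip_diff subset_iff)
  have ub: "ip u b = ip u u"
  proof -
    have "ip u b = ip u (u + b')" by (simp add: u_def)
    then show ?thesis using uB[OF b'(1)] uS bS by (simp add: ip_add_right)
  qed
  define t where "t = (if u = 0 then 0 else (\<phi> b - ip m b) / ip u u)"
  define m' where "m' = m + t *\<^sub>R u"
  have tuS: "t *\<^sub>R u \<in> S" using uS subspace_scale[OF subspace] by blast
  have 1: "ip m' y = \<phi> y" if "y \<in> span B" for y
  proof -
    have "y \<in> S" using that spB by blast
    then show ?thesis using m that uB uS tuS mS by (simp add: m'_def ip_add ip_scale)
  qed
  have 2: "ip m' b = \<phi> b"
  proof (cases "u = 0")
    case True
    then have "b \<in> span B" using b' by (simp add: u_def)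
    then show ?thesis by (rule 1)
  next
    case False
    then have "ip u u \<noteq> 0" using ip_pos[OF uS] by simp
    then show ?thesis using ub b uS tuS mS False by (simp add: m'_def ip_add ip_scale t_def)
  qed
  have u_span: "u \<in> span (insert b B)"
    unfolding u_def
    by (rule span_diff[OF span_base subsetD[OF span_mono b'(1)]]) auto
  have m': "m' \<in> span (insert b B)"
    unfolding m'_def
    by (rule span_add[OF subsetD[OF span_mono m(1)] span_scale[OF u_span]]) auto
  have m'S: "m' \<in> S" unfolding m'_def using mS tuS subspace_add[OF subspace] by blast
  have "ip m' y = \<phi> y" if y: "y \<in> span (insert b B)" for y
  proof -
    obtain c where c: "y - c *\<^sub>R b \<in> span B" using y by (auto simp: span_insert)
    have yc: "y - c *\<^sub>R b \<in> S" "c *\<^sub>R b \<in> S" using c spB b subspace_scale[OF subspace] by auto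
    have "ip m' ((y - c *\<^sub>R b) + c *\<^sub>R b) = \<phi> ((y - c *\<^sub>R b) + c *\<^sub>R b)"
      using yc b m'S 1[OF c] 2 insert.prems(2)[OF yc] insert.prems(3)[OF b]
      by (simp only: ip_add_right ip_scale_right)
    then show ?thesis by simp
  qed
  then show ?case using m' by blast
qed

theorem representing_vector:
  assumes "\<And>x y. x \<in> S \<Longrightarrow> y \<in> S \<Longrightarrow> \<phi> (x + y) = \<phi> x + \<phi> y"
    and "\<And>c x. x \<in> S \<Longrightarrow> \<phi> (c *\<^sub>R x) = c * \<phi> x"
  shows "\<exists>!m. m \<in> S \<and> (\<forall>y\<in>S. ip m y = (\<phi> y :: real))"
proof -
  obtain B where B: "B \<subseteq> S" "finite B" "span B = S"
    using basis_exists[of S] subspace span_subspace by (metis finiteI_independent)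
  show ?thesis
  proof (rule ex_ex1I)
    show "\<exists>m. m \<in> S \<and> (\<forall>y\<in>S. ip m y = \<phi> y)"
      using representing_vector_on_span[OF B(2,1) assms] B(3) by auto
    show "m = m'" if "m \<in> S \<and> (\<forall>y\<in>S. ip m y = \<phi> y)" "m' \<in> S \<and> (\<forall>y\<in>S. ip m' y = \<phi> y)" for m m'
      using that by (intro ip_unique) auto
  qed
qed

lemma restrict: "subspace T \<Longrightarrow> T \<subseteq> S \<Longrightarrow> subspace_inner T ip"
  using ip_add ip_scale ip_sym ip_pos by unfold_locales (auto simp: subset_iff)

end

text \<open>Finitely many strict inequalities survive a small move that leaves the hyperplanes orthogonal
  to the elements of \<open>D\<close>. Once \<open>d\<close> or \<open>- d\<close> pairs positively with the point, it joins the list of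
  inequalities to be preserved.\<close>

lemma (in subspace_inner) generic_perturbation:
  assumes "finite D" "D \<subseteq> S - {0}" "finite C" "C \<subseteq> S" "b \<in> S" "\<forall>c\<in>C. ip c b > 0"
  shows "\<exists>b'\<in>S. (\<forall>c\<in>C. ip c b' > 0) \<and> (\<forall>d\<in>D. ip d b' \<noteq> 0)"
  using assms
proof (induction D arbitrary: C b rule: finite_induct)
  case empty
  then show ?case by blast
next
  case (insert d D)
  have d: "d \<in> S" "d \<noteq> 0" using insert.prems by auto
  have "\<exists>b1\<in>S. (\<forall>c\<in>C. ip c b1 > 0) \<and> ip d b1 \<noteq> 0"
  proof (cases "ip d b = 0")
    case True
    have "eventually (\<lambda>t. ip c b + t * ip c d > 0) (at_right 0)" if "c \<in> C" for c
    proof (rule order_tendstoD(1))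
      have "((\<lambda>t. ip c b + t * ip c d) \<longlongrightarrow> ip c b + 0 * ip c d) (at_right 0)"
        by (intro tendsto_intros)
      then show "((\<lambda>t. ip c b + t * ip c d) \<longlongrightarrow> ip c b) (at_right 0)" by simp
      show "0 < ip c b" using insert.prems that by blast
    qed
    then have "eventually (\<lambda>t. \<forall>c\<in>C. ip c b + t * ip c d > 0) (at_right 0)"
      using insert.prems by (intro eventually_ball_finite) auto
    then have "eventually (\<lambda>t. t > 0 \<and> (\<forall>c\<in>C. ip c b + t * ip c d > 0)) (at_right 0)"
      using eventually_at_right_less[of "0::real"] by eventually_elim auto
    then obtain t where t: "t > 0" "\<forall>c\<in>C. ip c b + t * ip c d > 0"
      using eventually_happens'[OF trivial_limit_at_right_real] by blast
    have b1: "b + t *\<^sub>R d \<in> S"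
      using insert.prems d by (intro subspace_add[OF subspace] subspace_scale[OF subspace]) auto
    have "ip c (b + t *\<^sub>R d) = ip c b + t * ip c d" if "c \<in> S" for c
      using that insert.prems d subspace_scale[OF subspace] by (simp add: ip_add_right ip_scale_right)
    then have "(\<forall>c\<in>C. ip c (b + t *\<^sub>R d) > 0) \<and> ip d (b + t *\<^sub>R d) \<noteq> 0"
      using t True d ip_pos[OF d] insert.prems(3) by (auto simp: subset_iff)
    then show ?thesis using b1 by blast
  qed (use insert.prems in blast)
  then obtain b1 where b1: "b1 \<in> S" "\<forall>c\<in>C. ip c b1 > 0" "ip d b1 \<noteq> 0" by blast
  have neg: "ip (- d) y = - ip d y" if "y \<in> S" for y
    using ip_scale[OF d(1) that, of "-1"] by simp
  define s where "s = (if ip d b1 > 0 then d else - d)"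
  have s: "s \<in> S" unfolding s_def using d subspace_neg[OF subspace] by auto
  have "ip s b1 > 0" using b1 neg[OF b1(1)] by (auto simp: s_def)
  then have "\<exists>b'\<in>S. (\<forall>c\<in>insert s C. ip c b' > 0) \<and> (\<forall>d\<in>D. ip d b' \<noteq> 0)"
    using insert.prems b1 s by (intro insert.IH[of _ b1]) auto
  then obtain b' where b': "b' \<in> S" "\<forall>c\<in>insert s C. ip c b' > 0" "\<forall>d\<in>D. ip d b' \<noteq> 0" by blast
  have "ip d b' \<noteq> 0" using b' neg[OF b'(1)] by (auto simp: s_def split: if_splits)
  then show ?case using b' by blast
qed

section \<open>Points of the projective space\<close>

lemma proj_eq: "proj v = range (\<lambda>c. c *s v)"
  by (simp add: proj_def vec.span_singleton)

lemma mem_proj: "v \<in> proj v"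
  by (simp add: proj_def vec.span_base)

lemma proj_scale:
  assumes "c \<noteq> 0"
  shows "proj (c *s v) = proj v"
proof -
  have "d *s v \<in> range (\<lambda>d. d *s (c *s v))" for d
    by (rule range_eqI[of _ _ "d / c"]) (use assms in \<open>simp add: vector_smult_assoc\<close>)
  then show ?thesis unfolding proj_eq by (auto simp: vector_smult_assoc)
qed

lemma proj_image: "(*v) g ` proj v = proj (g *v v)"
  unfolding proj_eq image_image vector_scalar_commute ..

lemma proj_eqE:
  assumes "proj v = proj w" "v \<noteq> 0"
  obtains c where "c \<noteq> 0" "v = c *s w"
proof -
  have "v \<in> proj w" using assms(1) mem_proj[of v] by simp
  then obtain c where "v = c *s w" by (auto simp: proj_eq)
  then show ?thesis using that[of c] assms(2) by auto
qed

lemma PV_iff: "L \<in> PV \<longleftrightarrow> (\<exists>v. v \<noteq> 0 \<and> L = proj v)"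
  by (auto simp: PV_def)

lemma proj_orbit_proj: "proj_orbit G (proj v) = (\<lambda>g. proj (g *v v)) ` G"
  by (simp add: proj_orbit_def proj_image)

lemma invertible_vector_nonzero:
  fixes g :: "('n::finite) cmat"
  assumes "invertible g" "v \<noteq> 0"
  shows "g *v v \<noteq> 0"
proof
  assume "g *v v = 0"
  then have "(matrix_inv g ** g) *v v = 0" by (simp flip: matrix_vector_mul_assoc)
  then show False using assms by (simp add: matrix_inv_cancel)
qed

lemma closed_in_PV_limit:
  assumes "closed_in_PV S" "\<And>n. w n \<noteq> 0" "\<And>n. proj (w n) \<in> S" "w \<longlonglongrightarrow> l" "l \<noteq> 0"
  shows "proj l \<in> S"
proof -
  obtain T where T: "closed T" "{v. v \<noteq> 0 \<and> proj v \<in> S} = {v. v \<noteq> 0} \<inter> T"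
    using assms(1) unfolding closed_in_PV_def closedin_closed by blast
  then have "w n \<in> T" for n using assms(2,3) by blast
  then have "l \<in> T" using T(1) assms(4) by (metis closed_sequentially)
  then show ?thesis using T(2) assms(5) by blast
qed

section \<open>Matrix groups with a compatible Cartan decomposition\<close>

locale compatible_group = hermitian_form h
  for h :: "complex^'n::finite \<Rightarrow> complex^'n \<Rightarrow> complex" +
  fixes G K \<pp> :: "'n cmat set"
  assumes group_G: "matrix_group G" and connected_G: "connected G"
    and irreducible: "irreducible_action G"
    and group_K: "matrix_group K" and compact_K: "compact K"
    and cartan: "cartan_decomposition (lie_algebra G) (lie_algebra K) \<pp>"
    and compat: "compatible h G K \<pp>"
begin

lemma G_mult: "g \<in> G \<Longrightarrow> g' \<in> G \<Longrightarrow> g ** g' \<in> G"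
  and G_one: "mat 1 \<in> G"
  and G_inv: "g \<in> G \<Longrightarrow> matrix_inv g \<in> G"
  and G_invertible: "g \<in> G \<Longrightarrow> invertible g"
  using group_G by (auto simp: matrix_group_def)

lemma K_mult: "g \<in> K \<Longrightarrow> g' \<in> K \<Longrightarrow> g ** g' \<in> K"
  and K_one: "mat 1 \<in> K"
  and K_inv: "g \<in> K \<Longrightarrow> matrix_inv g \<in> K"
  and K_invertible: "g \<in> K \<Longrightarrow> invertible g"
  using group_K by (auto simp: matrix_group_def)

lemma p_subspace: "subspace \<pp>"
  and k_bracket_p: "X \<in> lie_algebra K \<Longrightarrow> Y \<in> \<pp> \<Longrightarrow> lie_bracket X Y \<in> \<pp>"
  and p_bracket_p: "X \<in> \<pp> \<Longrightarrow> Y \<in> \<pp> \<Longrightarrow> lie_bracket X Y \<in> lie_algebra K"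
  and lie_decompose: "lie_algebra G = {X + Y |X Y. X \<in> lie_algebra K \<and> Y \<in> \<pp>}"
  and k_subspace: "subspace (lie_algebra K)"
  using cartan by (auto simp: cartan_decomposition_def)

lemma p_lie_algebra: "X \<in> \<pp> \<Longrightarrow> X \<in> lie_algebra G"
  unfolding lie_decompose using subspace_0[OF k_subspace] by force

lemma mexp_p: "X \<in> \<pp> \<Longrightarrow> mexp X \<in> G"
  using p_lie_algebra unfolding lie_algebra_def by (metis (mono_tags) mem_Collect_eq scaleR_one)

lemma mexp_k: "X \<in> lie_algebra K \<Longrightarrow> mexp (t *\<^sub>R X) \<in> K"
  unfolding lie_algebra_def by blast

lemma G_decompose: "G = {k ** mexp X |k X. k \<in> K \<and> X \<in> \<pp>}"
  using compat by (simp add: compatible_def)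

lemma K_subset_G: "k \<in> K \<Longrightarrow> k \<in> G"
  unfolding G_decompose using subspace_0[OF p_subspace] mexp_0 by force

lemma K_unitary: "k \<in> K \<Longrightarrow> h (k *v u) (k *v v) = h u v"
  using compat unfolding compatible_def SU_def by blast

lemma p_selfadjoint:
  assumes "X \<in> \<pp>"
  shows "selfadjoint X"
proof -
  obtain Y where Y: "X = mat \<i> ** Y" "Y \<in> su_algebra h"
    using compat assms unfolding compatible_def by blast
  then show ?thesis
    by (simp add: selfadjoint_def su_algebra_def mat_vector_mult scale_left scale_right
        flip: matrix_vector_mul_assoc)
qed

lemma p_diagonalizable: "X \<in> \<pp> \<Longrightarrow> unitarily_diagonalizable X"
  by (intro selfadjoint_diagonalizable p_selfadjoint)

lemma selfadjoint_commutator_skew: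
  assumes "selfadjoint X" "selfadjoint Y"
  shows "skewadjoint (lie_bracket X Y)"
  using assms unfolding selfadjoint_def skewadjoint_def lie_bracket_def
  by (simp add: matrix_vector_mult_diff_rdistrib diff_left diff_right flip: matrix_vector_mul_assoc)

lemma Ad_selfadjoint:
  assumes k: "k \<in> K" and X: "selfadjoint X"
  shows "selfadjoint (Ad k X)"
proof -
  have 1: "k *v (matrix_inv k *v u) = u" for u
    by (simp add: matrix_vector_mul_assoc matrix_inv_cancel[OF K_invertible[OF k]])
  have "h (Ad k X *v u) v = h u (Ad k X *v v)" for u v
  proof -
    have "h (Ad k X *v u) v = h (k *v (X *v (matrix_inv k *v u))) (k *v (matrix_inv k *v v))"
      by (simp add: 1 Ad_def flip: matrix_vector_mul_assoc)
    also have "\<dots> = h (k *v (matrix_inv k *v u)) (k *v (X *v (matrix_inv k *v v)))"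
      using X by (simp add: K_unitary[OF k] selfadjoint_def)
    finally show ?thesis by (simp add: 1 Ad_def flip: matrix_vector_mul_assoc)
  qed
  then show ?thesis by (simp add: selfadjoint_def)
qed

text \<open>A selfadjoint matrix whose exponentials are unitary has only the eigenvalue \<open>0\<close>.\<close>

lemma selfadjoint_in_k:
  assumes "selfadjoint Y" "Y \<in> lie_algebra K"
  shows "Y = 0"
proof -
  obtain f and c :: "'n \<Rightarrow> real" where f: "orthonormal_frame h f"
      and c: "\<forall>i. Y *v f i = complex_of_real (c i) *s f i"
    using assms(1) by (rule selfadjoint_eigenframe)
  interpret orthonormal_frame h f by (rule f)
  have Y: "Y = diag (\<lambda>i. complex_of_real (c i))" using c by (intro diag_unique) simp
  have "c i = 0" for i
  proof -
    have "mexp Y = diag (\<lambda>i. exp (complex_of_real (c i)))" using c by (intro mexp_diagonal) simp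
    then have "mexp Y *v f i = complex_of_real (exp (c i)) *s f i" by (simp add: diag_frame exp_of_real)
    then have "h (f i) (f i) = complex_of_real (exp (c i)) * complex_of_real (exp (c i)) * h (f i) (f i)"
      using K_unitary[OF mexp_k[OF assms(2), of 1], of "f i" "f i"] by (simp add: scale_left scale_right)
    then have "complex_of_real (exp (c i) * exp (c i)) = complex_of_real 1" by (simp add: orthonormal)
    then have "exp (c i + c i) = 1" unfolding of_real_eq_iff exp_add .
    then show ?thesis unfolding exp_eq_one_iff by simp
  qed
  then show ?thesis unfolding Y by (intro matrix_eqI) (simp add: diag_frame)
qed

text \<open>The component of \<open>Ad k X\<close> in the Lie algebra of \<open>K\<close> is a difference of selfadjoint matrices,
  hence zero.\<close>

lemma Ad_p:
  assumes k: "k \<in> K" and X: "X \<in> \<pp>"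
  shows "Ad k X \<in> \<pp>"
proof -
  have "mexp (t *\<^sub>R Ad k X) \<in> G" for t
  proof -
    have tX: "t *\<^sub>R X \<in> \<pp>" using X subspace_scale[OF p_subspace] by blast
    have "t *\<^sub>R Ad k X = Ad k (t *\<^sub>R X)" by (simp add: linear_scale[OF linear_Ad])
    moreover have "mexp (Ad k (t *\<^sub>R X)) = Ad k (mexp (t *\<^sub>R X))"
      by (intro mexp_Ad K_invertible k p_diagonalizable tX selfadjoint_diagonalizable
          Ad_selfadjoint p_selfadjoint)
    ultimately show ?thesis
      using G_mult G_inv K_subset_G[OF k] mexp_p[OF tX] by (simp add: Ad_def)
  qed
  then have "Ad k X \<in> lie_algebra G" by (simp add: lie_algebra_def)
  then obtain Y Z where YZ: "Ad k X = Y + Z" "Y \<in> lie_algebra K" "Z \<in> \<pp>"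
    unfolding lie_decompose by blast
  have "selfadjoint (Ad k X - Z)"
    using Ad_selfadjoint[OF k p_selfadjoint[OF X]] p_selfadjoint[OF YZ(3)]
    by (simp add: selfadjoint_def matrix_vector_mult_diff_rdistrib diff_left diff_right)
  then have "Y = 0" using YZ by (intro selfadjoint_in_k) simp_all
  then show ?thesis using YZ by simp
qed

subsection \<open>Orbits of small neighbourhoods of the identity\<close>

text \<open>The complex spans of \<open>U v\<close>, for \<open>U\<close> running through the neighbourhoods of \<open>1\<close> in \<open>G\<close>,
  decrease with \<open>U\<close>, hence are eventually equal to one subspace. It is preserved by
  a neighbourhood of \<open>1\<close>, hence by the connected group \<open>G\<close>, and irreducibility makes it everything.\<close>

lemma neighbourhood_orbit_spans:
  assumes v: "v \<noteq> 0" and e: "e > 0"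
  shows "vec.span {u *v v |u. u \<in> G \<and> norm (u - mat 1) < e} = UNIV"
proof -
  define S where "S d = vec.span {u *v v |u. u \<in> G \<and> norm (u - mat 1) < d}" for d
  have mono: "S d \<subseteq> S d'" if "d \<le> d'" for d d'
    unfolding S_def using that by (intro vec.span_mono) force
  obtain d0 where d0: "d0 > 0" and least: "\<And>d. d > 0 \<Longrightarrow> vec.dim (S d0) \<le> vec.dim (S d)"
    using ex_has_least_nat[of "\<lambda>d. d > (0::real)" 1 "\<lambda>d. vec.dim (S d)"] by auto
  define d1 where "d1 = min e d0"
  have d1: "d1 > 0" "d1 \<le> e" "d1 \<le> d0" using e d0 by (auto simp: d1_def)
  have stable: "S d = S d0" if "d > 0" "d \<le> d0" for d
    using mono[OF that(2)] least[OF that(1)]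
    by (intro vec.subspace_dim_equal) (auto simp: S_def vec.subspace_span)
  define W where "W = S d1"
  obtain C where C: "C > 0" "\<And>A B. norm ((A :: 'n cmat) ** (B :: 'n cmat)) \<le> norm A * norm B * C"
    using bounded_bilinear.pos_bounded[OF bounded_bilinear_matrix_mult] by blast
  \<comment> \<open>chosen such that the product of two elements at distance less than \<open>d\<close> from \<open>1\<close> is at distance less than \<open>d1\<close>\<close>
  define d where "d = min d1 (d1 / (d1 * C + 2))"
  have den: "d1 * C + 2 > 0" using d1 C by (simp add: add_pos_pos)
  have d: "d > 0" "d \<le> d1" using d1 den by (auto simp: d_def)
  have Wd: "W = S d" unfolding W_def using stable[of d] stable[of d1] d d1 by simp
  have small: "u *v w \<in> W" if u: "u \<in> G" "norm (u - mat 1) < d" and w: "w \<in> W" for u w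
  proof -
    have "w \<in> vec.span {u' *v v |u'. u' \<in> G \<and> norm (u' - mat 1) < d}"
      using w by (simp add: Wd S_def)
    moreover have "vec.span {u' *v v |u'. u' \<in> G \<and> norm (u' - mat 1) < d} \<subseteq> {w. u *v w \<in> W}"
    proof (rule vec.span_minimal[OF subsetI])
      show "vec.subspace {w. u *v w \<in> W}"
        unfolding W_def S_def using vec.subspace_span
        by (auto simp: vec.subspace_def matrix_vector_right_distrib vector_scalar_commute
            vec.span_add vec.span_scale vec.span_zero)
    next
      fix x assume "x \<in> {u' *v v |u'. u' \<in> G \<and> norm (u' - mat 1) < d}"
      then obtain u' where u': "x = u' *v v" "u' \<in> G" "norm (u' - mat 1) < d" by blast
      have "u ** u' - mat 1 = (u - mat 1) ** (u' - mat 1) + (u - mat 1) + (u' - mat 1)"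
        by (simp add: matrix_diff_mult)
      also have "norm \<dots> \<le> norm ((u - mat 1) ** (u' - mat 1)) + norm (u - mat 1) + norm (u' - mat 1)"
        by (intro order.trans[OF norm_triangle_ineq] add_mono) auto
      also have "norm ((u - mat 1) ** (u' - mat 1)) \<le> norm (u - mat 1) * norm (u' - mat 1) * C" by (rule C(2))
      also have "norm (u - mat 1) * norm (u' - mat 1) * C \<le> d * d1 * C"
        using u u' d C by (intro mult_mono) auto
      also have "d * d1 * C + norm (u - mat 1) + norm (u' - mat 1) < d * d1 * C + d + d"
        using u u' by simp
      also have "\<dots> = d * (d1 * C + 2)" by (simp add: algebra_simps)
      also have "\<dots> \<le> d1 / (d1 * C + 2) * (d1 * C + 2)"
        using den by (intro mult_right_mono) (auto simp: d_def)
      also have "\<dots> = d1" using den by simp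
      finally have "norm (u ** u' - mat 1) < d1" by simp
      then have "(u ** u') *v v \<in> W"
        unfolding W_def S_def using G_mult[OF u(1) u'(2)] by (intro vec.span_base) blast
      then show "x \<in> {w. u *v w \<in> W}" by (simp add: u' matrix_vector_mul_assoc)
    qed
    ultimately show ?thesis by blast
  qed
  have subW: "vec.subspace W" by (simp add: W_def S_def vec.subspace_span)
  then have closedW: "closed W" by (simp add: closed_subspace complex_subspace_imp_subspace)
  define H where "H = {g\<in>G. \<forall>w\<in>W. g *v w \<in> W}"
  have "closedin (top_of_set G) H"
  proof -
    have "closed {g. g *v w \<in> W}" for w :: "complex^'n"
      using closed_vimage[OF closedW continuous_matrix_vector_mult[OF continuous_on_id continuous_on_const]]
      by (simp add: vimage_def)
    then have "closed (\<Inter>w\<in>W. {g. g *v w \<in> W})" by blast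
    moreover have "H = G \<inter> (\<Inter>w\<in>W. {g. g *v w \<in> W})" by (auto simp: H_def)
    ultimately show ?thesis by (auto simp: closedin_closed)
  qed
  moreover have "openin (top_of_set G) H"
    unfolding openin_euclidean_subtopology_iff
  proof (intro conjI ballI)
    show "H \<subseteq> G" by (auto simp: H_def)
    fix g assume g: "g \<in> H"
    then have gG: "g \<in> G" by (simp add: H_def)
    \<comment> \<open>chosen such that \<open>g\<^sup>-\<^sup>1 g'\<close> is at distance less than \<open>d\<close> from \<open>1\<close> when \<open>g'\<close> is \<open>r\<close>-close to \<open>g\<close>\<close>
    define r where "r = d / (norm (matrix_inv g) * C + 1)"
    have den': "norm (matrix_inv g) * C + 1 > 0" using C by (simp add: add_nonneg_pos)
    then have r: "r > 0" using d by (simp add: r_def)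
    have "g' \<in> H" if g': "g' \<in> G" "dist g' g < r" for g'
    proof -
      have "matrix_inv g ** g' - mat 1 = matrix_inv g ** (g' - g)"
        by (simp add: matrix_diff_mult matrix_inv_cancel[OF G_invertible[OF gG]])
      then have "norm (matrix_inv g ** g' - mat 1) \<le> norm (matrix_inv g) * norm (g' - g) * C"
        using C(2) by metis
      also have "\<dots> = norm (matrix_inv g) * C * norm (g' - g)" by simp
      also have "\<dots> \<le> (norm (matrix_inv g) * C) * r"
        using g' C by (intro mult_left_mono) (auto simp: dist_norm)
      also have "\<dots> < (norm (matrix_inv g) * C + 1) * r" using r by (simp add: algebra_simps)
      also have "\<dots> = d" using den' by (simp add: r_def)
      finally have *: "norm (matrix_inv g ** g' - mat 1) < d" .
      have "g' *v w \<in> W" if "w \<in> W" for w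
      proof -
        have "(matrix_inv g ** g') *v w \<in> W"
          using small[OF G_mult[OF G_inv[OF gG] g'(1)] *] that by blast
        then have "g *v ((matrix_inv g ** g') *v w) \<in> W" using g by (simp add: H_def)
        then show ?thesis
          by (simp add: matrix_vector_mul_assoc matrix_mul_assoc matrix_inv_cancel[OF G_invertible[OF gG]])
      qed
      then show ?thesis using g' by (simp add: H_def)
    qed
    then show "\<exists>r>0. \<forall>g'\<in>G. dist g' g < r \<longrightarrow> g' \<in> H" using r by blast
  qed
  moreover have "mat 1 \<in> H" using G_one by (simp add: H_def)
  ultimately have "H = G" using connected_G unfolding connected_clopen by blast
  then have "W = {0} \<or> W = UNIV" using irreducible subW unfolding irreducible_action_def H_def by blast
  moreover have "mat 1 *v v \<in> W"
    unfolding W_def S_def using G_one d1 by (intro vec.span_base) force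
  ultimately have "W = UNIV" using v by auto
  then show ?thesis using mono[OF d1(2)] by (auto simp: W_def S_def)
qed

lemma neighbourhood_orbit_not_orthogonal:
  assumes v: "v \<noteq> 0" and x: "x \<noteq> 0" and e: "e > 0"
  obtains u where "u \<in> G" "norm (u - mat 1) < e" "h (u *v v) x \<noteq> 0"
proof (rule ccontr)
  assume "\<not> thesis"
  then have "{u *v v |u. u \<in> G \<and> norm (u - mat 1) < e} \<subseteq> {w. h w x = 0}" using that by blast
  moreover have "vec.subspace {w. h w x = 0}" by (auto simp: vec.subspace_def add_left scale_left)
  ultimately have "vec.span {u *v v |u. u \<in> G \<and> norm (u - mat 1) < e} \<subseteq> {w. h w x = 0}"
    by (rule vec.span_minimal)
  then have "h x x = 0" using neighbourhood_orbit_spans[OF v e] by blast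
  then show False using x by simp
qed

text \<open>The conditions are open, so they are achieved one after the other by translating with elements
  of \<open>G\<close> close to \<open>1\<close>.\<close>

lemma orbit_generic_point:
  assumes v: "v \<noteq> 0" and X: "finite X" "0 \<notin> X"
  shows "\<exists>g\<in>G. \<forall>x\<in>X. h (g *v v) x \<noteq> 0"
  using X
proof (induction X rule: finite_induct)
  case empty
  then show ?case using G_one by blast
next
  case (insert x X)
  then obtain g where g: "g \<in> G" "\<forall>x\<in>X. h (g *v v) x \<noteq> 0" by auto
  define N where "N = (\<Inter>x\<in>X. {u. h (u *v (g *v v)) x \<noteq> 0})"
  have "open {u. h (u *v (g *v v)) x \<noteq> 0}" for x
    by (intro open_Collect_neq continuous_intros)
  then have "open N" unfolding N_def using insert.hyps by (intro open_INT) auto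
  moreover have "mat 1 \<in> N" using g by (simp add: N_def)
  ultimately obtain e where e: "e > 0" "ball (mat 1) e \<subseteq> N" using openE by blast
  have "g *v v \<noteq> 0" using v g G_invertible invertible_vector_nonzero by blast
  moreover have "x \<noteq> 0" using insert.prems by auto
  ultimately obtain u where u: "u \<in> G" "norm (u - mat 1) < e" "h (u *v (g *v v)) x \<noteq> 0"
    using neighbourhood_orbit_not_orthogonal e(1) by blast
  have "u \<in> N" using e(2) u(2) by (auto simp: dist_norm norm_minus_commute)
  then have "\<forall>y\<in>insert x X. h ((u ** g) *v v) y \<noteq> 0"
    using u(3) by (simp add: N_def flip: matrix_vector_mul_assoc)
  then show ?case using G_mult[OF u(1) g(1)] by blast
qed

end

section \<open>Gradient maps and weights of an Abelian subalgebra\<close>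

lemma convex_hull_range:
  fixes x :: "'i::finite \<Rightarrow> 'a::real_vector"
  shows "convex hull (range x) =
    {\<Sum>i\<in>UNIV. c i *\<^sub>R x i |c. (\<forall>i. 0 \<le> c i) \<and> sum c UNIV = 1}" (is "_ = ?R")
proof
  have "x j \<in> ?R" for j
  proof -
    have "x j = (\<Sum>i\<in>UNIV. (if i = j then 1 else 0) *\<^sub>R x i)"
      by (simp add: if_distrib[where f="\<lambda>c. c *\<^sub>R _"] cong: if_cong)
    moreover have "(\<forall>i. 0 \<le> (if i = j then 1 else 0 :: real)) \<and> (\<Sum>i\<in>UNIV. if i = j then 1 else 0 :: real) = 1"
      by simp
    ultimately show ?thesis
      by (intro CollectI exI[of _ "\<lambda>i. if i = j then 1 else 0"] conjI) auto
  qed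
  moreover have "convex ?R"
  proof (rule convexI)
    fix a b and s t :: real assume a: "a \<in> ?R" and b: "b \<in> ?R" and st: "0 \<le> s" "0 \<le> t" "s + t = 1"
    obtain c where c: "a = (\<Sum>i\<in>UNIV. c i *\<^sub>R x i)" "\<forall>i. 0 \<le> c i" "sum c UNIV = 1" using a by blast
    obtain d where d: "b = (\<Sum>i\<in>UNIV. d i *\<^sub>R x i)" "\<forall>i. 0 \<le> d i" "sum d UNIV = 1" using b by blast
    have "s *\<^sub>R a + t *\<^sub>R b = (\<Sum>i\<in>UNIV. (s * c i + t * d i) *\<^sub>R x i)"
      by (simp add: c(1) d(1) scaleR_sum_right sum.distrib algebra_simps)
    moreover have "(\<forall>i. 0 \<le> s * c i + t * d i) \<and> (\<Sum>i\<in>UNIV. s * c i + t * d i) = 1"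
      using c d st by (simp add: sum.distrib flip: sum_distrib_left)
    ultimately show "s *\<^sub>R a + t *\<^sub>R b \<in> ?R"
      by (intro CollectI exI[of _ "\<lambda>i. s * c i + t * d i"] conjI) auto
  qed
  ultimately show "convex hull (range x) \<subseteq> ?R" by (intro hull_minimal) auto
  show "?R \<subseteq> convex hull (range x)"
  proof
    fix y assume "y \<in> ?R"
    then obtain c where c: "y = (\<Sum>i\<in>UNIV. c i *\<^sub>R x i)" "\<forall>i. 0 \<le> c i" "sum c UNIV = 1" by blast
    show "y \<in> convex hull (range x)"
      unfolding c(1) using c by (intro convex_sum) (auto simp: hull_inc)
  qed
qed

locale weight_frame = compatible_group h G K \<pp> + orthonormal_frame h f
  for h :: "complex^'n::finite \<Rightarrow> complex^'n \<Rightarrow> complex" and G K \<pp> :: "'n cmat set"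
    and f :: "'n \<Rightarrow> complex^'n" +
  fixes \<aa> :: "'n cmat set" and ip :: "'n cmat \<Rightarrow> 'n cmat \<Rightarrow> real"
  assumes abelian: "abelian_subalgebra \<aa> \<pp>"
    and invariant: "Ad_invariant_scalar_product K \<pp> ip"
    and weight_vectors: "Z \<in> \<aa> \<Longrightarrow> \<exists>r. Z *v f i = complex_of_real r *s f i"
begin

lemma a_subspace: "subspace \<aa>"
  and a_subset_p: "Z \<in> \<aa> \<Longrightarrow> Z \<in> \<pp>"
  and a_commute: "Y \<in> \<aa> \<Longrightarrow> Z \<in> \<aa> \<Longrightarrow> Y ** Z = Z ** Y"
  using abelian by (auto simp: abelian_subalgebra_def lie_bracket_def)

lemma ip_Ad: "k \<in> K \<Longrightarrow> X \<in> \<pp> \<Longrightarrow> Y \<in> \<pp> \<Longrightarrow> ip (Ad k X) (Ad k Y) = ip X Y"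
  using invariant by (simp add: Ad_invariant_scalar_product_def)

sublocale P: subspace_inner \<pp> ip
  using invariant p_subspace by unfold_locales (auto simp: Ad_invariant_scalar_product_def)

sublocale A: subspace_inner \<aa> ip
  using a_subspace a_subset_p by (intro P.restrict) auto

text \<open>For \<open>Z \<in> \<aa>\<close> this is the eigenvalue of \<open>Z\<close> on \<open>f i\<close>; the formula extends it to a linear function
  of all matrices, so that it is visibly continuous.\<close>

definition weight :: "'n \<Rightarrow> 'n cmat \<Rightarrow> real" where
  "weight i Z = Re (h (Z *v f i) (f i))"

lemma weight_vector:
  assumes "Z \<in> \<aa>"
  shows "Z *v f i = complex_of_real (weight i Z) *s f i"
proof -
  obtain r where "Z *v f i = complex_of_real r *s f i" using weight_vectors[OF assms] by blast
  then show ?thesis by (simp add: weight_def scale_left orthonormal)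
qed

lemma weight_add: "weight i (Y + Z) = weight i Y + weight i Z"
  by (simp add: weight_def matrix_vector_mult_add_rdistrib add_left)

lemma weight_scale: "weight i (c *\<^sub>R Z) = c * weight i Z"
  by (simp add: weight_def scaleR_matrix_vector scale_left)

text \<open>The weights as elements of \<open>\<aa>\<close>, through the scalar product: the moment map takes its values
  there, and the Weyl group acts there.\<close>

definition weight_point :: "'n \<Rightarrow> 'n cmat" where
  "weight_point i = (THE x. x \<in> \<aa> \<and> (\<forall>Z\<in>\<aa>. ip x Z = weight i Z))"

lemma weight_point: "weight_point i \<in> \<aa>" "Z \<in> \<aa> \<Longrightarrow> ip (weight_point i) Z = weight i Z"
proof -
  have "\<exists>!x. x \<in> \<aa> \<and> (\<forall>Z\<in>\<aa>. ip x Z = weight i Z)"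
    by (rule A.representing_vector) (simp_all add: weight_add weight_scale)
  then have "weight_point i \<in> \<aa> \<and> (\<forall>Z\<in>\<aa>. ip (weight_point i) Z = weight i Z)"
    unfolding weight_point_def by (rule theI')
  then show "weight_point i \<in> \<aa>" "Z \<in> \<aa> \<Longrightarrow> ip (weight_point i) Z = weight i Z" by auto
qed

definition rayleigh :: "complex^'n \<Rightarrow> 'n cmat \<Rightarrow> real" where
  "rayleigh v Z = Re (h (Z *v v) v) / Re (h v v)"

lemma rayleigh_add: "rayleigh v (Y + Z) = rayleigh v Y + rayleigh v Z"
  by (simp add: rayleigh_def matrix_vector_mult_add_rdistrib add_left add_divide_distrib)

lemma rayleigh_scale: "rayleigh v (c *\<^sub>R Z) = c * rayleigh v Z"
  by (simp add: rayleigh_def scaleR_matrix_vector scale_left)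

lemma rayleigh_eigenvector:
  assumes "v \<noteq> 0" "Z *v v = complex_of_real r *s v"
  shows "rayleigh v Z = r"
  using positive[OF assms(1)] by (simp add: rayleigh_def assms(2) scale_left)

lemma rayleigh_proj:
  assumes "Z \<in> \<pp>" "w \<in> proj v" "w \<noteq> 0"
  shows "h (Z *v w) w / h w w = complex_of_real (rayleigh v Z)"
proof -
  obtain c where w: "w = c *s v" using assms(2) by (auto simp: proj_eq)
  then have c: "c \<noteq> 0" "v \<noteq> 0" using assms(3) by auto
  have "h (Z *v w) w / h w w = h (Z *v v) v / h v v"
    using c by (simp add: w vector_scalar_commute scale_left scale_right)
  also have "\<dots> = complex_of_real (Re (h (Z *v v) v)) / complex_of_real (Re (h v v))"
    using selfadjoint_diagonal_real[OF p_selfadjoint[OF assms(1)]] diagonal_real by metis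
  finally show ?thesis by (simp add: rayleigh_def)
qed

lemma gradient_map:
  assumes v: "v \<noteq> 0"
  shows "gradient_map h ip \<pp> (proj v) \<in> \<pp> \<and> (\<forall>Z\<in>\<pp>. ip (gradient_map h ip \<pp> (proj v)) Z = rayleigh v Z)"
proof -
  have "(X \<in> \<pp> \<and> (\<forall>Z\<in>\<pp>. \<forall>w\<in>proj v. w \<noteq> 0 \<longrightarrow> complex_of_real (ip X Z) = h (Z *v w) w / h w w))
      \<longleftrightarrow> X \<in> \<pp> \<and> (\<forall>Z\<in>\<pp>. ip X Z = rayleigh v Z)" for X
    using rayleigh_proj v mem_proj[of v] by auto
  then have eq: "gradient_map h ip \<pp> (proj v) = (THE X. X \<in> \<pp> \<and> (\<forall>Z\<in>\<pp>. ip X Z = rayleigh v Z))"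
    unfolding gradient_map_def by simp
  have "\<exists>!X. X \<in> \<pp> \<and> (\<forall>Z\<in>\<pp>. ip X Z = rayleigh v Z)"
    by (rule P.representing_vector) (simp_all add: rayleigh_add rayleigh_scale)
  then show ?thesis unfolding eq by (rule theI')
qed

definition moment :: "complex^'n \<Rightarrow> 'n cmat" where
  "moment v = A_gradient_map h ip \<pp> \<aa> (proj v)"

lemma moment:
  assumes v: "v \<noteq> 0"
  shows "moment v \<in> \<aa> \<and> (\<forall>Z\<in>\<aa>. ip (moment v) Z = rayleigh v Z)"
proof -
  define X where "X = gradient_map h ip \<pp> (proj v)"
  have X: "X \<in> \<pp>" "\<And>Z. Z \<in> \<pp> \<Longrightarrow> ip X Z = rayleigh v Z" using gradient_map[OF v] by (auto simp: X_def)
  have "(Y \<in> \<aa> \<and> (\<forall>Z\<in>\<aa>. ip (X - Y) Z = 0)) \<longleftrightarrow> Y \<in> \<aa> \<and> (\<forall>Z\<in>\<aa>. ip Y Z = rayleigh v Z)" for Y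
    using X a_subset_p by (auto simp: P.ip_diff)
  then have eq: "moment v = (THE Y. Y \<in> \<aa> \<and> (\<forall>Z\<in>\<aa>. ip Y Z = rayleigh v Z))"
    unfolding moment_def A_gradient_map_def orth_projection_def o_def X_def by simp
  have "\<exists>!Y. Y \<in> \<aa> \<and> (\<forall>Z\<in>\<aa>. ip Y Z = rayleigh v Z)"
    by (rule A.representing_vector) (simp_all add: rayleigh_add rayleigh_scale)
  then show ?thesis unfolding eq by (rule theI')
qed

lemma moment_eqI:
  assumes "v \<noteq> 0" "y \<in> \<aa>" "\<And>Z. Z \<in> \<aa> \<Longrightarrow> ip y Z = rayleigh v Z"
  shows "moment v = y"
  using moment[OF assms(1)] assms(2,3) by (intro A.ip_unique) auto

lemma coordinate_weight: "Z \<in> \<aa> \<Longrightarrow> h (Z *v v) (f i) = complex_of_real (weight i Z) * h v (f i)"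
  using p_selfadjoint[OF a_subset_p] by (simp add: selfadjoint_def weight_vector scale_right)

lemma rayleigh_coordinates:
  assumes "Z \<in> \<aa>"
  shows "rayleigh v Z = (\<Sum>i\<in>UNIV. (cmod (h v (f i)))\<^sup>2 * weight i Z) / Re (h v v)"
proof -
  have "h (Z *v v) v = (\<Sum>i\<in>UNIV. complex_of_real (weight i Z) * (h v (f i) * cnj (h v (f i))))"
    by (subst parseval) (simp add: coordinate_weight[OF assms] mult.assoc)
  also have "Re \<dots> = (\<Sum>i\<in>UNIV. (cmod (h v (f i)))\<^sup>2 * weight i Z)"
    by (simp add: mult.commute flip: complex_norm_square)
  finally show ?thesis by (simp add: rayleigh_def)
qed

lemma convex_combination_mem:
  "(\<Sum>i\<in>UNIV. c i *\<^sub>R weight_point i) \<in> \<aa>"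
  by (intro subspace_sum[OF a_subspace] subspace_scale[OF a_subspace] weight_point)

lemma ip_convex_combination:
  assumes "Z \<in> \<aa>"
  shows "ip (\<Sum>i\<in>UNIV. c i *\<^sub>R weight_point i) Z = (\<Sum>i\<in>UNIV. c i * weight i Z)"
  using assms weight_point subspace_scale[OF a_subspace]
  by (subst A.ip_sum) (auto simp: A.ip_scale)

lemma moment_coordinates:
  assumes "v \<noteq> 0"
  shows "moment v = (\<Sum>i\<in>UNIV. ((cmod (h v (f i)))\<^sup>2 / Re (h v v)) *\<^sub>R weight_point i)"
proof (rule moment_eqI[OF assms convex_combination_mem])
  show "ip (\<Sum>i\<in>UNIV. ((cmod (h v (f i)))\<^sup>2 / Re (h v v)) *\<^sub>R weight_point i) Z = rayleigh v Z"
    if "Z \<in> \<aa>" for Z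
    using that by (simp add: ip_convex_combination rayleigh_coordinates sum_divide_distrib)
qed

text \<open>The squared moduli of the coordinates of a unit vector are arbitrary barycentric coordinates,
  and they are the barycentric coordinates of its moment with respect to the weights.\<close>

theorem image_PV: "A_gradient_map h ip \<pp> \<aa> ` PV = convex hull (range weight_point)"
proof
  show "A_gradient_map h ip \<pp> \<aa> ` PV \<subseteq> convex hull (range weight_point)"
  proof
    fix y assume "y \<in> A_gradient_map h ip \<pp> \<aa> ` PV"
    then obtain v where v: "v \<noteq> 0" "y = moment v" by (auto simp: PV_def moment_def)
    have "(\<Sum>i\<in>UNIV. (cmod (h v (f i)))\<^sup>2 / Re (h v v)) = 1"
      using positive[OF v(1)] by (simp add: parseval_norm flip: sum_divide_distrib)
    moreover have "0 \<le> (cmod (h v (f i)))\<^sup>2 / Re (h v v)" for i using diagonal_nonneg by simp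
    ultimately show "y \<in> convex hull (range weight_point)"
      unfolding convex_hull_range v(2) moment_coordinates[OF v(1)]
      by (intro CollectI exI[of _ "\<lambda>i. (cmod (h v (f i)))\<^sup>2 / Re (h v v)"] conjI allI refl)
  qed
  show "convex hull (range weight_point) \<subseteq> A_gradient_map h ip \<pp> \<aa> ` PV"
  proof
    fix y assume "y \<in> convex hull (range weight_point)"
    then obtain c where c: "y = (\<Sum>i\<in>UNIV. c i *\<^sub>R weight_point i)" "\<forall>i. 0 \<le> c i" "sum c UNIV = 1"
      unfolding convex_hull_range by blast
    define v where "v = (\<Sum>i\<in>UNIV. complex_of_real (sqrt (c i)) *s f i)"
    have coord: "h v (f i) = complex_of_real (sqrt (c i))" for i by (simp add: v_def coordinate_of_sum)
    have sq: "(cmod (h v (f i)))\<^sup>2 = c i" for i using c by (simp add: coord)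
    then have norm: "Re (h v v) = 1" using c by (simp add: parseval_norm)
    then have v: "v \<noteq> 0" by auto
    have "y = moment v" using moment_coordinates[OF v] by (simp add: sq norm c(1))
    then show "y \<in> A_gradient_map h ip \<pp> \<aa> ` PV" using v by (auto simp: moment_def PV_def)
  qed
qed

lemma bounded_linear_weight: "bounded_linear (weight i)"
proof -
  have "linear (weight i)" by (auto intro!: linearI simp: weight_add weight_scale)
  then show ?thesis using linear_conv_bounded_linear by blast
qed

lemma mexp_coordinate:
  assumes "Z \<in> \<aa>"
  shows "h (mexp Z *v v) (f i) = complex_of_real (exp (weight i Z)) * h v (f i)"
  using mexp_diagonal[of Z "\<lambda>i. complex_of_real (weight i Z)"] weight_vector[OF assms]
  by (simp add: diag_coordinate exp_of_real)

text \<open>Every point of the convex hull is approximated by the moment map on a single orbit of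
  \<open>exp \<aa>\<close> through a vector \<open>v\<close> with no vanishing coordinate. For the point with barycentric
  coordinates \<open>c\<close>, the function \<open>F(\<xi>) = (\<Sum>i. |v\<^sub>i|\<^sup>2 exp (2 (\<lambda>\<^sub>i - L)(\<xi>)))\<close> with \<open>L = (\<Sum>i. c\<^sub>i \<lambda>\<^sub>i)\<close>
  is bounded below by a positive constant, and its logarithmic gradient is twice the error. A minimiser
  of \<open>F + \<epsilon> |\<xi>|\<^sup>2\<close> is an almost critical point of \<open>F\<close>.\<close>

lemma moment_approximation:
  assumes v: "\<forall>i. h v (f i) \<noteq> 0" and c: "\<forall>i. 0 \<le> c i" "sum c UNIV = 1"
  obtains C where "\<forall>e>0. \<exists>\<xi>\<in>\<aa>. \<forall>Z\<in>\<aa>.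
    \<bar>rayleigh (mexp \<xi> *v v) Z - (\<Sum>i\<in>UNIV. c i * weight i Z)\<bar> \<le> C * sqrt e * norm Z"
proof -
  define a where "a i = (cmod (h v (f i)))\<^sup>2" for i
  define L where "L Z = (\<Sum>i\<in>UNIV. c i * weight i Z)" for Z
  define E where "E \<xi> i = a i * exp (2 * (weight i \<xi> - L \<xi>))" for \<xi> i
  define F where "F \<xi> = (\<Sum>i\<in>UNIV. E \<xi> i)" for \<xi>
  define m where "m = Min (range a)"
  have a_pos: "a i > 0" for i using v by (simp add: a_def)
  have m_pos: "m > 0" unfolding m_def using a_pos by simp
  have E_pos: "E \<xi> i > 0" for \<xi> i by (simp add: E_def a_pos)
  have L_add: "L (Y + Z) = L Y + L Z" for Y Z by (simp add: L_def weight_add sum.distrib algebra_simps)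
  have L_scale: "L (t *\<^sub>R Z) = t * L Z" for t Z
    by (simp add: L_def weight_scale sum_distrib_left mult.left_commute)
  \<comment> \<open>\<open>L\<close> is a convex combination of the weights, so some weight is at least \<open>L\<close> at \<open>\<xi>\<close>\<close>
  have F_lower: "m \<le> F \<xi>" for \<xi>
  proof -
    have "\<exists>i. L \<xi> \<le> weight i \<xi>"
    proof (rule ccontr)
      assume "\<not> (\<exists>i. L \<xi> \<le> weight i \<xi>)"
      then have less: "weight i \<xi> < L \<xi>" for i by (simp add: not_le)
      have "\<exists>i. c i > 0" using c by (metis less_irrefl linorder_not_less order_antisym sum.neutral zero_less_one)
      then obtain j where "c j > 0" by blast
      then have "(\<Sum>i\<in>UNIV. c i * weight i \<xi>) < (\<Sum>i\<in>UNIV. c i * L \<xi>)"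
      proof (intro sum_strict_mono_ex1 ballI)
        show "\<exists>i\<in>UNIV. c i * weight i \<xi> < c i * L \<xi>" using less[of j] \<open>c j > 0\<close>
          by (intro bexI[of _ j]) simp_all
        show "c i * weight i \<xi> \<le> c i * L \<xi>" for i
          using less[of i] c(1) by (simp add: mult_left_mono)
      qed simp
      then show False using c(2) by (simp add: L_def flip: sum_distrib_right)
    qed
    then obtain i where "L \<xi> \<le> weight i \<xi>" by blast
    then have "m * 1 \<le> a i * exp (2 * (weight i \<xi> - L \<xi>))"
      using m_pos by (intro mult_mono) (auto simp: m_def less_imp_le[OF a_pos])
    also have "\<dots> \<le> F \<xi>" unfolding F_def E_def[symmetric]
      by (rule member_le_sum) (auto simp: less_imp_le[OF E_pos])
    finally show ?thesis by simp
  qed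
  have F_pos: "F \<xi> > 0" for \<xi> using F_lower[of \<xi>] m_pos by linarith
  have ray: "rayleigh (mexp \<xi> *v v) Z - L Z = (\<Sum>i\<in>UNIV. E \<xi> i * (weight i Z - L Z)) / F \<xi>"
    if \<xi>: "\<xi> \<in> \<aa>" and Z: "Z \<in> \<aa>" for \<xi> Z
  proof -
    have sq: "(cmod (h (mexp \<xi> *v v) (f i)))\<^sup>2 = exp (2 * L \<xi>) * E \<xi> i" for i
    proof -
      have "(cmod (h (mexp \<xi> *v v) (f i)))\<^sup>2 = exp (weight i \<xi>) * exp (weight i \<xi>) * a i"
        by (simp add: mexp_coordinate[OF \<xi>] norm_mult power_mult_distrib a_def power2_eq_square)
      also have "exp (weight i \<xi>) * exp (weight i \<xi>) = exp (2 * L \<xi>) * exp (2 * (weight i \<xi> - L \<xi>))"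
        by (simp add: algebra_simps flip: exp_add)
      finally show ?thesis by (simp add: E_def)
    qed
    have "rayleigh (mexp \<xi> *v v) Z = (\<Sum>i\<in>UNIV. E \<xi> i * weight i Z) / F \<xi>"
      unfolding rayleigh_coordinates[OF Z] parseval_norm sq F_def
      by (simp add: mult.assoc flip: sum_distrib_left)
    moreover have "(\<Sum>i\<in>UNIV. E \<xi> i * (weight i Z - L Z)) = (\<Sum>i\<in>UNIV. E \<xi> i * weight i Z) - F \<xi> * L Z"
      by (simp add: F_def right_diff_distrib sum_subtractf sum_distrib_right)
    ultimately show ?thesis using F_pos[of \<xi>] by (simp add: field_simps)
  qed
  have cont: "continuous_on UNIV F"
    unfolding F_def E_def L_def
    by (intro continuous_intros linear_continuous_on bounded_linear_weight)
  have main: "\<exists>\<xi>\<in>\<aa>. \<forall>Z\<in>\<aa>. \<bar>rayleigh (mexp \<xi> *v v) Z - L Z\<bar> \<le> sqrt (F 0) / m * sqrt e * norm Z"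
    if e: "e > 0" for e
  proof -
    \<comment> \<open>outside the ball of radius \<open>R\<close> the penalty alone exceeds the value at \<open>0\<close>\<close>
    define R where "R = sqrt (F 0 / e)"
    define H where "H \<xi> = F \<xi> + e * (norm \<xi>)\<^sup>2" for \<xi>
    have R0: "R \<ge> 0" using F_pos[of 0] e by (simp add: R_def)
    have "compact (\<aa> \<inter> cball 0 R)" by (simp add: closed_Int_compact closed_subspace a_subspace)
    moreover have "continuous_on (\<aa> \<inter> cball 0 R) H"
      unfolding H_def by (intro continuous_intros continuous_on_subset[OF cont]) auto
    moreover have z: "0 \<in> \<aa> \<inter> cball 0 R" using R0 A.zero_mem by simp
    ultimately obtain \<xi> where \<xi>: "\<xi> \<in> \<aa> \<inter> cball 0 R" and min: "\<forall>y\<in>\<aa> \<inter> cball 0 R. H \<xi> \<le> H y"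
      using continuous_attains_inf[of "\<aa> \<inter> cball 0 R" H] by blast
    have H0: "H \<xi> \<le> F 0" using bspec[OF min z] by (simp add: H_def)
    have global: "H \<xi> \<le> H y" if "y \<in> \<aa>" for y
    proof (cases "norm y \<le> R")
      case True
      then show ?thesis using min that by simp
    next
      case False
      then have "R\<^sup>2 \<le> (norm y)\<^sup>2" using R0 by (intro power_mono) auto
      then have "F 0 \<le> e * (norm y)\<^sup>2" using e F_pos[of 0] by (simp add: R_def field_simps)
      then show ?thesis using H0 F_pos[of y] by (simp add: H_def)
    qed
    have small: "e * norm \<xi> \<le> sqrt (F 0) * sqrt e"
    proof -
      have "e * (norm \<xi>)\<^sup>2 \<le> F 0" using H0 F_pos[of \<xi>] by (simp add: H_def)
      then have "e * (e * (norm \<xi>)\<^sup>2) \<le> e * F 0" using e by simp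
      then have "(e * norm \<xi>)\<^sup>2 \<le> F 0 * e" by (simp add: power2_eq_square mult.commute mult.left_commute)
      then show ?thesis by (simp add: real_le_rsqrt flip: real_sqrt_mult)
    qed
    have crit: "(\<Sum>i\<in>UNIV. E \<xi> i * (weight i Z - L Z)) = - e * (\<xi> \<bullet> Z)" if Z: "Z \<in> \<aa>" for Z
    proof -
      define \<phi> where "\<phi> t = (\<Sum>i\<in>UNIV. a i * exp (2 * ((weight i \<xi> - L \<xi>) + t * (weight i Z - L Z))))
        + e * ((norm \<xi>)\<^sup>2 + 2 * t * (\<xi> \<bullet> Z) + t\<^sup>2 * (norm Z)\<^sup>2)" for t
      have \<phi>: "\<phi> t = H (\<xi> + t *\<^sub>R Z)" for t
      proof -
        have "(norm (\<xi> + t *\<^sub>R Z))\<^sup>2 = (norm \<xi>)\<^sup>2 + 2 * t * (\<xi> \<bullet> Z) + t\<^sup>2 * (norm Z)\<^sup>2"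
          unfolding power2_norm_eq_inner
          by (simp add: inner_add inner_commute algebra_simps power2_eq_square)
        then show ?thesis
          by (simp add: \<phi>_def H_def F_def E_def weight_add weight_scale L_add L_scale algebra_simps)
      qed
      have "(\<phi> has_real_derivative (\<Sum>i\<in>UNIV. E \<xi> i * (2 * (weight i Z - L Z))) + e * (2 * (\<xi> \<bullet> Z))) (at 0)"
        unfolding \<phi>_def
        by (auto intro!: derivative_eq_intros sum.cong simp: E_def mult_ac)
      moreover have "\<forall>t. \<bar>0 - t\<bar> < 1 \<longrightarrow> \<phi> 0 \<le> \<phi> t"
        using global \<xi> Z subspace_add[OF a_subspace] subspace_scale[OF a_subspace] by (simp add: \<phi>)
      ultimately have "(\<Sum>i\<in>UNIV. E \<xi> i * (2 * (weight i Z - L Z))) + e * (2 * (\<xi> \<bullet> Z)) = 0"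
        by (intro DERIV_local_min[where d=1]) auto
      moreover have "(\<Sum>i\<in>UNIV. E \<xi> i * (2 * (weight i Z - L Z))) = 2 * (\<Sum>i\<in>UNIV. E \<xi> i * (weight i Z - L Z))"
        by (simp add: sum_distrib_left mult_ac)
      ultimately show ?thesis by simp
    qed
    have "\<bar>rayleigh (mexp \<xi> *v v) Z - L Z\<bar> \<le> sqrt (F 0) / m * sqrt e * norm Z" if Z: "Z \<in> \<aa>" for Z
    proof -
      have "\<bar>rayleigh (mexp \<xi> *v v) Z - L Z\<bar> = e * \<bar>\<xi> \<bullet> Z\<bar> / F \<xi>"
        using \<xi> Z F_pos[of \<xi>] e by (simp add: ray crit abs_mult)
      also have "\<dots> \<le> (e * norm \<xi> * norm Z) / m"
        using e F_lower[of \<xi>] m_pos Cauchy_Schwarz_ineq2[of \<xi> Z] by (intro frac_le) auto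
      also have "\<dots> \<le> (sqrt (F 0) * sqrt e * norm Z) / m"
        using small m_pos by (intro divide_right_mono mult_right_mono) auto
      finally show ?thesis by simp
    qed
    then show ?thesis using \<xi> by blast
  qed
  then show ?thesis using that[of "sqrt (F 0) / m"] unfolding L_def by blast
qed

lemma frame_nonzero: "f i \<noteq> 0"
  using orthonormal[of i i] by auto

end

locale closed_orbit = weight_frame h G K \<pp> f \<aa> ip
  for h :: "complex^'n::finite \<Rightarrow> complex^'n \<Rightarrow> complex" and G K \<pp> :: "'n cmat set"
    and f :: "'n \<Rightarrow> complex^'n" and \<aa> :: "'n cmat set" and ip :: "'n cmat \<Rightarrow> 'n cmat \<Rightarrow> real" +
  fixes \<O> :: "(complex^'n) set set"
  assumes orbit: "is_closed_orbit G \<O>"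
begin

lemma orbit_closed: "closed_in_PV \<O>"
  using orbit by (simp add: is_closed_orbit_def)

lemma orbit_base: "\<exists>u. u \<noteq> 0 \<and> \<O> = (\<lambda>g. proj (g *v u)) ` G"
proof -
  obtain L where L: "L \<in> PV" "\<O> = proj_orbit G L"
    using orbit by (auto simp: is_closed_orbit_def)
  then obtain u where u: "u \<noteq> 0" "L = proj u" by (auto simp: PV_iff)
  then have "\<O> = (\<lambda>g. proj (g *v u)) ` G" using L(2) by (simp add: proj_orbit_proj)
  then show ?thesis using u(1) by blast
qed

lemma orbit_transitive:
  assumes "proj v \<in> \<O>" "v \<noteq> 0"
  shows "\<O> = (\<lambda>g. proj (g *v v)) ` G"
proof -
  obtain u where u: "\<O> = (\<lambda>g. proj (g *v u)) ` G" using orbit_base by (elim exE conjE)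
  then obtain g where g: "g \<in> G" "proj v = proj (g *v u)" using assms(1) by blast
  obtain c where c: "c \<noteq> 0" "v = c *s (g *v u)" by (rule proj_eqE[OF g(2) assms(2)])
  have eq: "proj (g' *v v) = proj ((g' ** g) *v u)" for g'
    unfolding c(2) vector_scalar_commute proj_scale[OF c(1)] by (simp add: matrix_vector_mul_assoc)
  show ?thesis
  proof
    show "(\<lambda>g. proj (g *v v)) ` G \<subseteq> \<O>" using g G_mult by (auto simp: eq u)
    show "\<O> \<subseteq> (\<lambda>g. proj (g *v v)) ` G"
    proof
      fix L assume "L \<in> \<O>"
      then obtain g' where g': "g' \<in> G" "L = proj (g' *v u)" using u by blast
      have "(g' ** matrix_inv g) ** g = g'"
        by (simp add: matrix_inv_cancel[OF G_invertible[OF g(1)]] flip: matrix_mul_assoc)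
      then have "L = proj ((g' ** matrix_inv g) *v v)" unfolding eq using g' by simp
      then show "L \<in> (\<lambda>g. proj (g *v v)) ` G" using G_mult[OF g'(1) G_inv[OF g(1)]] by blast
    qed
  qed
qed

lemma orbit_invariant: "proj v \<in> \<O> \<Longrightarrow> v \<noteq> 0 \<Longrightarrow> g \<in> G \<Longrightarrow> proj (g *v v) \<in> \<O>"
  using orbit_transitive by blast

lemma orbit_generic_vector:
  obtains v where "v \<noteq> 0" "proj v \<in> \<O>" "\<forall>i. h v (f i) \<noteq> 0"
proof -
  obtain u where u: "u \<noteq> 0" "\<O> = (\<lambda>g. proj (g *v u)) ` G" using orbit_base by (elim exE conjE)
  have "finite (range f)" "0 \<notin> range f" using frame_nonzero by (auto simp: image_iff)
  then obtain g where g: "g \<in> G" "\<forall>x\<in>range f. h (g *v u) x \<noteq> 0"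
    using orbit_generic_point[OF u(1)] by blast
  show ?thesis
  proof (rule that)
    show "g *v u \<noteq> 0" using u g G_invertible invertible_vector_nonzero by blast
    show "proj (g *v u) \<in> \<O>" using u g by blast
    show "\<forall>i. h (g *v u) (f i) \<noteq> 0" using g by blast
  qed
qed

text \<open>The vectors from the preceding approximation, rescaled to norm \<open>1\<close>, accumulate at a vector whose
  moment is the prescribed point; it still represents a point of the orbit, because the orbit is
  closed.\<close>

theorem image_orbit: "A_gradient_map h ip \<pp> \<aa> ` PV = A_gradient_map h ip \<pp> \<aa> ` \<O>"
proof
  have "\<O> \<subseteq> PV" using orbit_closed by (simp add: closed_in_PV_def)
  then show "A_gradient_map h ip \<pp> \<aa> ` \<O> \<subseteq> A_gradient_map h ip \<pp> \<aa> ` PV" by blast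
  show "A_gradient_map h ip \<pp> \<aa> ` PV \<subseteq> A_gradient_map h ip \<pp> \<aa> ` \<O>"
    unfolding image_PV
  proof
    fix y assume "y \<in> convex hull (range weight_point)"
    then obtain c where c: "y = (\<Sum>i\<in>UNIV. c i *\<^sub>R weight_point i)" "\<forall>i. 0 \<le> c i" "sum c UNIV = 1"
      unfolding convex_hull_range by blast
    obtain v where v: "v \<noteq> 0" "proj v \<in> \<O>" "\<forall>i. h v (f i) \<noteq> 0" by (rule orbit_generic_vector)
    define L where "L Z = (\<Sum>i\<in>UNIV. c i * weight i Z)" for Z
    obtain C where C: "\<forall>e>0. \<exists>\<xi>\<in>\<aa>. \<forall>Z\<in>\<aa>. \<bar>rayleigh (mexp \<xi> *v v) Z - L Z\<bar> \<le> C * sqrt e * norm Z"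
      unfolding L_def by (rule moment_approximation[OF v(3) c(2,3)])
    have "\<exists>\<xi>\<in>\<aa>. \<forall>Z\<in>\<aa>. \<bar>rayleigh (mexp \<xi> *v v) Z - L Z\<bar> \<le> C * sqrt (inverse (real (Suc n))) * norm Z" for n
      using C by simp
    then have "\<forall>n. \<exists>\<xi>. \<xi> \<in> \<aa> \<and> (\<forall>Z\<in>\<aa>. \<bar>rayleigh (mexp \<xi> *v v) Z - L Z\<bar> \<le> C * sqrt (inverse (real (Suc n))) * norm Z)"
      by blast
    from choice[OF this] obtain \<xi> where "\<forall>n. \<xi> n \<in> \<aa> \<and> (\<forall>Z\<in>\<aa>. \<bar>rayleigh (mexp (\<xi> n) *v v) Z - L Z\<bar>
        \<le> C * sqrt (inverse (real (Suc n))) * norm Z)"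
      by (rule exE)
    then have \<xi>: "\<xi> n \<in> \<aa>"
      "Z \<in> \<aa> \<Longrightarrow> \<bar>rayleigh (mexp (\<xi> n) *v v) Z - L Z\<bar> \<le> C * sqrt (inverse (real (Suc n))) * norm Z" for n Z
      by auto
    define w where "w n = mexp (\<xi> n) *v v" for n
    have mexpG: "mexp (\<xi> n) \<in> G" for n using mexp_p a_subset_p \<xi>(1) by blast
    have w0: "w n \<noteq> 0" for n
      unfolding w_def using invertible_vector_nonzero[OF G_invertible[OF mexpG] v(1)] .
    define u where "u n = complex_of_real (1 / norm (w n)) *s w n" for n
    have c0: "complex_of_real (1 / norm (w n)) \<noteq> 0" for n using w0[of n] by simp
    have u: "norm (u n) = 1" "proj (u n) \<in> \<O>" "rayleigh (u n) Z = rayleigh (w n) Z" for n Z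
    proof -
      show "norm (u n) = 1" using w0[of n] unfolding u_def scaleR_eq_vector_scalar[symmetric] by simp
      show "proj (u n) \<in> \<O>"
        unfolding u_def proj_scale[OF c0] unfolding w_def using orbit_invariant[OF v(2,1) mexpG] .
      show "rayleigh (u n) Z = rayleigh (w n) Z"
        unfolding rayleigh_def u_def vector_scalar_commute using w0[of n] by (simp add: scale_left scale_right)
    qed
    have "compact (sphere 0 1 :: (complex^'n) set)" by simp
    then obtain l r where l: "l \<in> sphere 0 1" "strict_mono r" "(u \<circ> r) \<longlonglongrightarrow> l"
      unfolding compact_def using u(1) by (auto dest!: spec[of _ u])
    have l0: "l \<noteq> 0" using l(1) by auto
    have lO: "proj l \<in> \<O>"
    proof (rule closed_in_PV_limit[OF orbit_closed _ _ l(3) l0])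
      show "(u \<circ> r) n \<noteq> 0" for n using u(1)[of "r n"] by auto
      show "proj ((u \<circ> r) n) \<in> \<O>" for n using u(2) by simp
    qed
    have "rayleigh l Z = L Z" if Z: "Z \<in> \<aa>" for Z
    proof -
      have lim: "(\<lambda>n. u (r n)) \<longlonglongrightarrow> l" using l(3) by (simp add: o_def)
      have "Re (h l l) \<noteq> 0" using positive[OF l0] by simp
      then have 1: "(\<lambda>n. rayleigh (u (r n)) Z) \<longlonglongrightarrow> rayleigh l Z"
        unfolding rayleigh_def
        by (intro tendsto_divide tendsto_Re tendsto_form tendsto_matrix_vector_mult tendsto_const lim)
      have "(\<lambda>n. C * sqrt (inverse (real (Suc n))) * norm Z) \<longlonglongrightarrow> C * sqrt 0 * norm Z"
        by (intro tendsto_mult tendsto_const tendsto_real_sqrt LIMSEQ_inverse_real_of_nat)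
      then have null: "(\<lambda>n. C * sqrt (inverse (real (Suc n))) * norm Z) \<longlonglongrightarrow> 0" by simp
      have "norm (rayleigh (u n) Z - L Z) \<le> C * sqrt (inverse (real (Suc n))) * norm Z" for n
        using \<xi>(2)[OF Z, of n] by (simp add: u(3) w_def)
      then have "(\<lambda>n. rayleigh (u n) Z - L Z) \<longlonglongrightarrow> 0"
        by (intro Lim_null_comparison[OF _ null] always_eventually allI)
      then have "(\<lambda>n. rayleigh (u n) Z) \<longlonglongrightarrow> L Z" by (rule LIM_zero_cancel)
      from LIMSEQ_subseq_LIMSEQ[OF this l(2)] have "(\<lambda>n. rayleigh (u (r n)) Z) \<longlonglongrightarrow> L Z"
        by (simp add: o_def)
      with 1 show ?thesis by (rule LIMSEQ_unique)
    qed
    then have "moment l = y"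
      unfolding c(1) by (intro moment_eqI l0 convex_combination_mem) (simp add: ip_convex_combination L_def)
    then show "y \<in> A_gradient_map h ip \<pp> \<aa> ` \<O>" using lO by (auto simp: moment_def)
  qed
qed

end

section \<open>Interpolation and Dini derivatives\<close>

text \<open>Values are prescribed at one node after another: the product of the \<open>x - d\<close> over the earlier
  nodes \<open>d\<close> changes the value at the new node without disturbing the others.\<close>

lemma interpolation_in_algebra:
  fixes P :: "(real \<Rightarrow> real) \<Rightarrow> bool"
  assumes const: "\<And>c. P (\<lambda>_. c)" and ident: "P (\<lambda>x. x)"
    and add: "\<And>u v. P u \<Longrightarrow> P v \<Longrightarrow> P (\<lambda>x. u x + v x)"
    and mult: "\<And>u v. P u \<Longrightarrow> P v \<Longrightarrow> P (\<lambda>x. u x * v x)"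
    and C: "finite C"
  shows "\<exists>u. P u \<and> (\<forall>c\<in>C. u c = g c)"
  using C
proof (induction C rule: finite_induct)
  case empty
  then show ?case using const by blast
next
  case (insert c C)
  obtain u where u: "P u" "\<forall>c\<in>C. u c = g c" using insert.IH by blast
  define v where "v x = (\<Prod>d\<in>C. x - d)" for x
  have "P (\<lambda>x. \<Prod>d\<in>C. x - d)"
    using insert.hyps(1)
  proof (induction C rule: finite_induct)
    case (insert d C)
    have "P (\<lambda>x. (x + - d) * (\<Prod>d\<in>C. x - d))" by (intro mult add ident const insert.IH)
    then show ?case using insert.hyps by simp
  qed (simp add: const)
  then have v: "P v" by (simp add: v_def[abs_def])
  have "v c \<noteq> 0" using insert.hyps by (auto simp: v_def)
  moreover have "v d = 0" if "d \<in> C" for d using insert.hyps that by (auto simp: v_def)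
  moreover have "P (\<lambda>x. u x + (g c - u c) / v c * v x)" by (intro mult add const u v)
  ultimately show ?case
    using u(2) by (intro exI[of _ "\<lambda>x. u x + (g c - u c) / v c * v x"]) auto
qed

text \<open>The hypothesis says that the upper right Dini derivatives are nonpositive. The closed set of
  those \<open>t\<close> with \<open>d t \<le> e t\<close> then has no maximum below \<open>1\<close>, for every \<open>e > 0\<close>.\<close>

lemma dini_nonpositive:
  fixes d :: "real \<Rightarrow> real"
  assumes cont: "continuous_on {0..1} d" and d0: "d 0 \<le> 0"
    and dini: "\<And>t e. 0 \<le> t \<Longrightarrow> t < 1 \<Longrightarrow> e > 0 \<Longrightarrow> \<exists>r>0. \<forall>s. 0 < s \<and> s < r \<longrightarrow> d (t + s) \<le> d t + e * s"
  shows "d 1 \<le> 0"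
proof (rule field_le_epsilon)
  fix e :: real assume e: "e > 0"
  define A where "A = {0..1} \<inter> {t. d t - e * t \<le> 0}"
  have "closedin (top_of_set {0..1}) A"
  proof -
    have "continuous_on {0..1} (\<lambda>t. d t - e * t)" by (intro continuous_intros cont)
    from continuous_closedin_preimage[OF this, of "{..0}"] show ?thesis
      by (simp add: A_def vimage_def)
  qed
  then have "compact A" using closedin_compact[of "{0..1::real}" A] by simp
  moreover have "0 \<in> A" using d0 by (simp add: A_def)
  ultimately obtain T where T: "T \<in> A" "\<forall>t\<in>A. t \<le> T" using compact_attains_sup[of A] by auto
  have "T = 1"
  proof (rule ccontr)
    assume "T \<noteq> 1"
    then have T01: "0 \<le> T" "T < 1" using T(1) by (auto simp: A_def)
    obtain r where r: "r > 0" "\<And>s. 0 < s \<and> s < r \<Longrightarrow> d (T + s) \<le> d T + e * s"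
      using dini[OF T01 e] by blast
    define s where "s = min (r / 2) (1 - T)"
    have s: "0 < s" "s < r" "T + s \<le> 1" using r T01 by (auto simp: s_def)
    have "d (T + s) \<le> d T + e * s" using r(2) s by blast
    then have "T + s \<in> A" using T(1) s T01 by (auto simp: A_def algebra_simps)
    then show False using T(2) s by fastforce
  qed
  then show "d 1 \<le> 0 + e" using T(1) by (simp add: A_def)
qed

section \<open>The trace form\<close>

text \<open>Besides being invariant under conjugation by every invertible matrix, this form is definite both
  on selfadjoint and, with the opposite sign, on skew-adjoint matrices. Hence a skew-adjoint
  commutator vanishes as soon as its square has trace \<open>0\<close>; \<open>gradient_commutes\<close> and
  \<open>commutes_at_Ad_max\<close> are obtained in this way.\<close>

definition trace_form :: "('n::finite) cmat \<Rightarrow> 'n cmat \<Rightarrow> real" where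
  "trace_form X Y = Re (trace (X ** Y))"

lemma trace_form_sym: "trace_form X Y = trace_form Y X"
  unfolding trace_form_def by (rule arg_cong[OF trace_mul_sym])

lemma trace_form_add: "trace_form (X + Y) Z = trace_form X Z + trace_form Y Z"
  by (simp add: trace_form_def matrix_add_mult linear_add[OF linear_trace])

lemma trace_form_scale: "trace_form (c *\<^sub>R X) Y = c * trace_form X Y"
  by (simp add: trace_form_def scaleR_matrix_mult linear_scale[OF linear_trace])

lemma trace_form_Ad:
  "invertible g \<Longrightarrow> trace_form (Ad g X) Y = trace_form X (Ad (matrix_inv g) Y)"
  by (simp add: trace_form_def trace_Ad)

lemma trace_form_bracket: "trace_form (lie_bracket X Y) Z = trace_form X (lie_bracket Y Z)"
proof -
  have "trace (Y ** X ** Z) = trace (X ** Z ** Y)"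
    using trace_mul_sym[of Y "X ** Z"] by (simp only: matrix_mul_assoc)
  then show ?thesis
    by (simp only: trace_form_def lie_bracket_def matrix_diff_mult linear_diff[OF linear_trace] matrix_mul_assoc)
qed

context orthonormal_frame
begin

lemma trace_form_selfadjoint_pos:
  assumes "selfadjoint X" "X \<noteq> 0"
  shows "trace_form X X > 0"
proof -
  have "trace_form X X \<ge> 0"
    unfolding trace_form_def trace_square_selfadjoint[OF assms(1)] by (intro sum_nonneg) simp
  moreover have "trace_form X X \<noteq> 0"
    using assms(2) coef_square_sum_0_iff[of X]
    unfolding trace_form_def trace_square_selfadjoint[OF assms(1)] by simp
  ultimately show ?thesis by simp
qed

lemma trace_form_skewadjoint_eq_0:
  assumes "skewadjoint X" "trace_form X X = 0"
  shows "X = 0"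
  using assms(2) coef_square_sum_0_iff[of X]
  unfolding trace_form_def trace_square_skewadjoint[OF assms(1)] by simp

end

section \<open>Maximal Abelian subalgebras and regular elements\<close>

locale maximal_abelian = closed_orbit h G K \<pp> f \<aa> ip \<O>
  for h :: "complex^'n::finite \<Rightarrow> complex^'n \<Rightarrow> complex" and G K \<pp> :: "'n cmat set"
    and f :: "'n \<Rightarrow> complex^'n" and \<aa> :: "'n cmat set" and ip :: "'n cmat \<Rightarrow> 'n cmat \<Rightarrow> real"
    and \<O> :: "(complex^'n) set set" +
  assumes maximal: "maximal_abelian_subalgebra \<aa> \<pp>"
begin

sublocale T: subspace_inner \<pp> trace_form
proof
  show "subspace \<pp>" by (rule p_subspace)
  show "trace_form (x + y) z = trace_form x z + trace_form y z" for x y z :: "'n cmat"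
    by (rule trace_form_add)
  show "trace_form (c *\<^sub>R x) y = c * trace_form x y" for c and x y :: "'n cmat"
    by (rule trace_form_scale)
  show "trace_form x y = trace_form y x" for x y :: "'n cmat" by (rule trace_form_sym)
  show "trace_form x x > 0" if "x \<in> \<pp>" "x \<noteq> 0" for x
    using that by (intro trace_form_selfadjoint_pos p_selfadjoint)
qed

text \<open>Regular elements separate the weights. Equality of weights as functions on \<open>\<aa>\<close> is expressed by
  equality of the weight points, since distinct indices may carry the same weight.\<close>

definition regular :: "'n cmat \<Rightarrow> bool" where
  "regular \<beta> \<longleftrightarrow> \<beta> \<in> \<aa> \<and> (\<forall>i j. weight i \<beta> = weight j \<beta> \<longrightarrow> weight_point i = weight_point j)"

text \<open>Then the \<open>i\<close>-th weight is a vertex of the weight polytope, where \<open>\<beta>\<close> attains its strict maximum.\<close>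

definition exposed :: "'n cmat \<Rightarrow> 'n \<Rightarrow> bool" where
  "exposed \<beta> i \<longleftrightarrow> regular \<beta> \<and> (\<forall>j. weight j \<beta> \<le> weight i \<beta>)"

definition has_weight :: "'n \<Rightarrow> complex^'n \<Rightarrow> bool" where
  "has_weight i v \<longleftrightarrow> v \<noteq> 0 \<and> (\<forall>Z\<in>\<aa>. Z *v v = complex_of_real (weight i Z) *s v)"

lemma weight_eq: "weight_point i = weight_point j \<Longrightarrow> Z \<in> \<aa> \<Longrightarrow> weight i Z = weight j Z"
  using weight_point(2) by metis

lemma regular_mem: "regular \<beta> \<Longrightarrow> \<beta> \<in> \<aa>"
  unfolding regular_def by (rule conjunct1)

lemma regular_weight_eq:
  assumes "regular \<beta>" "weight i \<beta> = weight j \<beta>" "Z \<in> \<aa>"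
  shows "weight i Z = weight j Z"
proof -
  have "weight_point i = weight_point j" using assms(1,2) unfolding regular_def by blast
  then show ?thesis using assms(3) by (rule weight_eq)
qed

lemma coef_a_left: "Y \<in> \<aa> \<Longrightarrow> coef (Y ** Z) i j = complex_of_real (weight i Y) * coef Z i j"
  by (simp add: coef_def coordinate_weight flip: matrix_vector_mul_assoc)

lemma coef_a_right: "Y \<in> \<aa> \<Longrightarrow> coef (Z ** Y) i j = complex_of_real (weight j Y) * coef Z i j"
  by (simp add: coef_def weight_vector vector_scalar_commute scale_left flip: matrix_vector_mul_assoc)

text \<open>A regular element separates the weights, so what commutes with it preserves all weight spaces
  and hence commutes with \<open>\<aa>\<close>.\<close>

lemma regular_centralizer:
  assumes \<beta>: "regular \<beta>" and Z: "Z \<in> \<pp>" and comm: "Z ** \<beta> = \<beta> ** Z"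
  shows "Z \<in> \<aa>"
proof -
  have \<beta>a: "\<beta> \<in> \<aa>" using \<beta> by (rule regular_mem)
  have YZ: "Y ** Z = Z ** Y" if Y: "Y \<in> \<aa>" for Y
  proof (rule coef_eqI)
    fix i j
    have "complex_of_real (weight j \<beta>) * coef Z i j = complex_of_real (weight i \<beta>) * coef Z i j"
      using arg_cong[OF comm, of "\<lambda>X. coef X i j"] by (simp add: coef_a_left[OF \<beta>a] coef_a_right[OF \<beta>a])
    then have "coef Z i j = 0 \<or> weight i \<beta> = weight j \<beta>" by auto
    then have "coef Z i j = 0 \<or> weight i Y = weight j Y"
      using regular_weight_eq[OF \<beta> _ Y] by blast
    then show "coef (Y ** Z) i j = coef (Z ** Y) i j"
      by (auto simp: coef_a_left[OF Y] coef_a_right[OF Y])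
  qed
  define a' where "a' = {Y + c *\<^sub>R Z |Y c. Y \<in> \<aa>}"
  have a'I: "Y + c *\<^sub>R Z \<in> a'" if "Y \<in> \<aa>" for Y c using that by (auto simp: a'_def)
  have "subspace a'"
  proof (rule subspaceI)
    show "0 \<in> a'" using a'I[OF A.zero_mem, of 0] by simp
    fix x assume "x \<in> a'"
    then obtain Y c where x: "x = Y + c *\<^sub>R Z" "Y \<in> \<aa>" by (auto simp: a'_def)
    show "r *\<^sub>R x \<in> a'" for r
      using a'I[OF subspace_scale[OF a_subspace x(2)], of r "r * c"] by (simp add: x algebra_simps)
    fix x' assume "x' \<in> a'"
    then obtain Y' c' where x': "x' = Y' + c' *\<^sub>R Z" "Y' \<in> \<aa>" by (auto simp: a'_def)
    show "x + x' \<in> a'"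
      using a'I[OF subspace_add[OF a_subspace x(2) x'(2)], of "c + c'"] by (simp add: x x' algebra_simps)
  qed
  moreover have "a' \<subseteq> \<pp>"
    using a_subset_p Z subspace_add[OF p_subspace] subspace_scale[OF p_subspace] by (auto simp: a'_def)
  moreover have "lie_bracket X X' = 0" if X: "X \<in> a'" and X': "X' \<in> a'" for X X'
  proof -
    obtain Y c where 1: "X = Y + c *\<^sub>R Z" "Y \<in> \<aa>" using X by (auto simp: a'_def)
    obtain Y' c' where 2: "X' = Y' + c' *\<^sub>R Z" "Y' \<in> \<aa>" using X' by (auto simp: a'_def)
    show ?thesis
      unfolding 1(1) 2(1) lie_bracket_def matrix_add_mult scaleR_matrix_mult
        a_commute[OF 1(2) 2(2)] YZ[OF 1(2)] YZ[OF 2(2)]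
      by (simp add: algebra_simps)
  qed
  ultimately have "abelian_subalgebra a' \<pp>" by (simp add: abelian_subalgebra_def)
  moreover have "\<aa> \<subseteq> a'"
  proof
    show "Y \<in> a'" if "Y \<in> \<aa>" for Y using a'I[OF that, of 0] by simp
  qed
  ultimately have "a' = \<aa>" using maximal by (simp add: maximal_abelian_subalgebra_def)
  then show ?thesis using a'I[OF A.zero_mem, of 1] by simp
qed

text \<open>The vector is \<open>lim exp(t \<beta>) v\<close>, rescaled, for \<open>v\<close> with no vanishing coordinate.\<close>

lemma exposed_weight_in_orbit:
  assumes "exposed \<beta> i"
  shows "\<exists>w. has_weight i w \<and> proj w \<in> \<O>"
proof -
  have reg: "regular \<beta>" and top: "\<And>j. weight j \<beta> \<le> weight i \<beta>"
    using assms by (simp_all only: exposed_def)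
  have \<beta>: "\<beta> \<in> \<aa>" using reg by (rule regular_mem)
  obtain v where v: "v \<noteq> 0" "proj v \<in> \<O>" "\<forall>i. h v (f i) \<noteq> 0" by (rule orbit_generic_vector)
  define w where "w = (\<Sum>j\<in>UNIV. (if weight j \<beta> = weight i \<beta> then h v (f j) else 0) *s f j)"
  define u where "u n = complex_of_real (exp (- real n * weight i \<beta>)) *s (mexp (real n *\<^sub>R \<beta>) *v v)" for n
  have coord: "h w (f j) = (if weight j \<beta> = weight i \<beta> then h v (f j) else 0)" for j
    by (simp add: w_def coordinate_of_sum)
  have "h w (f i) \<noteq> 0" using v by (simp add: coord)
  then have w0: "w \<noteq> 0" by auto
  have n\<beta>: "real n *\<^sub>R \<beta> \<in> \<aa>" for n using \<beta> subspace_scale[OF a_subspace] by blast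
  have gG: "mexp (real n *\<^sub>R \<beta>) \<in> G" for n using n\<beta> a_subset_p mexp_p by blast
  have u: "u n = (\<Sum>j\<in>UNIV. (complex_of_real (exp (weight j \<beta> - weight i \<beta>) ^ n) * h v (f j)) *s f j)" for n
  proof (rule vector_eqI)
    fix j
    have "exp (- real n * weight i \<beta>) * exp (real n * weight j \<beta>) = exp (weight j \<beta> - weight i \<beta>) ^ n"
      unfolding exp_of_nat_mult[symmetric] exp_add[symmetric] by (simp only: right_diff_distrib) simp
    then show "h (u n) (f j) = h (\<Sum>j\<in>UNIV. (complex_of_real (exp (weight j \<beta> - weight i \<beta>) ^ n) * h v (f j)) *s f j) (f j)"
      unfolding coordinate_of_sum u_def scale_left mexp_coordinate[OF n\<beta>] weight_scale
      by (simp only: mult.assoc[symmetric] of_real_mult[symmetric])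
  qed
  have coord_lim: "(\<lambda>n. complex_of_real (exp (weight j \<beta> - weight i \<beta>) ^ n) * h v (f j))
      \<longlonglongrightarrow> (if weight j \<beta> = weight i \<beta> then h v (f j) else 0)" for j
  proof (cases "weight j \<beta> = weight i \<beta>")
    case False
    then have "exp (weight j \<beta> - weight i \<beta>) < 1" using top[of j] by simp
    then have "(\<lambda>n. exp (weight j \<beta> - weight i \<beta>) ^ n) \<longlonglongrightarrow> 0" by (intro LIMSEQ_power_zero) simp
    then have "(\<lambda>n. complex_of_real (exp (weight j \<beta> - weight i \<beta>) ^ n) * h v (f j)) \<longlonglongrightarrow> complex_of_real 0 * h v (f j)"
      by (intro tendsto_mult tendsto_of_real tendsto_const)
    then show ?thesis using False by simp
  qed simp
  have lim: "u \<longlonglongrightarrow> w"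
    unfolding w_def
    by (subst u[abs_def], rule tendsto_sum)
      (rule bounded_linear.tendsto[OF bounded_linear_vector_scalar coord_lim])
  have s0: "complex_of_real (exp (- real n * weight i \<beta>)) \<noteq> 0" for n by simp
  have "proj w \<in> \<O>"
  proof (rule closed_in_PV_limit[OF orbit_closed _ _ lim w0])
    show "u n \<noteq> 0" for n
      unfolding u_def using s0 invertible_vector_nonzero[OF G_invertible[OF gG] v(1)] by simp
    show "proj (u n) \<in> \<O>" for n
      unfolding u_def proj_scale[OF s0] by (rule orbit_invariant[OF v(2,1) gG])
  qed
  moreover have "\<forall>Z\<in>\<aa>. Z *v w = complex_of_real (weight i Z) *s w"
  proof
    fix Z assume Z: "Z \<in> \<aa>"
    show "Z *v w = complex_of_real (weight i Z) *s w"
    proof (rule vector_eqI)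
      fix j
      show "h (Z *v w) (f j) = h (complex_of_real (weight i Z) *s w) (f j)"
        unfolding coordinate_weight[OF Z] scale_left coord
        using regular_weight_eq[OF reg _ Z, of j i] by simp
    qed
  qed
  ultimately show ?thesis using w0 unfolding has_weight_def by blast
qed

text \<open>The gradient is taken with respect to the trace form here. With \<open>X = [M, \<beta>]\<close>, which is skew,
  the derivative of the Rayleigh quotient in the direction \<open>[X, \<beta>]\<close> vanishes at an eigenvector of
  \<open>\<beta>\<close>, and by invariance of the trace form it equals \<open>- tr X\<^sup>2\<close>.\<close>

lemma gradient_commutes:
  assumes M: "M \<in> \<pp>" "\<And>Z. Z \<in> \<pp> \<Longrightarrow> trace_form M Z = rayleigh w Z"
    and \<beta>: "\<beta> \<in> \<pp>" "\<beta> *v w = complex_of_real b *s w"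
  shows "M ** \<beta> = \<beta> ** M"
proof -
  define X where "X = lie_bracket M \<beta>"
  have X: "X \<in> lie_algebra K" unfolding X_def by (rule p_bracket_p[OF M(1) \<beta>(1)])
  have "h (lie_bracket X \<beta> *v w) w = 0"
    using p_selfadjoint[OF \<beta>(1)]
    by (simp add: lie_bracket_def matrix_vector_mult_diff_rdistrib diff_left selfadjoint_def \<beta>(2)
        vector_scalar_commute scale_left scale_right flip: matrix_vector_mul_assoc)
  then have "trace_form M (lie_bracket X \<beta>) = 0"
    using M(2)[OF k_bracket_p[OF X \<beta>(1)]] by (simp add: rayleigh_def)
  moreover have "lie_bracket X \<beta> = - lie_bracket \<beta> X" by (simp add: lie_bracket_def)
  ultimately have "trace_form M (lie_bracket \<beta> X) = 0"
    using trace_form_scale[of "-1" "lie_bracket \<beta> X" M] by (simp add: trace_form_sym[of M])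
  then have "trace_form X X = 0" unfolding X_def trace_form_bracket .
  then have "X = 0"
    using trace_form_skewadjoint_eq_0 selfadjoint_commutator_skew M(1) \<beta>(1) p_selfadjoint X_def by blast
  then show ?thesis by (simp add: X_def lie_bracket_def)
qed

end

section \<open>The closed orbit is an orbit of the compact group\<close>

context maximal_abelian
begin

text \<open>The functions \<open>u\<close> for which \<open>u((ad \<beta>)\<^sup>2)\<close> preserves \<open>\<pp>\<close> form an algebra containing the
  polynomials, and a polynomial takes arbitrary values on a finite set.\<close>

lemma ad_square_interpolation:
  assumes \<beta>: "\<beta> \<in> \<aa>" and C: "finite C"
  shows "\<exists>u. (\<forall>Z\<in>\<pp>. \<exists>Z'\<in>\<pp>. \<forall>i j. coef Z' i j = complex_of_real (u ((weight i \<beta> - weight j \<beta>)\<^sup>2)) * coef Z i j)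
    \<and> (\<forall>c\<in>C. u c = g c)"
proof (rule interpolation_in_algebra[OF _ _ _ _ C])
  let ?P = "\<lambda>u. \<forall>Z\<in>\<pp>. \<exists>Z'\<in>\<pp>. \<forall>i j. coef Z' i j = complex_of_real (u ((weight i \<beta> - weight j \<beta>)\<^sup>2)) * coef Z i j"
  show "?P (\<lambda>_. c)" for c
  proof
    fix Z assume "Z \<in> \<pp>"
    then show "\<exists>Z'\<in>\<pp>. \<forall>i j. coef Z' i j = complex_of_real c * coef Z i j"
      by (intro bexI[of _ "c *\<^sub>R Z"]) (simp_all add: coef_scaleR subspace_scale[OF p_subspace])
  qed
  show "?P (\<lambda>x. x)"
  proof
    fix Z assume Z: "Z \<in> \<pp>"
    have \<beta>p: "\<beta> \<in> \<pp>" using \<beta> by (rule a_subset_p)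
    have "lie_bracket (lie_bracket Z \<beta>) \<beta> \<in> \<pp>"
      by (intro k_bracket_p p_bracket_p Z \<beta>p)
    moreover have "coef (lie_bracket (lie_bracket Z \<beta>) \<beta>) i j
        = complex_of_real ((weight i \<beta> - weight j \<beta>)\<^sup>2) * coef Z i j" for i j
      unfolding lie_bracket_def coef_diff coef_a_left[OF \<beta>] coef_a_right[OF \<beta>]
      by (simp add: power2_eq_square algebra_simps)
    ultimately show "\<exists>Z'\<in>\<pp>. \<forall>i j. coef Z' i j = complex_of_real ((weight i \<beta> - weight j \<beta>)\<^sup>2) * coef Z i j"
      by (intro bexI[of _ "lie_bracket (lie_bracket Z \<beta>) \<beta>"] allI)
  qed
  fix u v assume u: "?P u" and v: "?P v"
  show "?P (\<lambda>x. u x + v x)"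
  proof
    fix Z assume Z: "Z \<in> \<pp>"
    obtain Z1 where 1: "Z1 \<in> \<pp>" "\<forall>i j. coef Z1 i j = complex_of_real (u ((weight i \<beta> - weight j \<beta>)\<^sup>2)) * coef Z i j"
      using bspec[OF u Z] by (elim bexE)
    obtain Z2 where 2: "Z2 \<in> \<pp>" "\<forall>i j. coef Z2 i j = complex_of_real (v ((weight i \<beta> - weight j \<beta>)\<^sup>2)) * coef Z i j"
      using bspec[OF v Z] by (elim bexE)
    show "\<exists>Z'\<in>\<pp>. \<forall>i j. coef Z' i j = complex_of_real (u ((weight i \<beta> - weight j \<beta>)\<^sup>2) + v ((weight i \<beta> - weight j \<beta>)\<^sup>2)) * coef Z i j"
      using 1 2 by (intro bexI[of _ "Z1 + Z2"]) (simp_all add: coef_add distrib_right subspace_add[OF p_subspace])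
  qed
  show "?P (\<lambda>x. u x * v x)"
  proof
    fix Z assume Z: "Z \<in> \<pp>"
    obtain Z1 where 1: "Z1 \<in> \<pp>" "\<forall>i j. coef Z1 i j = complex_of_real (v ((weight i \<beta> - weight j \<beta>)\<^sup>2)) * coef Z i j"
      using bspec[OF v Z] by (elim bexE)
    obtain Z2 where 2: "Z2 \<in> \<pp>" "\<forall>i j. coef Z2 i j = complex_of_real (u ((weight i \<beta> - weight j \<beta>)\<^sup>2)) * coef Z1 i j"
      using bspec[OF u 1(1)] by (elim bexE)
    show "\<exists>Z'\<in>\<pp>. \<forall>i j. coef Z' i j = complex_of_real (u ((weight i \<beta> - weight j \<beta>)\<^sup>2) * v ((weight i \<beta> - weight j \<beta>)\<^sup>2)) * coef Z i j"
      using 1 2 by (intro bexI[of _ Z2]) simp_all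
  qed
qed

text \<open>The tangent vectors \<open>\<pp> v\<close> to the orbit of \<open>G\<close> at an exposed weight vector are tangent to the
  orbit of \<open>K\<close>, up to real multiples of \<open>v\<close>. Let \<open>sgn(ad \<beta>)\<close> multiply the matrix coefficients by the
  signs of the differences of the eigenvalues of \<open>\<beta>\<close>; it is an odd polynomial in \<open>ad \<beta>\<close>, so it maps
  \<open>\<pp>\<close> to the Lie algebra of \<open>K\<close>. As \<open>v\<close> lies in the top eigenspace of \<open>\<beta>\<close>, the element
  \<open>Z + sgn(ad \<beta>) Z\<close> acts on \<open>v\<close> as the component of \<open>Z\<close> commuting with \<open>\<beta>\<close>, which is in \<open>\<aa>\<close>.\<close>

lemma p_tangent_to_K_orbit:
  assumes ex: "exposed \<beta> i" and v: "has_weight i v" and Z: "Z \<in> \<pp>"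
  obtains Y c where "Y \<in> lie_algebra K" "skewadjoint Y" "Z *v v = Y *v v + complex_of_real c *s v"
proof -
  have reg: "regular \<beta>" and top: "\<And>j. weight j \<beta> \<le> weight i \<beta>"
    using ex by (simp_all only: exposed_def)
  have \<beta>: "\<beta> \<in> \<aa>" using reg by (rule regular_mem)
  define C where "C = range (\<lambda>(k, j). (weight k \<beta> - weight j \<beta>)\<^sup>2)"
  have finC: "finite C" by (simp add: C_def)
  have memC: "(weight k \<beta> - weight j \<beta>)\<^sup>2 \<in> C" for k j
    unfolding C_def by (rule range_eqI[of _ _ "(k, j)"]) simp
  obtain u1 where u1: "\<forall>Z\<in>\<pp>. \<exists>Z'\<in>\<pp>. \<forall>k j. coef Z' k j = complex_of_real (u1 ((weight k \<beta> - weight j \<beta>)\<^sup>2)) * coef Z k j"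
      and u1C: "\<forall>c\<in>C. u1 c = (if c = 0 then 0 else 1 / sqrt c)"
    using ad_square_interpolation[OF \<beta> finC, of "\<lambda>c. if c = 0 then 0 else 1 / sqrt c"] by (elim exE conjE)
  obtain u0 where u0: "\<forall>Z\<in>\<pp>. \<exists>Z'\<in>\<pp>. \<forall>k j. coef Z' k j = complex_of_real (u0 ((weight k \<beta> - weight j \<beta>)\<^sup>2)) * coef Z k j"
      and u0C: "\<forall>c\<in>C. u0 c = (if c = 0 then 1 else 0)"
    using ad_square_interpolation[OF \<beta> finC, of "\<lambda>c. if c = 0 then 1 else 0"] by (elim exE conjE)
  obtain Z1 where Z1: "Z1 \<in> \<pp>" "\<forall>k j. coef Z1 k j = complex_of_real (u1 ((weight k \<beta> - weight j \<beta>)\<^sup>2)) * coef Z k j"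
    using bspec[OF u1 Z] by (elim bexE)
  obtain Z0 where Z0: "Z0 \<in> \<pp>" "\<forall>k j. coef Z0 k j = complex_of_real (u0 ((weight k \<beta> - weight j \<beta>)\<^sup>2)) * coef Z k j"
    using bspec[OF u0 Z] by (elim bexE)
  have coef0: "coef Z0 k j = (if weight k \<beta> = weight j \<beta> then coef Z k j else 0)" for k j
    using Z0(2) bspec[OF u0C memC, of k j] by simp
  have "Z0 ** \<beta> = \<beta> ** Z0"
    by (rule coef_eqI) (simp add: coef_a_left[OF \<beta>] coef_a_right[OF \<beta>] coef0)
  then have Z0a: "Z0 \<in> \<aa>" by (rule regular_centralizer[OF reg Z0(1)])
  \<comment> \<open>this is \<open>- sgn(ad \<beta>) Z\<close>\<close>
  define Y where "Y = lie_bracket Z1 \<beta>"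
  have \<beta>p: "\<beta> \<in> \<pp>" using \<beta> by (rule a_subset_p)
  have YK: "Y \<in> lie_algebra K" unfolding Y_def by (rule p_bracket_p[OF Z1(1) \<beta>p])
  have Yskew: "skewadjoint Y"
    unfolding Y_def by (intro selfadjoint_commutator_skew p_selfadjoint Z1(1) \<beta>p)
  have coefY: "coef Y k j = complex_of_real (weight j \<beta> - weight k \<beta>) * coef Z1 k j" for k j
    unfolding Y_def lie_bracket_def coef_diff coef_a_left[OF \<beta>] coef_a_right[OF \<beta>]
    by (simp add: left_diff_distrib)
  have support: "h v (f j) = 0 \<or> weight j \<beta> = weight i \<beta>" for j
  proof -
    have "\<beta> *v v = complex_of_real (weight i \<beta>) *s v" using v \<beta> by (simp add: has_weight_def)
    then have "complex_of_real (weight j \<beta>) * h v (f j) = complex_of_real (weight i \<beta>) * h v (f j)"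
      using arg_cong[where f="\<lambda>u. h u (f j)"] coordinate_weight[OF \<beta>, of v j] by (metis scale_left)
    then show ?thesis unfolding mult_cancel_right of_real_eq_iff by blast
  qed
  have term_eq: "coef Z k j * h v (f j) = (coef Y k j + coef Z0 k j) * h v (f j)" for k j
  proof (cases "h v (f j) = 0")
    case False
    then have le: "weight k \<beta> \<le> weight j \<beta>" using support[of j] top[of k] by simp
    have "coef Z k j = coef Y k j + coef Z0 k j"
    proof (cases "weight k \<beta> = weight j \<beta>")
      case True
      then show ?thesis by (simp add: coef0 coefY)
    next
      case ne: False
      have "u1 ((weight k \<beta> - weight j \<beta>)\<^sup>2) = 1 / sqrt ((weight k \<beta> - weight j \<beta>)\<^sup>2)"
        using bspec[OF u1C memC, of k j] ne by simp
      also have "\<dots> = 1 / (weight j \<beta> - weight k \<beta>)" using le by (simp add: real_sqrt_abs)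
      finally have "(weight j \<beta> - weight k \<beta>) * u1 ((weight k \<beta> - weight j \<beta>)\<^sup>2) = 1" using ne by simp
      then have "complex_of_real (weight j \<beta> - weight k \<beta>) * complex_of_real (u1 ((weight k \<beta> - weight j \<beta>)\<^sup>2)) = 1"
        unfolding of_real_mult[symmetric] by simp
      then have "coef Y k j = coef Z k j" by (simp add: coefY Z1(2) mult.assoc[symmetric])
      then show ?thesis using ne by (simp add: coef0)
    qed
    then show ?thesis by simp
  qed simp
  have "Z *v v = Y *v v + Z0 *v v"
  proof (rule vector_eqI)
    fix k
    have "h (Z *v v) (f k) = (\<Sum>j\<in>UNIV. (coef Y k j + coef Z0 k j) * h v (f j))"
      unfolding coordinate_apply term_eq ..
    then show "h (Z *v v) (f k) = h (Y *v v + Z0 *v v) (f k)"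
      by (simp add: add_left coordinate_apply distrib_right sum.distrib)
  qed
  moreover have "Z0 *v v = complex_of_real (weight i Z0) *s v" using v Z0a by (simp add: has_weight_def)
  ultimately show ?thesis using that[OF YK Yskew, of "weight i Z0"] by simp
qed

text \<open>By the previous lemma the compact set \<open>S\<close> of multiples, by factors in \<open>[0,1]\<close>, of vectors in
  \<open>K v\<close> is invariant to first order under the flow of \<open>X - \<Lambda>\<close>, where \<open>\<Lambda>\<close> bounds the spectrum of \<open>X\<close>. As
  this flow is contracting, the distance from the trajectory of \<open>v\<close> to \<open>S\<close> has nonpositive Dini
  derivatives, so the trajectory stays in \<open>S\<close>.\<close>

lemma mexp_p_in_K_orbit_cone:
  assumes ex: "exposed \<beta> i" and v: "has_weight i v" and X: "X \<in> \<pp>"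
  shows "\<exists>r k. k \<in> K \<and> mexp X *v v = complex_of_real r *s (k *v v)"
proof -
  obtain f' and c :: "'n \<Rightarrow> real" where f': "orthonormal_frame h f'"
      and c: "\<forall>j. X *v f' j = complex_of_real (c j) *s f' j"
    using p_selfadjoint[OF X] by (rule selfadjoint_eigenframe)
  interpret F: orthonormal_frame h f' by (rule f')
  define \<Lambda> where "\<Lambda> = Max (range c)"
  have \<Lambda>: "c j \<le> \<Lambda>" for j by (simp add: \<Lambda>_def)
  define X' where "X' = X - mat (complex_of_real \<Lambda>)"
  have X'f: "X' *v f' j = complex_of_real (c j - \<Lambda>) *s f' j" for j
    using c by (simp add: X'_def matrix_vector_mult_diff_rdistrib mat_vector_mult vector_ssub_ldistrib)
  have X'd: "unitarily_diagonalizable X'"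
    unfolding unitarily_diagonalizable_def
    by (intro exI[of _ f'] exI[of _ "\<lambda>j. complex_of_real (c j - \<Lambda>)"] conjI allI f' X'f)
  have flow: "h (mexp (t *\<^sub>R X') *v u) (f' j) = complex_of_real (exp (t * (c j - \<Lambda>))) * h u (f' j)" for t u j
  proof -
    have "exp (complex_of_real t * complex_of_real (c j - \<Lambda>)) = complex_of_real (exp (t * (c j - \<Lambda>)))"
      by (simp only: of_real_mult[symmetric] exp_of_real)
    then show ?thesis unfolding F.mexp_diagonal_scaled[OF X'f] F.diag_coordinate by simp
  qed
  \<comment> \<open>an isometry from \<open>h\<close> to the standard norm, in which distances to sets are measured\<close>
  define \<Phi> :: "complex^'n \<Rightarrow> complex^'n" where "\<Phi> u = (\<chi> j. h u (f j))" for u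
  have \<Phi>_norm: "norm (\<Phi> u) = sqrt (Re (h u u))" for u
    by (simp add: \<Phi>_def norm_vec_def L2_set_def parseval_norm)
  have \<Phi>_diff: "\<Phi> (u - w) = \<Phi> u - \<Phi> w" for u w by (simp add: \<Phi>_def vec_eq_iff diff_left)
  have \<Phi>_add: "\<Phi> (u + w) = \<Phi> u + \<Phi> w" for u w by (simp add: \<Phi>_def vec_eq_iff add_left)
  have "linear \<Phi>"
    by (rule linearI) (simp_all add: \<Phi>_add, simp add: \<Phi>_def vec_eq_iff scaleR_eq_vector_scalar scale_left scaleR_conv_of_real[where 'a=complex])
  then have \<Phi>_bl: "bounded_linear \<Phi>" using linear_conv_bounded_linear by blast
  have contraction: "norm (\<Phi> (mexp (t *\<^sub>R X') *v u)) \<le> norm (\<Phi> u)" if t: "t \<ge> 0" for t u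
  proof -
    have "cmod (h (mexp (t *\<^sub>R X') *v u) (f' j)) \<le> cmod (h u (f' j))" for j
    proof -
      have "exp (t * (c j - \<Lambda>)) \<le> 1" using t \<Lambda>[of j] by (simp add: mult_nonneg_nonpos)
      then show ?thesis unfolding flow norm_mult by (simp add: mult_left_le_one_le)
    qed
    then show ?thesis
      unfolding \<Phi>_norm F.parseval_norm by (intro real_sqrt_le_mono sum_mono power_mono) auto
  qed
  have rayleigh_bound: "Re (h (X *v u) u) \<le> \<Lambda> * Re (h u u)" for u
  proof -
    have "h (X *v u) (f' j) = complex_of_real (c j) * h u (f' j)" for j
      using p_selfadjoint[OF X] c by (simp add: selfadjoint_def scale_right)
    then have "h (X *v u) u = (\<Sum>j\<in>UNIV. complex_of_real (c j) * (h u (f' j) * cnj (h u (f' j))))"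
      by (subst F.parseval) (simp add: mult.assoc)
    also have "Re \<dots> = (\<Sum>j\<in>UNIV. c j * (cmod (h u (f' j)))\<^sup>2)"
      by (simp flip: complex_norm_square)
    also have "\<dots> \<le> (\<Sum>j\<in>UNIV. \<Lambda> * (cmod (h u (f' j)))\<^sup>2)"
      by (intro sum_mono mult_right_mono \<Lambda>) simp
    finally show ?thesis by (simp add: F.parseval_norm sum_distrib_left)
  qed
  have v0: "v \<noteq> 0" using v by (simp add: has_weight_def)
  define S where "S = (\<lambda>x. fst x *\<^sub>R (snd x *v v)) ` ({0..1::real} \<times> K)"
  have SI: "r *\<^sub>R (k *v v) \<in> S" if "0 \<le> r" "r \<le> 1" "k \<in> K" for r k
    unfolding S_def by (rule image_eqI[of _ _ "(r, k)"]) (use that in simp_all)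
  have "compact S"
    unfolding S_def
    by (intro compact_continuous_image compact_Times compact_K compact_Icc continuous_on_scaleR
        continuous_matrix_vector_mult continuous_on_fst continuous_on_snd continuous_on_id continuous_on_const)
  then have "compact (\<Phi> ` S)"
    by (intro compact_continuous_image linear_continuous_on \<Phi>_bl)
  then have closed: "closed (\<Phi> ` S)" by (rule compact_imp_closed)
  have vS: "v \<in> S" using SI[of 1 "mat 1"] K_one by simp
  then have ne: "\<Phi> ` S \<noteq> {}" by blast
  define d where "d t = infdist (\<Phi> (mexp (t *\<^sub>R X') *v v)) (\<Phi> ` S)" for t
  have "d 1 \<le> 0"
  proof (rule dini_nonpositive)
    show "continuous_on {0..1} d"
      unfolding d_def
      by (intro continuous_on_infdist bounded_linear.continuous_on[OF \<Phi>_bl] continuous_matrix_vector_mult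
          continuous_on_const continuous_on_subset[OF continuous_mexp[OF X'd]]) simp
    show "d 0 \<le> 0"
      unfolding d_def using vS by (simp add: mexp_0)
    fix t e :: real assume t: "0 \<le> t" "t < 1" and e: "e > 0"
    obtain y where y: "y \<in> \<Phi> ` S" "d t = dist (\<Phi> (mexp (t *\<^sub>R X') *v v)) y"
      unfolding d_def by (rule infdist_attains_inf[OF closed ne])
    then obtain r k where rk: "0 \<le> r" "r \<le> 1" "k \<in> K" and y_eq: "y = \<Phi> (r *\<^sub>R (k *v v))"
      by (auto simp: S_def)
    define s where "s = r *\<^sub>R (k *v v)"
    have dt: "d t = norm (\<Phi> (mexp (t *\<^sub>R X') *v v - s))"
      using y(2) by (simp add: y_eq s_def dist_norm \<Phi>_diff)
    have kinv: "invertible k" using K_invertible rk by blast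
    have AdX: "Ad (matrix_inv k) X \<in> \<pp>" using Ad_p K_inv rk X by blast
    obtain Y c0 where Y: "Y \<in> lie_algebra K" "skewadjoint Y"
        and tangent: "Ad (matrix_inv k) X *v v = Y *v v + complex_of_real c0 *s v"
      by (rule p_tangent_to_K_orbit[OF ex v AdX])
    have Xk: "X *v (k *v v) = k *v (Y *v v) + c0 *\<^sub>R (k *v v)"
    proof -
      have "X *v (k *v v) = k *v (Ad (matrix_inv k) X *v v)"
        using Ad_intertwines[OF kinv, of "Ad (matrix_inv k) X" v] by (simp add: Ad_matrix_inv[OF kinv])
      then show ?thesis
        by (simp add: tangent matrix_vector_right_distrib vector_scalar_commute scaleR_eq_vector_scalar)
    qed
    have c0: "c0 \<le> \<Lambda>"
    proof -
      have "h (Y *v v) v = - cnj (h (Y *v v) v)"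
        using Y(2) conj_swap[of v "Y *v v"] unfolding skewadjoint_def by metis
      then have "Re (h (Y *v v) v) = 0" by (simp add: complex_eq_iff)
      then have "Re (h (X *v (k *v v)) (k *v v)) = c0 * Re (h v v)"
        unfolding Xk add_left scaleR_eq_vector_scalar scale_left K_unitary[OF rk(3)] by simp
      moreover have "Re (h (X *v (k *v v)) (k *v v)) \<le> \<Lambda> * Re (h v v)"
        using rayleigh_bound[of "k *v v"] K_unitary[OF rk(3)] by simp
      ultimately have "c0 * Re (h v v) \<le> \<Lambda> * Re (h v v)" by simp
      then show ?thesis using positive[OF v0] by simp
    qed
    \<comment> \<open>a curve in \<open>S\<close> through \<open>s\<close> with the same velocity as the flow of \<open>X'\<close>\<close>
    define s' where "s' q = (exp (q * (c0 - \<Lambda>)) * r) *\<^sub>R (k *v (mexp (q *\<^sub>R Y) *v v))" for q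
    define D where "D q = mexp (q *\<^sub>R X') *v s - s' q" for q
    have s'S: "s' q \<in> S" if q: "q > 0" for q
    proof -
      have "exp (q * (c0 - \<Lambda>)) \<le> 1" using q c0 by (simp add: mult_nonneg_nonpos)
      then have "exp (q * (c0 - \<Lambda>)) * r \<le> 1" using rk by (simp add: mult_le_one)
      then show ?thesis
        using SI[of "exp (q * (c0 - \<Lambda>)) * r" "k ** mexp (q *\<^sub>R Y)"] rk K_mult[OF rk(3) mexp_k[OF Y(1)]]
        by (simp add: s'_def matrix_vector_mul_assoc)
    qed
    have "(D has_vector_derivative (X' *v s - (r *\<^sub>R (k *v (Y *v v)) + ((c0 - \<Lambda>) * r) *\<^sub>R (k *v v)))) (at 0)"
    proof -
      have 1: "((\<lambda>q. mexp (q *\<^sub>R X') *v s) has_vector_derivative X' *v s) (at 0)"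
        by (rule bounded_linear.has_vector_derivative[OF
              bounded_bilinear.bounded_linear_left[OF bounded_bilinear_matrix_vector_mult] mexp_derivative[OF X'd]])
      have 2: "((\<lambda>q. mexp (q *\<^sub>R Y) *v v) has_vector_derivative Y *v v) (at 0)"
        by (rule bounded_linear.has_vector_derivative[OF
              bounded_bilinear.bounded_linear_left[OF bounded_bilinear_matrix_vector_mult]
              mexp_derivative[OF skewadjoint_diagonalizable[OF Y(2)]]])
      have 3: "((\<lambda>q. k *v (mexp (q *\<^sub>R Y) *v v)) has_vector_derivative k *v (Y *v v)) (at 0)"
        by (rule bounded_linear.has_vector_derivative[OF
              bounded_bilinear.bounded_linear_right[OF bounded_bilinear_matrix_vector_mult] 2])
      have 4: "((\<lambda>q. exp (q * (c0 - \<Lambda>)) * r) has_field_derivative (c0 - \<Lambda>) * r) (at 0)"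
        by (auto intro!: derivative_eq_intros)
      have "(s' has_vector_derivative (r *\<^sub>R (k *v (Y *v v)) + ((c0 - \<Lambda>) * r) *\<^sub>R (k *v v))) (at 0)"
        using has_vector_derivative_scaleR[OF 4 3] unfolding s'_def[abs_def] by (simp add: mexp_0)
      from has_vector_derivative_diff[OF 1 this] show ?thesis unfolding D_def[abs_def] .
    qed
    moreover have "X' *v s = r *\<^sub>R (k *v (Y *v v)) + ((c0 - \<Lambda>) * r) *\<^sub>R (k *v v)"
    proof -
      have "X' *v s = r *\<^sub>R (X *v (k *v v)) - \<Lambda> *\<^sub>R (r *\<^sub>R (k *v v))"
        by (simp add: X'_def s_def matrix_vector_mult_diff_rdistrib mat_vector_mult scaleR_eq_vector_scalar
            vector_scalar_commute)
      then show ?thesis unfolding Xk by (simp add: algebra_simps)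
    qed
    ultimately have "(D has_vector_derivative 0) (at 0)" by simp
    from bounded_linear.has_vector_derivative[OF \<Phi>_bl this]
    have "((\<lambda>q. \<Phi> (D q)) has_vector_derivative 0) (at 0)" by (simp add: linear_0[OF \<open>linear \<Phi>\<close>])
    then have "\<forall>e>0. \<exists>r>0. \<forall>q. norm (q - 0) < r \<longrightarrow> norm (\<Phi> (D q) - \<Phi> (D 0) - (q - 0) *\<^sub>R 0) \<le> e * norm (q - 0)"
      unfolding has_vector_derivative_def has_derivative_at_alt by (rule conjunct2)
    then obtain \<rho> where \<rho>: "\<rho> > 0" "\<forall>q. norm (q - 0) < \<rho> \<longrightarrow> norm (\<Phi> (D q) - \<Phi> (D 0) - (q - 0) *\<^sub>R 0) \<le> e * norm (q - 0)"
      using e by blast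
    have D0: "D 0 = 0" by (simp add: D_def s'_def mexp_0 s_def)
    have \<Phi>0: "\<Phi> 0 = 0" by (rule linear_0[OF \<open>linear \<Phi>\<close>])
    show "\<exists>\<rho>>0. \<forall>q. 0 < q \<and> q < \<rho> \<longrightarrow> d (t + q) \<le> d t + e * q"
    proof (intro exI[of _ \<rho>] conjI allI impI \<rho>(1))
      fix q assume q: "0 < q \<and> q < \<rho>"
      have small: "norm (\<Phi> (D q)) \<le> e * q" using spec[OF \<rho>(2), of q] q by (simp add: D0 \<Phi>0)
      have split: "mexp ((t + q) *\<^sub>R X') *v v - s' q = mexp (q *\<^sub>R X') *v (mexp (t *\<^sub>R X') *v v - s) + D q"
        by (simp add: D_def matrix_vector_mult_diff_distrib mexp_add[OF X'd, of q t, unfolded add.commute[of q t]]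
            flip: matrix_vector_mul_assoc)
      have "d (t + q) \<le> dist (\<Phi> (mexp ((t + q) *\<^sub>R X') *v v)) (\<Phi> (s' q))"
        unfolding d_def using s'S q by (intro infdist_le) auto
      also have "\<dots> = norm (\<Phi> (mexp (q *\<^sub>R X') *v (mexp (t *\<^sub>R X') *v v - s)) + \<Phi> (D q))"
        unfolding dist_norm \<Phi>_diff[symmetric] split \<Phi>_add ..
      also have "\<dots> \<le> norm (\<Phi> (mexp (q *\<^sub>R X') *v (mexp (t *\<^sub>R X') *v v - s))) + norm (\<Phi> (D q))"
        by (rule norm_triangle_ineq)
      also have "\<dots> \<le> d t + e * q"
        unfolding dt using contraction[of q] small q by (intro add_mono) auto
      finally show "d (t + q) \<le> d t + e * q" .
    qed
  qed
  then have "infdist (\<Phi> (mexp X' *v v)) (\<Phi> ` S) = 0" using infdist_nonneg[of "\<Phi> (mexp X' *v v)" "\<Phi> ` S"] by (simp add: d_def)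
  then have "\<Phi> (mexp X' *v v) \<in> \<Phi> ` S" using in_closed_iff_infdist_zero[OF closed ne] by blast
  then obtain s where s: "s \<in> S" "\<Phi> (mexp X' *v v) = \<Phi> s" by blast
  have "norm (\<Phi> (mexp X' *v v - s)) = 0" using s(2) by (simp add: \<Phi>_diff)
  then have "Re (h (mexp X' *v v - s) (mexp X' *v v - s)) = 0" unfolding \<Phi>_norm by simp
  then have "mexp X' *v v = s" using positive[of "mexp X' *v v - s"] by force
  then have "mexp X' *v v \<in> S" using s(1) by simp
  then obtain x where x: "x \<in> {0..1} \<times> K" "mexp X' *v v = fst x *\<^sub>R (snd x *v v)"
    unfolding S_def by (elim imageE)
  define r k where "r = fst x" and "k = snd x"
  have rk: "k \<in> K" "mexp X' *v v = r *\<^sub>R (k *v v)" using x by (auto simp: r_def k_def)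
  have "mexp X *v v = exp \<Lambda> *\<^sub>R (mexp X' *v v)"
  proof (rule F.vector_eqI)
    fix j
    have "h (mexp X *v v) (f' j) = complex_of_real (exp (c j)) * h v (f' j)"
      using F.mexp_diagonal[of X "\<lambda>j. complex_of_real (c j)"] c by (simp add: F.diag_coordinate exp_of_real)
    moreover have "exp \<Lambda> * exp (c j - \<Lambda>) = exp (c j)" by (simp flip: exp_add)
    ultimately show "h (mexp X *v v) (f' j) = h (exp \<Lambda> *\<^sub>R (mexp X' *v v)) (f' j)"
      using flow[of 1 v j]
      by (simp only: scaleR_eq_vector_scalar scale_left scaleR_one mult_1 mult.assoc[symmetric] of_real_mult[symmetric])
  qed
  then have "mexp X *v v = complex_of_real (exp \<Lambda> * r) *s (k *v v)"
    unfolding rk(2) scaleR_scaleR scaleR_eq_vector_scalar by (simp add: vector_smult_assoc)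
  then show ?thesis using rk(1) by blast
qed

lemma K_transitive:
  assumes ex: "exposed \<beta> i" and v: "has_weight i v" "proj v \<in> \<O>" and w: "w \<noteq> 0" "proj w \<in> \<O>"
  shows "\<exists>c k. k \<in> K \<and> c \<noteq> 0 \<and> w = c *s (k *v v)"
proof -
  have v0: "v \<noteq> 0" using v by (simp add: has_weight_def)
  obtain g where g: "g \<in> G" "proj w = proj (g *v v)"
    using w(2) orbit_transitive[OF v(2) v0] by auto
  obtain c where c: "c \<noteq> 0" "w = c *s (g *v v)" by (rule proj_eqE[OF g(2) w(1)])
  obtain k X where kX: "k \<in> K" "X \<in> \<pp>" "g = k ** mexp X" using g(1) unfolding G_decompose by auto
  obtain r k' where rk: "k' \<in> K" "mexp X *v v = complex_of_real r *s (k' *v v)"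
    using mexp_p_in_K_orbit_cone[OF ex v(1) kX(2)] by (elim exE conjE)
  have w_eq: "w = (c * complex_of_real r) *s ((k ** k') *v v)"
    by (simp add: c(2) kX(3) rk(2) vector_scalar_commute vector_smult_assoc flip: matrix_vector_mul_assoc)
  then have "c * complex_of_real r \<noteq> 0" using w(1) by auto
  then show ?thesis using w_eq K_mult[OF kX(1) rk(1)] by blast
qed

end

section \<open>Exposed weights and the Weyl group\<close>

context maximal_abelian
begin

lemma rayleigh_K:
  assumes k: "k \<in> K" and c: "c \<noteq> 0"
  shows "rayleigh (c *s (k *v v)) Z = rayleigh v (Ad (matrix_inv k) Z)"
proof -
  have kinv: "invertible k" using k by (rule K_invertible)
  have "Z *v (k *v v) = k *v (Ad (matrix_inv k) Z *v v)"
    using Ad_intertwines[OF kinv, of "Ad (matrix_inv k) Z" v] by (simp add: Ad_matrix_inv[OF kinv])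
  then have "h (Z *v (c *s (k *v v))) (c *s (k *v v)) = c * cnj c * h (Ad (matrix_inv k) Z *v v) v"
    by (simp add: vector_scalar_commute scale_left scale_right K_unitary[OF k])
  moreover have "h (c *s (k *v v)) (c *s (k *v v)) = c * cnj c * h v v"
    by (simp add: scale_left scale_right K_unitary[OF k])
  moreover have "c * cnj c = complex_of_real ((cmod c)\<^sup>2)" by (rule complex_norm_square[symmetric])
  ultimately show ?thesis using c by (simp add: rayleigh_def del: of_real_power)
qed

lemma has_weight_rayleigh:
  assumes "has_weight i v" "Z \<in> \<aa>"
  shows "rayleigh v Z = weight i Z"
  using assms by (intro rayleigh_eigenvector) (simp_all add: has_weight_def)

text \<open>The curve \<open>exp(t X) l\<close> with \<open>X = [Ad l \<gamma>0, \<beta>]\<close> stays in the centralizer of \<open>M\<close>, and along it the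
  maximised function has derivative \<open>tr X\<^sup>2\<close> at \<open>t = 0\<close>.\<close>

lemma commutes_at_Ad_max:
  assumes l: "l \<in> K" "l ** M = M ** l" and \<gamma>0: "\<gamma>0 \<in> \<pp>" "\<gamma>0 ** M = M ** \<gamma>0"
    and \<beta>: "\<beta> \<in> \<pp>" "M ** \<beta> = \<beta> ** M"
    and max: "\<And>l'. l' \<in> K \<Longrightarrow> l' ** M = M ** l' \<Longrightarrow> trace_form (Ad l' \<gamma>0) \<beta> \<le> trace_form (Ad l \<gamma>0) \<beta>"
  shows "Ad l \<gamma>0 ** \<beta> = \<beta> ** Ad l \<gamma>0"
proof -
  define \<gamma> where "\<gamma> = Ad l \<gamma>0"
  define X where "X = lie_bracket \<gamma> \<beta>"
  have linv: "invertible l" using l(1) by (rule K_invertible)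
  have AdM: "Ad l M = M"
    by (simp add: Ad_def l(2) matrix_inv_cancel[OF linv] flip: matrix_mul_assoc)
  have \<gamma>p: "\<gamma> \<in> \<pp>" unfolding \<gamma>_def by (rule Ad_p[OF l(1) \<gamma>0(1)])
  have \<gamma>M: "\<gamma> ** M = M ** \<gamma>"
    using arg_cong[OF \<gamma>0(2), of "Ad l"] unfolding Ad_product[OF linv] AdM \<gamma>_def .
  have XK: "X \<in> lie_algebra K" unfolding X_def by (rule p_bracket_p[OF \<gamma>p \<beta>(1)])
  have Xskew: "skewadjoint X"
    unfolding X_def by (intro selfadjoint_commutator_skew p_selfadjoint \<gamma>p \<beta>(1))
  have Xd: "unitarily_diagonalizable X" using Xskew by (rule skewadjoint_diagonalizable)
  have MX: "M ** X = X ** M"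
  proof -
    have prod: "M ** (A ** B) = (A ** B) ** M" if A: "M ** A = A ** M" and B: "M ** B = B ** M" for A B
    proof -
      have "M ** (A ** B) = (M ** A) ** B" by (rule matrix_mul_assoc)
      also have "\<dots> = A ** (M ** B)" unfolding A by (rule matrix_mul_assoc[symmetric])
      also have "\<dots> = (A ** B) ** M" unfolding B by (rule matrix_mul_assoc)
      finally show ?thesis .
    qed
    show ?thesis
      unfolding X_def lie_bracket_def matrix_diff_mult
        prod[OF \<gamma>M[symmetric] \<beta>(2)] prod[OF \<beta>(2) \<gamma>M[symmetric]] ..
  qed
  define \<psi> where "\<psi> t = trace_form (mexp (t *\<^sub>R X) ** \<gamma> ** mexp (t *\<^sub>R (- X))) \<beta>" for t
  have \<psi>_eq: "\<psi> t = trace_form (Ad (mexp (t *\<^sub>R X) ** l) \<gamma>0) \<beta>" for t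
  proof -
    have "Ad (mexp (t *\<^sub>R X) ** l) \<gamma>0 = Ad (mexp (t *\<^sub>R X)) \<gamma>"
      unfolding \<gamma>_def by (rule Ad_mult[OF mexp_invertible[OF Xd] linv])
    then show ?thesis by (simp add: \<psi>_def Ad_def mexp_inverse(2)[OF Xd])
  qed
  have Xskew': "skewadjoint (t *\<^sub>R X)" for t
    using Xskew by (simp add: skewadjoint_def scaleR_matrix_vector scale_left scale_right)
  have "\<psi> t \<le> \<psi> 0" for t
  proof -
    have tX: "M ** (t *\<^sub>R X) = (t *\<^sub>R X) ** M" by (simp add: scaleR_matrix_mult MX)
    have "unitarily_diagonalizable (t *\<^sub>R X)"
      using Xskew' by (rule skewadjoint_diagonalizable)
    from mexp_commute[OF this tX] have comm: "M ** mexp (t *\<^sub>R X) = mexp (t *\<^sub>R X) ** M" .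
    have "(mexp (t *\<^sub>R X) ** l) ** M = mexp (t *\<^sub>R X) ** (l ** M)" by (rule matrix_mul_assoc[symmetric])
    also have "\<dots> = (mexp (t *\<^sub>R X) ** M) ** l" unfolding l(2) by (rule matrix_mul_assoc)
    also have "\<dots> = M ** (mexp (t *\<^sub>R X) ** l)" unfolding comm[symmetric] by (rule matrix_mul_assoc[symmetric])
    finally have "(mexp (t *\<^sub>R X) ** l) ** M = M ** (mexp (t *\<^sub>R X) ** l)" .
    then have "trace_form (Ad (mexp (t *\<^sub>R X) ** l) \<gamma>0) \<beta> \<le> trace_form (Ad l \<gamma>0) \<beta>"
      by (intro max K_mult mexp_k XK l(1))
    then show ?thesis using \<psi>_eq[of 0] by (simp add: \<psi>_eq mexp_0)
  qed
  moreover have "(\<psi> has_real_derivative trace_form (X ** \<gamma> - \<gamma> ** X) \<beta>) (at 0)"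
  proof -
    have "skewadjoint (- X)" using Xskew'[of "-1"] by simp
    then have 2: "((\<lambda>t. mexp (t *\<^sub>R (- X))) has_vector_derivative - X) (at 0)"
      by (intro mexp_derivative skewadjoint_diagonalizable)
    have 1: "((\<lambda>t. mexp (t *\<^sub>R X) ** \<gamma>) has_vector_derivative X ** \<gamma>) (at 0)"
      by (rule bounded_linear.has_vector_derivative[OF
            bounded_bilinear.bounded_linear_left[OF bounded_bilinear_matrix_mult] mexp_derivative[OF Xd]])
    have "((\<lambda>t. mexp (t *\<^sub>R X) ** \<gamma> ** mexp (t *\<^sub>R (- X))) has_vector_derivative
        (mexp (0 *\<^sub>R X) ** \<gamma> ** (- X) + X ** \<gamma> ** mexp (0 *\<^sub>R (- X)))) (at 0)"
      by (rule bounded_bilinear.has_vector_derivative[OF bounded_bilinear_matrix_mult 1 2])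
    moreover have "mexp (0 *\<^sub>R X) ** \<gamma> ** (- X) + X ** \<gamma> ** mexp (0 *\<^sub>R (- X)) = X ** \<gamma> - \<gamma> ** X"
      using matrix_diff_mult(2)[of \<gamma> 0 X] by (simp add: mexp_0)
    ultimately have 3: "((\<lambda>t. mexp (t *\<^sub>R X) ** \<gamma> ** mexp (t *\<^sub>R (- X))) has_vector_derivative X ** \<gamma> - \<gamma> ** X) (at 0)"
      by simp
    have "linear (\<lambda>Y. trace_form Y \<beta>)" by (rule linearI) (simp_all add: trace_form_add trace_form_scale)
    then have "bounded_linear (\<lambda>Y. trace_form Y \<beta>)" using linear_conv_bounded_linear by blast
    from bounded_linear.has_vector_derivative[OF this 3]
    show ?thesis unfolding \<psi>_def[abs_def] has_real_derivative_iff_has_vector_derivative .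
  qed
  ultimately have "trace_form (X ** \<gamma> - \<gamma> ** X) \<beta> = 0"
    by (intro DERIV_local_max[where d=1]) auto
  then have "trace_form X X = 0"
    using trace_form_bracket[of X \<gamma> \<beta>] by (simp add: X_def lie_bracket_def)
  then have "X = 0" by (rule trace_form_skewadjoint_eq_0[OF Xskew])
  then show ?thesis by (simp add: X_def lie_bracket_def \<gamma>_def)
qed

text \<open>The inverse is recorded next to each element, which makes the maximised function visibly
  continuous on a compact set.\<close>

lemma exists_Ad_max:
  obtains l where "l \<in> K" "l ** M = M ** l"
    "\<forall>l'\<in>K. l' ** M = M ** l' \<longrightarrow> trace_form (Ad l' \<gamma>) \<beta> \<le> trace_form (Ad l \<gamma>) \<beta>"
proof -
  define L where "L = (K \<times> K) \<inter> {x. fst x ** snd x = mat 1} \<inter> {x. fst x ** M = M ** fst x}"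
  define \<psi> where "\<psi> x = trace_form (fst x ** \<gamma> ** snd x) \<beta>" for x
  have "closed {x :: 'n cmat \<times> 'n cmat. fst x ** snd x = mat 1}"
    by (intro closed_Collect_eq continuous_matrix_mult continuous_on_fst continuous_on_snd
        continuous_on_id continuous_on_const)
  moreover have "closed {x :: 'n cmat \<times> 'n cmat. fst x ** M = M ** fst x}"
    by (intro closed_Collect_eq continuous_matrix_mult continuous_on_fst continuous_on_id continuous_on_const)
  ultimately have "compact L"
    unfolding L_def by (intro compact_Int_closed compact_Times compact_K)
  moreover have "(mat 1, mat 1) \<in> L" using K_one by (simp add: L_def)
  then have "L \<noteq> {}" by blast
  moreover have "continuous_on L \<psi>"
    unfolding \<psi>_def trace_form_def
    by (intro continuous_on_Re bounded_linear.continuous_on[OF bounded_linear_trace] continuous_matrix_mult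
        continuous_on_fst continuous_on_snd continuous_on_id continuous_on_const)
  ultimately have "\<exists>x\<in>L. \<forall>y\<in>L. \<psi> y \<le> \<psi> x" by (rule continuous_attains_sup)
  then obtain x where x: "x \<in> L" "\<forall>y\<in>L. \<psi> y \<le> \<psi> x" by (elim bexE)
  have Ad: "Ad (fst y) \<gamma> = fst y ** \<gamma> ** snd y" if "y \<in> L" for y
    using that matrix_inv_unique[of "fst y" "snd y"] by (simp add: L_def Ad_def)
  have pair: "(l', matrix_inv l') \<in> L" if "l' \<in> K" "l' ** M = M ** l'" for l'
    using that K_inv matrix_inv_cancel(1)[OF K_invertible[OF that(1)]] by (simp add: L_def)
  show ?thesis
  proof (rule that[of "fst x"])
    show "fst x \<in> K" "fst x ** M = M ** fst x" using x(1) by (auto simp: L_def)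
    show "\<forall>l'\<in>K. l' ** M = M ** l' \<longrightarrow> trace_form (Ad l' \<gamma>) \<beta> \<le> trace_form (Ad (fst x) \<gamma>) \<beta>"
    proof (intro ballI impI)
      fix l' assume l': "l' \<in> K" "l' ** M = M ** l'"
      have "\<psi> (l', matrix_inv l') \<le> \<psi> x" using x(2) pair[OF l'] by blast
      then show "trace_form (Ad l' \<gamma>) \<beta> \<le> trace_form (Ad (fst x) \<gamma>) \<beta>"
        using Ad[OF pair[OF l']] Ad[OF x(1)] by (simp add: \<psi>_def)
    qed
  qed
qed

text \<open>Every element of \<open>\<aa>\<close> commutes with \<open>Ad n \<beta>0\<close>, whose centralizer in \<open>\<pp>\<close> is \<open>Ad n \<aa>\<close>. So \<open>Ad n \<aa>\<close> is
  an Abelian subalgebra of \<open>\<pp>\<close> that contains \<open>\<aa>\<close>.\<close>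

lemma normalizer_from_regular:
  assumes n: "n \<in> K" and \<beta>0: "regular \<beta>0" and mem: "Ad n \<beta>0 \<in> \<aa>"
  shows "n \<in> normalizer_in K \<aa>"
proof -
  have ninv: "invertible n" using n by (rule K_invertible)
  define a' where "a' = Ad n ` \<aa>"
  have "subspace a'" unfolding a'_def by (rule linear_subspace_image[OF linear_Ad a_subspace])
  moreover have "a' \<subseteq> \<pp>" unfolding a'_def using Ad_p[OF n] a_subset_p by blast
  moreover have "lie_bracket X Y = 0" if X: "X \<in> a'" and Y: "Y \<in> a'" for X Y
  proof -
    obtain X0 where X0: "X0 \<in> \<aa>" "X = Ad n X0" using X by (auto simp: a'_def)
    obtain Y0 where Y0: "Y0 \<in> \<aa>" "Y = Ad n Y0" using Y by (auto simp: a'_def)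
    have "X ** Y = Y ** X"
      unfolding X0(2) Y0(2) Ad_product[OF ninv, symmetric] a_commute[OF X0(1) Y0(1)] ..
    then show ?thesis by (simp add: lie_bracket_def)
  qed
  ultimately have "abelian_subalgebra a' \<pp>" by (simp add: abelian_subalgebra_def)
  moreover have "\<aa> \<subseteq> a'"
  proof
    fix Z assume Z: "Z \<in> \<aa>"
    define Z' where "Z' = Ad (matrix_inv n) Z"
    have inv': "invertible (matrix_inv n)" using K_invertible[OF K_inv[OF n]] .
    have "Z ** Ad n \<beta>0 = Ad n \<beta>0 ** Z" by (rule a_commute[OF Z mem])
    from arg_cong[OF this, of "Ad (matrix_inv n)"] have "Z' ** \<beta>0 = \<beta>0 ** Z'"
      unfolding Ad_product[OF inv'] Ad_matrix_inv(2)[OF ninv] Z'_def .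
    moreover have "Z' \<in> \<pp>" unfolding Z'_def using Ad_p[OF K_inv[OF n] a_subset_p[OF Z]] .
    ultimately have "Z' \<in> \<aa>" by (intro regular_centralizer[OF \<beta>0])
    moreover have "Z = Ad n Z'" by (simp add: Z'_def Ad_matrix_inv[OF ninv])
    ultimately show "Z \<in> a'" unfolding a'_def by (rule rev_image_eqI)
  qed
  ultimately have "a' = \<aa>" using maximal by (simp add: maximal_abelian_subalgebra_def)
  then show ?thesis using n by (simp add: normalizer_in_def a'_def)
qed

lemma weight_point_eqI:
  assumes "x \<in> \<aa>" "\<And>Z. Z \<in> \<aa> \<Longrightarrow> ip x Z = weight i Z"
  shows "weight_point i = x"
  using assms weight_point by (intro A.ip_unique) auto

lemma normalizer_Ad:
  assumes "n \<in> normalizer_in K \<aa>"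
  shows "n \<in> K" "Z \<in> \<aa> \<Longrightarrow> Ad n Z \<in> \<aa>" "Z \<in> \<aa> \<Longrightarrow> Ad (matrix_inv n) Z \<in> \<aa>"
proof -
  show n: "n \<in> K" using assms by (simp add: normalizer_in_def)
  have eq: "Ad n ` \<aa> = \<aa>" using assms by (simp add: normalizer_in_def)
  show "Ad n Z \<in> \<aa>" if "Z \<in> \<aa>" using eq that by blast
  show "Ad (matrix_inv n) Z \<in> \<aa>" if Z: "Z \<in> \<aa>"
  proof -
    obtain Z0 where "Z0 \<in> \<aa>" "Z = Ad n Z0" using eq Z by blast
    then show ?thesis by (simp add: Ad_matrix_inv[OF K_invertible[OF n]])
  qed
qed

lemma ip_Ad_adjoint:
  assumes "k \<in> K" "X \<in> \<pp>" "Z \<in> \<pp>"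
  shows "ip (Ad k X) Z = ip X (Ad (matrix_inv k) Z)"
  using ip_Ad[OF assms(1,2) Ad_p[OF K_inv[OF assms(1)] assms(3)]]
  by (simp add: Ad_matrix_inv[OF K_invertible[OF assms(1)]])

text \<open>Let \<open>v\<close> and \<open>w = c k v\<close> be exposed weight vectors in the orbit. The gradients \<open>M\<close> at \<open>v\<close> and
  \<open>M' = Ad k M\<close> at \<open>w\<close> commute with the respective regular elements. Rotating \<open>Ad k \<beta>\<^sub>0\<close> inside the
  centralizer of \<open>M'\<close> in \<open>K\<close> as close as possible to \<open>\<beta>\<close> makes it commute with \<open>\<beta>\<close>, so the rotation
  composed with \<open>k\<close> normalizes \<open>\<aa>\<close>; it still carries \<open>M\<close> to \<open>M'\<close>.\<close>

lemma exposed_weights_conjugate: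
  assumes ex0: "exposed \<beta>0 i" and ex: "exposed \<beta> j"
  shows "\<exists>n\<in>normalizer_in K \<aa>. weight_point j = Ad n (weight_point i)"
proof -
  have reg0: "regular \<beta>0" and reg: "regular \<beta>" using ex0 ex by (simp_all only: exposed_def)
  have \<beta>0: "\<beta>0 \<in> \<aa>" and \<beta>: "\<beta> \<in> \<aa>" using reg0 reg by (simp_all add: regular_mem)
  obtain v where v: "has_weight i v" "proj v \<in> \<O>"
    using exposed_weight_in_orbit[OF ex0] by (elim exE conjE)
  obtain w where w: "has_weight j w" "proj w \<in> \<O>"
    using exposed_weight_in_orbit[OF ex] by (elim exE conjE)
  have w0: "w \<noteq> 0" using w(1) by (simp add: has_weight_def)
  obtain c k where ck: "k \<in> K" "c \<noteq> 0" "w = c *s (k *v v)"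
    using K_transitive[OF ex0 v w0 w(2)] by (elim exE conjE)
  have kinv: "invertible k" using ck(1) by (rule K_invertible)
  have "\<exists>!M. M \<in> \<pp> \<and> (\<forall>Z\<in>\<pp>. trace_form M Z = rayleigh v Z)"
    by (rule T.representing_vector) (simp_all add: rayleigh_add rayleigh_scale)
  then obtain M where M: "M \<in> \<pp>" "\<And>Z. Z \<in> \<pp> \<Longrightarrow> trace_form M Z = rayleigh v Z" by blast
  define M' where "M' = Ad k M"
  have M'p: "M' \<in> \<pp>" unfolding M'_def by (rule Ad_p[OF ck(1) M(1)])
  have M': "trace_form M' Z = rayleigh w Z" if "Z \<in> \<pp>" for Z
    unfolding M'_def ck(3) rayleigh_K[OF ck(1,2)] trace_form_Ad[OF kinv]
    by (rule M(2)[OF Ad_p[OF K_inv[OF ck(1)] that]])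
  have "\<beta>0 *v v = complex_of_real (weight i \<beta>0) *s v" using v(1) \<beta>0 by (simp add: has_weight_def)
  from gradient_commutes[OF M a_subset_p[OF \<beta>0] this] have M\<beta>0: "M ** \<beta>0 = \<beta>0 ** M" .
  have "\<beta> *v w = complex_of_real (weight j \<beta>) *s w" using w(1) \<beta> by (simp add: has_weight_def)
  from gradient_commutes[OF M'p M' a_subset_p[OF \<beta>] this] have M'\<beta>: "M' ** \<beta> = \<beta> ** M'" .
  define \<gamma>0 where "\<gamma>0 = Ad k \<beta>0"
  have \<gamma>0p: "\<gamma>0 \<in> \<pp>" unfolding \<gamma>0_def by (rule Ad_p[OF ck(1) a_subset_p[OF \<beta>0]])
  have \<gamma>0M': "\<gamma>0 ** M' = M' ** \<gamma>0"
    unfolding \<gamma>0_def M'_def Ad_product[OF kinv, symmetric] M\<beta>0 ..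
  obtain l where l: "l \<in> K" "l ** M' = M' ** l"
      and max: "\<forall>l'\<in>K. l' ** M' = M' ** l' \<longrightarrow> trace_form (Ad l' \<gamma>0) \<beta> \<le> trace_form (Ad l \<gamma>0) \<beta>"
    by (rule exists_Ad_max)
  have linv: "invertible l" using l(1) by (rule K_invertible)
  have "Ad l \<gamma>0 ** \<beta> = \<beta> ** Ad l \<gamma>0"
    by (rule commutes_at_Ad_max[OF l \<gamma>0p \<gamma>0M' a_subset_p[OF \<beta>] M'\<beta>]) (use max in blast)
  then have mem: "Ad l \<gamma>0 \<in> \<aa>" by (rule regular_centralizer[OF reg Ad_p[OF l(1) \<gamma>0p]])
  define n where "n = l ** k"
  have nK: "n \<in> K" unfolding n_def by (rule K_mult[OF l(1) ck(1)])
  have Adn: "Ad n Y = Ad l (Ad k Y)" for Y unfolding n_def by (rule Ad_mult[OF linv kinv])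
  have norm: "n \<in> normalizer_in K \<aa>"
    by (rule normalizer_from_regular[OF nK reg0]) (use mem in \<open>simp add: Adn \<gamma>0_def\<close>)
  have AdM: "Ad n M = M'"
    unfolding Adn M'_def[symmetric]
    by (simp add: Ad_def l(2) matrix_inv_cancel[OF linv] flip: matrix_mul_assoc)
  have "weight_point j = Ad n (weight_point i)"
  proof (rule weight_point_eqI)
    show "Ad n (weight_point i) \<in> \<aa>" by (rule normalizer_Ad(2)[OF norm weight_point(1)])
    fix Z assume Z: "Z \<in> \<aa>"
    have Z': "Ad (matrix_inv n) Z \<in> \<aa>" by (rule normalizer_Ad(3)[OF norm Z])
    have "ip (Ad n (weight_point i)) Z = weight i (Ad (matrix_inv n) Z)"
      using ip_Ad_adjoint[OF nK a_subset_p[OF weight_point(1)] a_subset_p[OF Z]] weight_point(2)[OF Z'] by simp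
    also have "\<dots> = trace_form M (Ad (matrix_inv n) Z)"
      using has_weight_rayleigh[OF v(1) Z'] M(2)[OF a_subset_p[OF Z']] by simp
    also have "\<dots> = trace_form M' Z"
      unfolding AdM[symmetric] by (rule trace_form_Ad[OF K_invertible[OF nK], symmetric])
    also have "\<dots> = weight j Z"
      using M'[OF a_subset_p[OF Z]] has_weight_rayleigh[OF w(1) Z] by simp
    finally show "ip (Ad n (weight_point i)) Z = weight j Z" .
  qed
  then show ?thesis using norm by blast
qed

text \<open>A functional that separates a point from the exposed weights may be perturbed to a regular one,
  and the weight where this one is maximal is exposed.\<close>

lemma convex_hull_exposed:
  "convex hull (range weight_point) = convex hull (weight_point ` {i. \<exists>\<beta>. exposed \<beta> i})"
proof
  let ?E = "weight_point ` {i. \<exists>\<beta>. exposed \<beta> i}"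
  show "convex hull ?E \<subseteq> convex hull (range weight_point)" by (intro hull_mono) blast
  have sub: "range weight_point \<subseteq> \<aa>" using weight_point(1) by blast
  have hull_a: "convex hull (range weight_point) \<subseteq> \<aa>"
    by (rule hull_minimal) (rule sub, rule subspace_imp_convex[OF a_subspace])
  show "convex hull (range weight_point) \<subseteq> convex hull ?E"
  proof (rule ccontr)
    assume "\<not> ?thesis"
    then obtain x where x: "x \<in> convex hull (range weight_point)" "x \<notin> convex hull ?E" by blast
    have xa: "x \<in> \<aa>" using x(1) hull_a by blast
    have finE: "finite ?E" by simp
    then have "compact (convex hull ?E)" by (intro compact_convex_hull finite_imp_compact)
    then have "closed (convex hull ?E)" by (rule compact_imp_closed)
    from separating_hyperplane_closed_point[OF convex_convex_hull this x(2)]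
    obtain z b where z: "z \<bullet> x < b" "\<forall>y\<in>convex hull ?E. b < z \<bullet> y" by (elim exE conjE)
    have "\<exists>!\<beta>. \<beta> \<in> \<aa> \<and> (\<forall>y\<in>\<aa>. ip \<beta> y = - z \<bullet> y)"
      by (rule A.representing_vector) (simp_all add: inner_add_right)
    then obtain \<beta>1 where \<beta>1: "\<beta>1 \<in> \<aa>" "\<forall>y\<in>\<aa>. ip \<beta>1 y = - z \<bullet> y" by blast
    define C where "C = (\<lambda>y. x - y) ` ?E"
    define D where "D = (\<lambda>(i, j). weight_point i - weight_point j) ` UNIV - {0}"
    have diff_a: "weight_point i - weight_point j \<in> \<aa>" for i j
      using subspace_diff[OF a_subspace weight_point(1) weight_point(1)] .
    have 1: "finite D" "D \<subseteq> \<aa> - {0}" using diff_a by (auto simp: D_def)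
    have 2: "finite C" "C \<subseteq> \<aa>" using finE subspace_diff[OF a_subspace xa weight_point(1)] by (auto simp: C_def)
    have 3: "\<forall>c\<in>C. ip c \<beta>1 > 0"
    proof
      fix c assume "c \<in> C"
      then obtain y where y: "y \<in> ?E" "c = x - y" by (auto simp: C_def)
      have "z \<bullet> x < z \<bullet> y" using z hull_inc[OF y(1), of convex] by fastforce
      moreover have "y \<in> \<aa>" using y(1) weight_point(1) by auto
      moreover have "ip c \<beta>1 = ip \<beta>1 c"
        using A.ip_sym \<beta>1(1) 2(2) \<open>c \<in> C\<close> by blast
      ultimately show "ip c \<beta>1 > 0"
        using \<beta>1 xa subspace_diff[OF a_subspace xa \<open>y \<in> \<aa>\<close>] by (simp add: y(2) inner_diff_right)
    qed
    obtain \<beta> where \<beta>: "\<beta> \<in> \<aa>" "\<forall>c\<in>C. ip c \<beta> > 0" "\<forall>d\<in>D. ip d \<beta> \<noteq> 0"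
      using A.generic_perturbation[OF 1 2 \<beta>1(1) 3] by (elim bexE conjE)
    have reg: "regular \<beta>"
      unfolding regular_def
    proof (intro conjI allI impI \<beta>(1))
      fix i j assume eq: "weight i \<beta> = weight j \<beta>"
      have "ip (weight_point i - weight_point j) \<beta> = 0"
        using A.ip_diff[OF weight_point(1) weight_point(1) \<beta>(1), of i j] weight_point(2)[OF \<beta>(1)] eq by simp
      then have "weight_point i - weight_point j \<notin> D" using \<beta>(3) by blast
      then show "weight_point i = weight_point j" by (auto simp: D_def)
    qed
    have "Max (range (\<lambda>i. weight i \<beta>)) \<in> range (\<lambda>i. weight i \<beta>)" by (intro Max_in) auto
    then obtain m where m: "Max (range (\<lambda>i. weight i \<beta>)) = weight m \<beta>" by (rule imageE)
    have top: "weight j \<beta> \<le> weight m \<beta>" for j unfolding m[symmetric] by (intro Max_ge) auto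
    have "exposed \<beta> m" unfolding exposed_def using reg top by blast
    then have "weight_point m \<in> ?E" by blast
    then have "x - weight_point m \<in> C" unfolding C_def by (rule imageI)
    then have "ip (x - weight_point m) \<beta> > 0" using \<beta>(2) by blast
    then have gt: "weight m \<beta> < ip x \<beta>"
      using A.ip_diff[OF xa weight_point(1) \<beta>(1)] weight_point(2)[OF \<beta>(1)] by simp
    obtain c where c: "x = (\<Sum>i\<in>UNIV. c i *\<^sub>R weight_point i)" "\<forall>i. 0 \<le> c i" "sum c UNIV = 1"
      using x(1) unfolding convex_hull_range by blast
    have "ip x \<beta> = (\<Sum>i\<in>UNIV. c i * weight i \<beta>)" unfolding c(1) by (rule ip_convex_combination[OF \<beta>(1)])
    also have "\<dots> \<le> (\<Sum>i\<in>UNIV. c i * weight m \<beta>)" using c(2) top by (intro sum_mono mult_left_mono) auto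
    also have "\<dots> = weight m \<beta>" using c(3) by (simp flip: sum_distrib_right)
    finally show False using gt by simp
  qed
qed

lemma weyl_orbit_eq: "weyl_orbit K \<aa> x = (\<lambda>n. Ad n x) ` normalizer_in K \<aa>" if x: "x \<in> \<aa>"
proof
  show "weyl_orbit K \<aa> x \<subseteq> (\<lambda>n. Ad n x) ` normalizer_in K \<aa>"
  proof
    fix y assume "y \<in> weyl_orbit K \<aa> x"
    then obtain n c where nc: "n \<in> normalizer_in K \<aa>" "c \<in> centralizer_in K \<aa>" "y = Ad (n ** c) x"
      by (auto simp: weyl_orbit_def weyl_group_def)
    have "Ad c x = x" "c \<in> K" using nc(2) x by (auto simp: centralizer_in_def)
    then have "y = Ad n x" using nc Ad_mult[OF K_invertible[OF normalizer_Ad(1)[OF nc(1)]] K_invertible] by simp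
    then show "y \<in> (\<lambda>n. Ad n x) ` normalizer_in K \<aa>" using nc(1) by blast
  qed
  have one: "mat 1 \<in> centralizer_in K \<aa>"
    using K_one matrix_inv_unique[of "mat 1" "mat 1 :: 'n cmat"] by (simp add: centralizer_in_def Ad_def)
  show "(\<lambda>n. Ad n x) ` normalizer_in K \<aa> \<subseteq> weyl_orbit K \<aa> x"
  proof
    fix y assume "y \<in> (\<lambda>n. Ad n x) ` normalizer_in K \<aa>"
    then obtain n where n: "n \<in> normalizer_in K \<aa>" "y = Ad n x" by blast
    have "n \<in> (\<lambda>c. n ** c) ` centralizer_in K \<aa>" by (rule image_eqI[OF _ one]) simp
    then show "y \<in> weyl_orbit K \<aa> x"
      unfolding weyl_orbit_def weyl_group_def using n by blast
  qed
qed

text \<open>The Weyl group permutes the weights: \<open>n *v f i\<close> is a weight vector for the transported weight.\<close>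

lemma weyl_orbit_in_image:
  assumes n: "n \<in> normalizer_in K \<aa>"
  shows "Ad n (weight_point i) \<in> convex hull (range weight_point)"
proof -
  have nK: "n \<in> K" by (rule normalizer_Ad(1)[OF n])
  have n0: "1 *s (n *v f i) \<noteq> 0"
    using invertible_vector_nonzero[OF K_invertible[OF nK] frame_nonzero] by simp
  have "moment (1 *s (n *v f i)) = Ad n (weight_point i)"
  proof (rule moment_eqI[OF n0 normalizer_Ad(2)[OF n weight_point(1)]])
    fix Z assume Z: "Z \<in> \<aa>"
    have Z': "Ad (matrix_inv n) Z \<in> \<aa>" by (rule normalizer_Ad(3)[OF n Z])
    show "ip (Ad n (weight_point i)) Z = rayleigh (1 *s (n *v f i)) Z"
      unfolding rayleigh_K[OF nK one_neq_zero]
        ip_Ad_adjoint[OF nK a_subset_p[OF weight_point(1)] a_subset_p[OF Z]] weight_point(2)[OF Z']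
      by (rule rayleigh_eigenvector[OF frame_nonzero weight_vector[OF Z'], symmetric])
  qed
  moreover have "proj (1 *s (n *v f i)) \<in> PV" using n0 by (auto simp: PV_def)
  ultimately show ?thesis unfolding image_PV[symmetric] moment_def by (metis imageI)
qed

theorem image_is_weyl_polytope:
  "\<exists>x\<in>\<aa>. A_gradient_map h ip \<pp> \<aa> ` PV = convex hull (weyl_orbit K \<aa> x)"
proof -
  let ?E = "{i. \<exists>\<beta>. exposed \<beta> i}"
  have "convex hull (weight_point ` ?E) \<noteq> {}" unfolding convex_hull_exposed[symmetric] by simp
  then have "?E \<noteq> {}" by auto
  then obtain i \<beta>0 where i: "exposed \<beta>0 i" by blast
  let ?x = "weight_point i"
  have "convex hull (weight_point ` ?E) \<subseteq> convex hull (weyl_orbit K \<aa> ?x)"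
  proof (rule hull_mono, rule subsetI)
    fix y assume "y \<in> weight_point ` ?E"
    then obtain j \<beta> where "y = weight_point j" "exposed \<beta> j" by blast
    then show "y \<in> weyl_orbit K \<aa> ?x"
      using exposed_weights_conjugate[OF i] unfolding weyl_orbit_eq[OF weight_point(1)] by blast
  qed
  moreover have "convex hull (weyl_orbit K \<aa> ?x) \<subseteq> convex hull (range weight_point)"
  proof (rule hull_minimal)
    show "weyl_orbit K \<aa> ?x \<subseteq> convex hull (range weight_point)"
      unfolding weyl_orbit_eq[OF weight_point(1)] using weyl_orbit_in_image by blast
  qed (rule convex_convex_hull)
  ultimately have "convex hull (range weight_point) = convex hull (weyl_orbit K \<aa> ?x)"
    unfolding convex_hull_exposed[symmetric] by (rule equalityI)
  then show ?thesis unfolding image_PV using weight_point(1) by blast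
qed

end

theorem proposition1:
  fixes G K \<pp> \<aa> :: "(complex^'n::finite^'n) set"
    and h :: "complex^'n \<Rightarrow> complex^'n \<Rightarrow> complex"
    and ip :: "complex^'n^'n \<Rightarrow> complex^'n^'n \<Rightarrow> real"
    and \<O> \<O>' :: "(complex^'n) set set"
  assumes "matrix_group G" and "closed G" and "G \<subseteq> SL"
    and "connected G" and "\<not> compact G"
    and "semisimple_lie_algebra (lie_algebra G)" and "finite (group_center G)"
    and "irreducible_action G"
    and "maximal_compact_subgroup K G"
    and "cartan_decomposition (lie_algebra G) (lie_algebra K) \<pp>"
    and "hermitian_scalar_product h"
    and "compatible h G K \<pp>"
    and "Ad_invariant_scalar_product K \<pp> ip"
    and "is_closed_orbit (zariski_closure_SL G) \<O>'"
    and "is_closed_orbit G \<O>" and "\<O> \<subseteq> \<O>'"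
    and "abelian_subalgebra \<aa> \<pp>"
  shows "A_gradient_map h ip \<pp> \<aa> ` PV = A_gradient_map h ip \<pp> \<aa> ` \<O> \<and>
    (maximal_abelian_subalgebra \<aa> \<pp> \<longrightarrow>
      (\<exists>x\<in>\<aa>. A_gradient_map h ip \<pp> \<aa> ` PV = convex hull (weyl_orbit K \<aa> x)))"
proof -
  have K: "matrix_group K" "compact K" using assms(9) by (simp_all add: maximal_compact_subgroup_def)
  interpret compatible_group h G K \<pp>
    by (unfold_locales; fact)
  have sa: "selfadjoint Z" if "Z \<in> \<aa>" for Z
    using assms(17) that p_selfadjoint unfolding abelian_subalgebra_def by blast
  have comm: "Z ** Z' = Z' ** Z" if "Z \<in> \<aa>" "Z' \<in> \<aa>" for Z Z'
    using assms(17) that by (simp add: abelian_subalgebra_def lie_bracket_def)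
  obtain f :: "'n \<Rightarrow> complex^'n" and l :: "'n \<Rightarrow> 'n cmat \<Rightarrow> real"
    where f: "\<forall>i j. h (f i) (f j) = (if i = j then 1 else 0)"
      and l: "\<forall>Z\<in>\<aa>. \<forall>i. Z *v f i = complex_of_real (l i Z) *s f i"
    by (rule spectral_theorem[OF sa comm])
  interpret closed_orbit h G K \<pp> f \<aa> ip \<O>
  proof unfold_locales
    show "h (f i) (f j) = (if i = j then 1 else 0)" for i j using f by simp
    show "abelian_subalgebra \<aa> \<pp>" "Ad_invariant_scalar_product K \<pp> ip" "is_closed_orbit G \<O>" by fact+
    show "\<exists>r. Z *v f i = complex_of_real r *s f i" if "Z \<in> \<aa>" for Z i using l that by blast
  qed
  show ?thesis
  proof (intro conjI impI image_orbit)
    assume "maximal_abelian_subalgebra \<aa> \<pp>"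
    then interpret maximal_abelian h G K \<pp> f \<aa> ip \<O> by unfold_locales
    show "\<exists>x\<in>\<aa>. A_gradient_map h ip \<pp> \<aa> ` PV = convex hull (weyl_orbit K \<aa> x)"
      by (rule image_is_weyl_polytope)
  qed
qed

end
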